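(* Let $A$ be a separable Fell algebra, and let $\{a_i:i\in\mathbb{N}\}\subset A$ be a set of abelian norm-one elements which generate $A$ as an ideal. Let $\mathcal{K}=\mathcal{K}(\ell^2(\mathbb{N}))$, and denote the canonical matrix units in $\mathcal{K}$ by $\{\Theta_{ij}:i,j\in\mathbb{N}\}$. Set $$a:=\sum_{i=1}^\infty\frac1i\,a_i\otimes\Theta_{ii}\in A\otimes\mathcal{K}.$$ Then: (1) the hereditary subalgebra $C:=\overline{a(A\otimes\mathcal{K})a}$ generated by $a$ is Morita equivalent to $A$; (2) $D:=\bigoplus_{i\in\mathbb{N}}\overline{a_iAa_i}\otimes\Theta_{ii}$ is a C*-diagonal in $C$, i.e. $(C,D)$ is a diagonal pair; and (3) the conditional expectation $P:C\to D$ is given by $P(c)=\bigoplus_i(1\otimes\Theta_{ii})c(1\otimes\Theta_{ii})$.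
   Context: A C*-algebra $A$ is a Fell algebra if for every irreducible representation $\pi_0$ of $A$ there are a positive $b\in A$ and a neighbourhood $U$ of $[\pi_0]$ in the spectrum $\widehat A$ such that $\pi(b)$ is a rank-one projection whenever $[\pi]\in U$. A positive element $a\in A$ is abelian if the hereditary C*-subalgebra $\overline{aAa}$ is commutative. Here $\mathbb{N}=\{1,2,\dots\}$. For a separable C*-algebra $C$ and abelian C*-subalgebra $D$, a normaliser of $D$ is $n\in C$ with $n^*Dn\subset D$ and $nDn^*\subset D$; it is free if $n^2=0$; $N_f(D)$ is the set of free normalisers. $(C,D)$ is a diagonal pair ($D$ is a C*-diagonal in $C$) if (D1) $D$ contains an approximate identity for $C$; (D2) there is a faithful conditional expectation $P:C\to D$ (a linear, norm-decreasing, positive map with $P|_D=\mathrm{id}$, $P(cd)=P(c)d$, $P(dc)=dP(c)$, and $P(c^*c)=0\Rightarrow c=0$); (D3) $\ker P=\overline{\mathrm{span}}\,N_f(D)$. For a diagonal pair the conditional expectation $C\to D$ is unique. *)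

theory Defs
  imports "HOL-Analysis.Analysis"
begin

section \<open>Complex vector spaces and C*-algebras\<close>

class complex_vector = real_vector +
  fixes scaleC :: "complex \<Rightarrow> 'a \<Rightarrow> 'a"  (infixr \<open>*\<^sub>C\<close> 75)
  assumes scaleC_add_right: "c *\<^sub>C (x + y) = c *\<^sub>C x + c *\<^sub>C y"
    and scaleC_add_left: "(c + d) *\<^sub>C x = c *\<^sub>C x + d *\<^sub>C x"
    and scaleC_scaleC: "c *\<^sub>C d *\<^sub>C x = (c * d) *\<^sub>C x"
    and scaleC_of_real: "complex_of_real r *\<^sub>C x = r *\<^sub>R x"

lemma scaleC_one [simp]: "1 *\<^sub>C x = (x :: 'a::complex_vector)"
  using scaleC_of_real[of 1 x] by simp

class complex_normed_vector = complex_vector + real_normed_vector +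
  assumes norm_scaleC: "norm (c *\<^sub>C x) = cmod c * norm x"

global_interpretation complex_vector: vector_space "scaleC :: complex \<Rightarrow> 'a \<Rightarrow> 'a::complex_vector"
  defines cdependent = complex_vector.dependent
    and csubspace = complex_vector.subspace
    and cspan = complex_vector.span
    and cdim = complex_vector.dim
  by unfold_locales (auto simp: scaleC_add_right scaleC_add_left scaleC_scaleC)

definition clinear :: "('a::complex_vector \<Rightarrow> 'b::complex_vector) \<Rightarrow> bool" where
  "clinear f \<longleftrightarrow> (\<forall>x y. f (x + y) = f x + f y) \<and> (\<forall>c x. f (c *\<^sub>C x) = c *\<^sub>C f x)"

text \<open>C*-algebras need not be unital; the algebra \<open>{0}\<close> is allowed.\<close>

class cstar_algebra = complex_normed_vector + real_normed_algebra + banach +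
  fixes adj :: "'a \<Rightarrow> 'a"  (\<open>(_\<^sup>\<star>)\<close> [1000] 999)
  assumes mult_scaleC_left: "(c *\<^sub>C x) * y = c *\<^sub>C (x * y)"
    and mult_scaleC_right: "x * (c *\<^sub>C y) = c *\<^sub>C (x * y)"
    and adj_adj: "(x\<^sup>\<star>)\<^sup>\<star> = x"
    and adj_add: "(x + y)\<^sup>\<star> = x\<^sup>\<star> + y\<^sup>\<star>"
    and adj_scaleC: "(c *\<^sub>C x)\<^sup>\<star> = cnj c *\<^sub>C x\<^sup>\<star>"
    and adj_mult: "(x * y)\<^sup>\<star> = y\<^sup>\<star> * x\<^sup>\<star>"
    and cstar_identity: "norm (x\<^sup>\<star> * x) = (norm x)\<^sup>2"

definition cstar_subalgebra :: "'a::cstar_algebra set \<Rightarrow> bool" where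
  "cstar_subalgebra S \<longleftrightarrow> csubspace S \<and> closed S \<and>
     (\<forall>x\<in>S. \<forall>y\<in>S. x * y \<in> S) \<and> (\<forall>x\<in>S. x\<^sup>\<star> \<in> S)"

definition commutative_on :: "'a::cstar_algebra set \<Rightarrow> bool" where
  "commutative_on S \<longleftrightarrow> (\<forall>x\<in>S. \<forall>y\<in>S. x * y = y * x)"

definition closed_ideal :: "'a::cstar_algebra set \<Rightarrow> bool" where
  "closed_ideal J \<longleftrightarrow> csubspace J \<and> closed J \<and> (\<forall>x\<in>J. \<forall>y. x * y \<in> J \<and> y * x \<in> J)"

definition positive_in :: "'a::cstar_algebra set \<Rightarrow> 'a \<Rightarrow> bool" where
  "positive_in S a \<longleftrightarrow> (\<exists>x\<in>S. a = x\<^sup>\<star> * x)"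

definition hereditary_subalgebra :: "'a::cstar_algebra \<Rightarrow> 'a set" where
  "hereditary_subalgebra a = closure (range (\<lambda>x. a * x * a))"

definition abelian_element :: "'a::cstar_algebra \<Rightarrow> bool" where
  "abelian_element a \<longleftrightarrow> positive_in UNIV a \<and> commutative_on (hereditary_subalgebra a)"


section \<open>The Hilbert spaces \<open>\<ell>\<^sup>2\<close> and their operators\<close>

typedef 'i ell2 = "{f :: 'i \<Rightarrow> complex. (\<lambda>i. (cmod (f i))\<^sup>2) summable_on UNIV}"
  by (rule exI[of _ "\<lambda>_. 0"]) simp

setup_lifting type_definition_ell2

lemma ell2_summable_mult:
  assumes "(\<lambda>i. (cmod (f i))\<^sup>2) summable_on UNIV" "(\<lambda>i. (cmod (g i))\<^sup>2) summable_on UNIV"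
  shows "(\<lambda>i. cmod (f i) * cmod (g i)) summable_on UNIV"
proof (rule summable_on_comparison_test)
  show "(\<lambda>i. (cmod (f i))\<^sup>2 + (cmod (g i))\<^sup>2) summable_on UNIV"
    using assms by (rule summable_on_add)
  fix i
  have "2 * (cmod (f i) * cmod (g i)) \<le> (cmod (f i))\<^sup>2 + (cmod (g i))\<^sup>2"
    using sum_squares_bound[of "cmod (f i)" "cmod (g i)"] by (simp add: mult.assoc)
  moreover have "0 \<le> cmod (f i) * cmod (g i)"
    by simp
  ultimately show "cmod (f i) * cmod (g i) \<le> (cmod (f i))\<^sup>2 + (cmod (g i))\<^sup>2"
    by linarith
qed simp

lemma ell2_summable_add:
  assumes "(\<lambda>i. (cmod (f i))\<^sup>2) summable_on UNIV" "(\<lambda>i. (cmod (g i))\<^sup>2) summable_on UNIV"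
  shows "(\<lambda>i. (cmod (f i + g i))\<^sup>2) summable_on UNIV"
proof (rule summable_on_comparison_test)
  show "(\<lambda>i. (cmod (f i))\<^sup>2 + (cmod (g i))\<^sup>2 + 2 * (cmod (f i) * cmod (g i))) summable_on UNIV"
    by (intro summable_on_add summable_on_cmult_right ell2_summable_mult assms)
  fix i
  have "(cmod (f i + g i))\<^sup>2 \<le> (cmod (f i) + cmod (g i))\<^sup>2"
    by (intro power_mono norm_triangle_ineq norm_ge_zero)
  then show "(cmod (f i + g i))\<^sup>2 \<le> (cmod (f i))\<^sup>2 + (cmod (g i))\<^sup>2 + 2 * (cmod (f i) * cmod (g i))"
    by (simp add: power2_sum algebra_simps)
qed simp

lemma ell2_summable_scale:
  assumes "(\<lambda>i. (cmod (f i))\<^sup>2) summable_on UNIV"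
  shows "(\<lambda>i. (cmod (c * f i))\<^sup>2) summable_on UNIV"
  using summable_on_cmult_right[OF assms, of "(cmod c)\<^sup>2"]
  by (simp add: norm_mult power_mult_distrib)

instantiation ell2 :: (type) complex_vector
begin

lift_definition zero_ell2 :: "'a ell2" is "\<lambda>_. 0" by simp
lift_definition plus_ell2 :: "'a ell2 \<Rightarrow> 'a ell2 \<Rightarrow> 'a ell2" is "\<lambda>f g i. f i + g i"
  by (rule ell2_summable_add)
lift_definition uminus_ell2 :: "'a ell2 \<Rightarrow> 'a ell2" is "\<lambda>f i. - f i" by simp
lift_definition minus_ell2 :: "'a ell2 \<Rightarrow> 'a ell2 \<Rightarrow> 'a ell2" is "\<lambda>f g i. f i - g i"
  subgoal for f g using ell2_summable_add[of f "\<lambda>i. - g i"] by simp done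
lift_definition scaleC_ell2 :: "complex \<Rightarrow> 'a ell2 \<Rightarrow> 'a ell2" is "\<lambda>c f i. c * f i"
  by (rule ell2_summable_scale)
lift_definition scaleR_ell2 :: "real \<Rightarrow> 'a ell2 \<Rightarrow> 'a ell2" is "\<lambda>r f i. complex_of_real r * f i"
  by (rule ell2_summable_scale)

instance
  by standard (transfer; simp add: fun_eq_iff algebra_simps)+

end

text \<open>The inner product is conjugate-linear in its first argument.\<close>

lift_definition cinner :: "'i ell2 \<Rightarrow> 'i ell2 \<Rightarrow> complex" is
  "\<lambda>f g. \<Sum>\<^sub>\<infinity>i. cnj (f i) * g i" .

lemma cinner_summable: "(\<lambda>i. cnj (Rep_ell2 x i) * Rep_ell2 y i) summable_on UNIV"
  by (rule abs_summable_summable)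
    (use ell2_summable_mult[of "Rep_ell2 x" "Rep_ell2 y"] Rep_ell2[of x] Rep_ell2[of y]
      in \<open>simp add: norm_mult\<close>)

lemma cinner_add_left: "cinner (x + y) z = cinner x z + cinner y z"
proof -
  have "cinner (x + y) z =
      (\<Sum>\<^sub>\<infinity>i. cnj (Rep_ell2 x i) * Rep_ell2 z i + cnj (Rep_ell2 y i) * Rep_ell2 z i)"
    by (simp add: cinner.rep_eq plus_ell2.rep_eq ring_distribs)
  then show ?thesis
    by (simp add: cinner.rep_eq infsum_add cinner_summable)
qed

lemma cinner_scaleC_left: "cinner (c *\<^sub>C x) y = cnj c * cinner x y"
  by (simp add: cinner.rep_eq scaleC_ell2.rep_eq infsum_cmult_right' mult.assoc)

lemma cinner_commute: "cinner x y = cnj (cinner y x)"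
  by (simp add: cinner.rep_eq mult.commute flip: infsum_cnj)

lemma cinner_self: "cinner x x = complex_of_real (\<Sum>\<^sub>\<infinity>i. (cmod (Rep_ell2 x i))\<^sup>2)"
proof -
  have "(\<lambda>i. cnj (Rep_ell2 x i) * Rep_ell2 x i) = (\<lambda>i. complex_of_real ((cmod (Rep_ell2 x i))\<^sup>2))"
    by (rule ext) (simp only: complex_norm_square mult.commute)
  moreover have "((\<lambda>i. complex_of_real ((cmod (Rep_ell2 x i))\<^sup>2)) has_sum
      complex_of_real (\<Sum>\<^sub>\<infinity>i. (cmod (Rep_ell2 x i))\<^sup>2)) UNIV"
    using Rep_ell2[of x] by (intro has_sum_of_real has_sum_infsum) simp
  ultimately show ?thesis
    by (simp only: cinner.rep_eq infsumI)
qed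

instantiation ell2 :: (type) real_inner
begin

definition inner_ell2 :: "'a ell2 \<Rightarrow> 'a ell2 \<Rightarrow> real" where
  "inner_ell2 x y = Re (cinner x y)"
definition norm_ell2 :: "'a ell2 \<Rightarrow> real" where
  "norm_ell2 x = sqrt (inner x x)"
definition dist_ell2 :: "'a ell2 \<Rightarrow> 'a ell2 \<Rightarrow> real" where
  "dist_ell2 x y = norm (x - y)"
definition sgn_ell2 :: "'a ell2 \<Rightarrow> 'a ell2" where
  "sgn_ell2 x = x /\<^sub>R norm x"
definition uniformity_ell2 :: "('a ell2 \<times> 'a ell2) filter" where
  "uniformity_ell2 = (INF e\<in>{0<..}. principal {(x, y). dist x y < e})"
definition open_ell2 :: "'a ell2 set \<Rightarrow> bool" where
  "open_ell2 U \<longleftrightarrow> (\<forall>x\<in>U. eventually (\<lambda>(x', y). x' = x \<longrightarrow> y \<in> U) uniformity)"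

instance
proof
  fix x y z :: "'a ell2" and r :: real
  show "inner x y = inner y x"
    using cinner_commute[of x y] by (simp add: inner_ell2_def)
  show "inner (x + y) z = inner x z + inner y z"
    by (simp add: inner_ell2_def cinner_add_left)
  show "inner (r *\<^sub>R x) y = r * inner x y"
    by (simp add: inner_ell2_def cinner_scaleC_left flip: scaleC_of_real)
  show "0 \<le> inner x x"
    by (simp add: inner_ell2_def cinner_self infsum_nonneg)
  show "inner x x = 0 \<longleftrightarrow> x = 0"
  proof
    assume "inner x x = 0"
    then have "(\<Sum>\<^sub>\<infinity>i. (cmod (Rep_ell2 x i))\<^sup>2) \<le> 0"
      by (simp add: inner_ell2_def cinner_self)
    then have "(cmod (Rep_ell2 x i))\<^sup>2 = 0" for i
      using Rep_ell2[of x] by (intro nonneg_infsum_le_0D[where A = UNIV]) auto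
    then have "Rep_ell2 x = (\<lambda>_. 0)"
      by auto
    then show "x = 0"
      by (simp add: Rep_ell2_inject[symmetric] zero_ell2.rep_eq)
  next
    assume "x = 0"
    then show "inner x x = 0"
      by (simp add: inner_ell2_def cinner_self zero_ell2.rep_eq)
  qed
qed (rule norm_ell2_def dist_ell2_def sgn_ell2_def uniformity_ell2_def open_ell2_def)+

end

instance ell2 :: (type) complex_normed_vector
proof
  fix c :: complex and x :: "'a ell2"
  have "(norm (c *\<^sub>C x))\<^sup>2 = (cmod c * norm x)\<^sup>2"
  proof -
    have "cinner (c *\<^sub>C x) (c *\<^sub>C x) = complex_of_real ((cmod c)\<^sup>2) * cinner x x"
      unfolding cinner_self
      by (simp add: scaleC_ell2.rep_eq norm_mult power_mult_distrib infsum_cmult_right')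
    then show ?thesis
      by (simp add: power2_norm_eq_inner inner_ell2_def power_mult_distrib)
  qed
  then show "norm (c *\<^sub>C x) = cmod c * norm x"
    by (simp add: power2_eq_iff_nonneg)
qed

text \<open>Bounded operators are elements of the library type of bounded \<^emph>\<open>real\<close>-linear maps, with
  complex linearity imposed separately.\<close>

lemma bounded_linear_scaleC:
  "bounded_linear f \<Longrightarrow> bounded_linear (\<lambda>x. c *\<^sub>C (f x :: 'b::complex_normed_vector))"
proof -
  have "bounded_linear (\<lambda>y::'b. c *\<^sub>C y)"
    by (rule bounded_linear_intro[of _ "cmod c"])
      (simp_all add: scaleC_add_right scaleC_scaleC norm_scaleC mult.commute flip: scaleC_of_real)
  then show "bounded_linear f \<Longrightarrow> bounded_linear (\<lambda>x. c *\<^sub>C f x)"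
    by (rule bounded_linear_compose)
qed

instantiation blinfun :: (real_normed_vector, complex_normed_vector) complex_normed_vector
begin

lift_definition scaleC_blinfun :: "complex \<Rightarrow> ('a \<Rightarrow>\<^sub>L 'b) \<Rightarrow> 'a \<Rightarrow>\<^sub>L 'b" is "\<lambda>c f x. c *\<^sub>C f x"
  by (rule bounded_linear_scaleC)

instance
proof
  fix c d :: complex and f g :: "'a \<Rightarrow>\<^sub>L 'b" and r :: real
  show "c *\<^sub>C (f + g) = c *\<^sub>C f + c *\<^sub>C g" "(c + d) *\<^sub>C f = c *\<^sub>C f + d *\<^sub>C f"
    "c *\<^sub>C d *\<^sub>C f = (c * d) *\<^sub>C f" "complex_of_real r *\<^sub>C f = r *\<^sub>R f"
    by (transfer; simp add: fun_eq_iff scaleC_add_right scaleC_add_left scaleC_scaleC scaleC_of_real)+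
  show "norm (c *\<^sub>C f) = cmod c * norm f"
  proof (transfer fixing: c)
    fix f :: "'a \<Rightarrow> 'b"
    assume f: "bounded_linear f"
    show "onorm (\<lambda>x. c *\<^sub>C f x) = cmod c * onorm f"
    proof -
      have "onorm (\<lambda>x. cmod c *\<^sub>R f x) = \<bar>cmod c\<bar> * onorm f"
        by (rule onorm_scaleR[OF f])
      then show ?thesis
        by (simp only: onorm_def norm_scaleC norm_scaleR abs_norm_cancel)
    qed
  qed
qed

end

type_synonym 'i operator = "'i ell2 \<Rightarrow>\<^sub>L 'i ell2"

definition adjoint_pair :: "'i operator \<Rightarrow> 'i operator \<Rightarrow> bool" where
  "adjoint_pair T S \<longleftrightarrow> (\<forall>u v. cinner (T u) v = cinner u (S v))"

definition compact_operators :: "'i operator set" where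
  "compact_operators = {T. clinear (blinfun_apply T) \<and> compact (closure (T ` cball 0 1))}"

definition rank_one_projection :: "'i operator \<Rightarrow> bool" where
  "rank_one_projection T \<longleftrightarrow> T o\<^sub>L T = T \<and> adjoint_pair T T \<and> cdim (range (blinfun_apply T)) = 1"

lift_definition ell2_basis :: "'i \<Rightarrow> 'i ell2" is "\<lambda>i j. if j = i then 1 else 0"
proof -
  fix i :: 'i
  have "(\<lambda>j. (cmod (if j = i then 1 else 0))\<^sup>2) summable_on {i}"
    by simp
  then show "(\<lambda>j. (cmod (if j = i then 1 else 0))\<^sup>2) summable_on UNIV"
    by (rule summable_on_cong_neutral[THEN iffD1, rotated -1]) auto
qed

lemma cinner_ell2_basis: "cinner (ell2_basis j) x = Rep_ell2 x j"
proof -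
  have "cinner (ell2_basis j) x = (\<Sum>\<^sub>\<infinity>i\<in>{j}. Rep_ell2 x i)"
    unfolding cinner.rep_eq ell2_basis.rep_eq by (rule infsum_cong_neutral) auto
  then show ?thesis
    by simp
qed

lemma norm_ell2_coordinate: "cmod (Rep_ell2 x j) \<le> norm x"
proof -
  have "(\<Sum>\<^sub>\<infinity>i\<in>{j}. (cmod (Rep_ell2 x i))\<^sup>2) \<le> (\<Sum>\<^sub>\<infinity>i. (cmod (Rep_ell2 x i))\<^sup>2)"
    using Rep_ell2[of x] by (intro infsum_mono_neutral) auto
  then have "(cmod (Rep_ell2 x j))\<^sup>2 \<le> (norm x)\<^sup>2"
    by (simp add: power2_norm_eq_inner inner_ell2_def cinner_self)
  then show ?thesis
    by (simp add: power2_le_iff_abs_le)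
qed

lift_definition matrix_unit :: "'i \<Rightarrow> 'i \<Rightarrow> 'i operator"  (\<open>\<Theta>\<close>) is
  "\<lambda>i j x. cinner (ell2_basis j) x *\<^sub>C ell2_basis i"
proof (rule bounded_linear_intro)
  fix i j :: 'i and x y :: "'i ell2" and r :: real
  show "cinner (ell2_basis j) (x + y) *\<^sub>C ell2_basis i =
      cinner (ell2_basis j) x *\<^sub>C ell2_basis i + cinner (ell2_basis j) y *\<^sub>C ell2_basis i"
    by (simp add: cinner_ell2_basis plus_ell2.rep_eq scaleC_add_left)
  show "cinner (ell2_basis j) (r *\<^sub>R x) *\<^sub>C ell2_basis i =
      r *\<^sub>R (cinner (ell2_basis j) x *\<^sub>C ell2_basis i)"
    by (simp only: cinner_ell2_basis scaleR_ell2.rep_eq scaleC_scaleC[symmetric] scaleC_of_real)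
  show "norm (cinner (ell2_basis j) x *\<^sub>C ell2_basis i) \<le> norm x * norm (ell2_basis i)"
    by (simp add: cinner_ell2_basis norm_scaleC mult_right_mono norm_ell2_coordinate)
qed


section \<open>Representations, spectrum and Fell algebras\<close>

text \<open>A representation of \<open>A\<close> on a Hilbert space \<open>H\<close> is modelled with \<open>H\<close> a closed subspace of
  \<open>\<ell>\<^sup>2(A)\<close>, and with \<open>B(H)\<close> identified with the operators on \<open>\<ell>\<^sup>2(A)\<close> that map into \<open>H\<close> and vanish on
  the orthogonal complement of \<open>H\<close> (the latter because the adjoint of \<open>\<pi> x\<close> also maps into \<open>H\<close>).
  Every irreducible representation of \<open>A\<close> is unitarily equivalent to one of this form: it is cyclic,
  so its Hilbert space has an orthonormal basis of cardinality at most that of \<open>A\<close>.\<close>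

type_synonym 'a rep = "'a ell2 set \<times> ('a \<Rightarrow> 'a operator)"

definition cstar_representation :: "'a::cstar_algebra rep \<Rightarrow> bool" where
  "cstar_representation = (\<lambda>(H, \<pi>).
     csubspace H \<and> closed H \<and>
     (\<forall>x. clinear (blinfun_apply (\<pi> x)) \<and> range (blinfun_apply (\<pi> x)) \<subseteq> H) \<and>
     clinear \<pi> \<and>
     (\<forall>x y. \<pi> (x * y) = \<pi> x o\<^sub>L \<pi> y) \<and>
     (\<forall>x. adjoint_pair (\<pi> x) (\<pi> (x\<^sup>\<star>))))"

definition irreducible_rep :: "'a::cstar_algebra rep \<Rightarrow> bool" where
  "irreducible_rep = (\<lambda>(H, \<pi>).
     cstar_representation (H, \<pi>) \<and> (\<exists>x. \<pi> x \<noteq> 0) \<and>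
     (\<forall>M. csubspace M \<and> closed M \<and> M \<subseteq> H \<and> (\<forall>x. \<forall>v\<in>M. \<pi> x v \<in> M) \<longrightarrow> M = {0} \<or> M = H))"

definition unitarily_equivalent :: "('a::cstar_algebra rep \<times> 'a rep) set" where
  "unitarily_equivalent = {((H, \<pi>), (H', \<pi>')). \<exists>U :: 'a ell2 \<Rightarrow> 'a ell2.
     bij_betw U H H' \<and>
     (\<forall>u\<in>H. \<forall>v\<in>H. U (u + v) = U u + U v) \<and>
     (\<forall>c. \<forall>u\<in>H. U (c *\<^sub>C u) = c *\<^sub>C U u) \<and>
     (\<forall>u\<in>H. \<forall>v\<in>H. cinner (U u) (U v) = cinner u v) \<and>
     (\<forall>x. \<forall>u\<in>H. U (blinfun_apply (\<pi> x) u) = blinfun_apply (\<pi>' x) (U u))}"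

definition rep_class :: "'a::cstar_algebra rep \<Rightarrow> 'a rep set" where
  "rep_class r = unitarily_equivalent `` {r} \<inter> {r'. irreducible_rep r'}"

definition spectrum :: "'a::cstar_algebra rep set set" where
  "spectrum = rep_class ` {r. irreducible_rep r}"

text \<open>The Jacobson topology. The generating family is already closed under finite intersections and
  arbitrary unions, so it is the family of open sets.\<close>

definition spectrum_topology :: "'a::cstar_algebra rep set topology" where
  "spectrum_topology = topology_generated_by
     {{p \<in> spectrum. \<exists>(H, \<pi>)\<in>p. \<exists>x\<in>J. \<pi> x \<noteq> 0} | J :: 'a set. closed_ideal J}"

definition fell_algebra :: "'a::cstar_algebra itself \<Rightarrow> bool" where
  "fell_algebra _ \<longleftrightarrow> (\<forall>r0 :: 'a rep. irreducible_rep r0 \<longrightarrow>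
     (\<exists>b U V. positive_in UNIV b \<and>
        openin spectrum_topology V \<and> rep_class r0 \<in> V \<and> V \<subseteq> U \<and>
        (\<forall>H \<pi>. irreducible_rep (H, \<pi>) \<and> rep_class (H, \<pi>) \<in> U \<longrightarrow> rank_one_projection (\<pi> b))))"


section \<open>Tensor products with the compact operators\<close>

text \<open>\<open>B\<close> together with \<open>(a, k) \<mapsto> a \<otimes> k\<close> is a completion of the algebraic tensor product of \<open>A\<close> and
  \<open>\<K>(\<ell>\<^sup>2)\<close> in a C*-norm. As \<open>\<K>(\<ell>\<^sup>2)\<close> is nuclear this determines \<open>B\<close> up to isomorphism.  The
  third-last clause says that the norm is a cross norm (which every C*-norm is), the second-last that
  the algebraic tensor product embeds, and the last that its image is dense. Elements of \<open>A\<close> are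
  tensored only with compact operators; \<open>tensor\<close> is unconstrained elsewhere.\<close>

definition tensor_with_compacts ::
    "('a::cstar_algebra \<Rightarrow> 'i operator \<Rightarrow> 'b::cstar_algebra) \<Rightarrow> bool" where
  "tensor_with_compacts tensor \<longleftrightarrow>
     (\<forall>k\<in>compact_operators. clinear (\<lambda>a. tensor a k)) \<and>
     (\<forall>a. \<forall>k\<in>compact_operators. \<forall>l\<in>compact_operators. tensor a (k + l) = tensor a k + tensor a l) \<and>
     (\<forall>a c. \<forall>k\<in>compact_operators. tensor a (c *\<^sub>C k) = c *\<^sub>C tensor a k) \<and>
     (\<forall>a b. \<forall>k\<in>compact_operators. \<forall>l\<in>compact_operators.
        tensor a k * tensor b l = tensor (a * b) (k o\<^sub>L l)) \<and>
     (\<forall>a. \<forall>k\<in>compact_operators. \<forall>l\<in>compact_operators.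
        adjoint_pair k l \<longrightarrow> (tensor a k)\<^sup>\<star> = tensor (a\<^sup>\<star>) l) \<and>
     (\<forall>a. \<forall>k\<in>compact_operators. norm (tensor a k) = norm a * norm k) \<and>
     (\<forall>F f. finite F \<and> F \<subseteq> compact_operators \<and> \<not> cdependent F \<and> (\<Sum>k\<in>F. tensor (f k) k) = 0 \<longrightarrow>
        (\<forall>k\<in>F. f k = 0)) \<and>
     closure (cspan {tensor a k | a k. k \<in> compact_operators}) = UNIV"

text \<open>Multipliers of \<open>B\<close> as double centralizers: \<open>(L, R)\<close> stands for \<open>m\<close> with \<open>m y = L y\<close> and
  \<open>y m = R y\<close>.\<close>

definition double_centralizer ::
    "('b::cstar_algebra \<Rightarrow> 'b) \<times> ('b \<Rightarrow> 'b) \<Rightarrow> bool" where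
  "double_centralizer = (\<lambda>(L, R). clinear L \<and> bounded_linear L \<and> clinear R \<and> bounded_linear R \<and>
     (\<forall>x y. L (x * y) = L x * y \<and> R (x * y) = x * R y \<and> R x * y = x * L y))"

definition one_tensor ::
    "('a::cstar_algebra \<Rightarrow> 'i operator \<Rightarrow> 'b::cstar_algebra) \<Rightarrow> 'i operator \<Rightarrow> ('b \<Rightarrow> 'b) \<times> ('b \<Rightarrow> 'b)" where
  "one_tensor tensor T = (THE (L, R). double_centralizer (L, R) \<and>
     (\<forall>a. \<forall>k\<in>compact_operators. L (tensor a k) = tensor a (T o\<^sub>L k) \<and> R (tensor a k) = tensor a (k o\<^sub>L T)))"

definition compress :: "('b \<Rightarrow> 'b) \<times> ('b \<Rightarrow> 'b) \<Rightarrow> 'b \<Rightarrow> 'b" where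
  "compress m c = fst m (snd m c)"


section \<open>Morita equivalence\<close>

locale complex_vector_carrier =
  fixes X :: "'x set"
    and vadd :: "'x \<Rightarrow> 'x \<Rightarrow> 'x"
    and vzero :: 'x
    and vscale :: "complex \<Rightarrow> 'x \<Rightarrow> 'x"
  assumes vadd_closed: "\<lbrakk>x \<in> X; y \<in> X\<rbrakk> \<Longrightarrow> vadd x y \<in> X"
    and vzero_closed: "vzero \<in> X"
    and vscale_closed: "x \<in> X \<Longrightarrow> vscale c x \<in> X"
    and vadd_assoc: "\<lbrakk>x \<in> X; y \<in> X; z \<in> X\<rbrakk> \<Longrightarrow> vadd (vadd x y) z = vadd x (vadd y z)"
    and vadd_commute: "\<lbrakk>x \<in> X; y \<in> X\<rbrakk> \<Longrightarrow> vadd x y = vadd y x"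
    and vadd_zero: "x \<in> X \<Longrightarrow> vadd x vzero = x"
    and vadd_inverse: "x \<in> X \<Longrightarrow> \<exists>y\<in>X. vadd x y = vzero"
    and vscale_add_right: "\<lbrakk>x \<in> X; y \<in> X\<rbrakk> \<Longrightarrow> vscale c (vadd x y) = vadd (vscale c x) (vscale c y)"
    and vscale_add_left: "x \<in> X \<Longrightarrow> vscale (c + d) x = vadd (vscale c x) (vscale d x)"
    and vscale_vscale: "x \<in> X \<Longrightarrow> vscale c (vscale d x) = vscale (c * d) x"
    and vscale_one: "x \<in> X \<Longrightarrow> vscale 1 x = x"
begin

definition vdiff :: "'x \<Rightarrow> 'x \<Rightarrow> 'x" where
  "vdiff x y = vadd x (vscale (- 1) y)"

definition complete_wrt :: "('x \<Rightarrow> real) \<Rightarrow> bool" where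
  "complete_wrt N \<longleftrightarrow> (\<forall>f :: nat \<Rightarrow> 'x. range f \<subseteq> X \<and>
     (\<forall>e>0. \<exists>n0. \<forall>m\<ge>n0. \<forall>n\<ge>n0. N (vdiff (f m) (f n)) < e) \<longrightarrow>
     (\<exists>x\<in>X. (\<lambda>n. N (vdiff (f n) x)) \<longlonglongrightarrow> 0))"

end

text \<open>The inner product of a left Hilbert module is linear in its first variable, that of a right
  Hilbert module in its second.\<close>

locale full_left_hilbert_module = complex_vector_carrier X vadd vzero vscale
  for S :: "'a::cstar_algebra set"
    and X :: "'x set" and vadd vzero vscale +
  fixes lact :: "'a \<Rightarrow> 'x \<Rightarrow> 'x"
    and linner :: "'x \<Rightarrow> 'x \<Rightarrow> 'a"
  assumes lact_closed: "\<lbrakk>a \<in> S; x \<in> X\<rbrakk> \<Longrightarrow> lact a x \<in> X"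
    and lact_add_left: "\<lbrakk>a \<in> S; b \<in> S; x \<in> X\<rbrakk> \<Longrightarrow> lact (a + b) x = vadd (lact a x) (lact b x)"
    and lact_add_right: "\<lbrakk>a \<in> S; x \<in> X; y \<in> X\<rbrakk> \<Longrightarrow> lact a (vadd x y) = vadd (lact a x) (lact a y)"
    and lact_scale_left: "\<lbrakk>a \<in> S; x \<in> X\<rbrakk> \<Longrightarrow> lact (c *\<^sub>C a) x = vscale c (lact a x)"
    and lact_scale_right: "\<lbrakk>a \<in> S; x \<in> X\<rbrakk> \<Longrightarrow> lact a (vscale c x) = vscale c (lact a x)"
    and lact_mult: "\<lbrakk>a \<in> S; b \<in> S; x \<in> X\<rbrakk> \<Longrightarrow> lact (a * b) x = lact a (lact b x)"
    and linner_closed: "\<lbrakk>x \<in> X; y \<in> X\<rbrakk> \<Longrightarrow> linner x y \<in> S"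
    and linner_add: "\<lbrakk>x \<in> X; y \<in> X; z \<in> X\<rbrakk> \<Longrightarrow> linner (vadd x y) z = linner x z + linner y z"
    and linner_scale: "\<lbrakk>x \<in> X; y \<in> X\<rbrakk> \<Longrightarrow> linner (vscale c x) y = c *\<^sub>C linner x y"
    and linner_lact: "\<lbrakk>a \<in> S; x \<in> X; y \<in> X\<rbrakk> \<Longrightarrow> linner (lact a x) y = a * linner x y"
    and linner_adj: "\<lbrakk>x \<in> X; y \<in> X\<rbrakk> \<Longrightarrow> (linner x y)\<^sup>\<star> = linner y x"
    and linner_positive: "x \<in> X \<Longrightarrow> positive_in S (linner x x)"
    and linner_definite: "\<lbrakk>x \<in> X; linner x x = 0\<rbrakk> \<Longrightarrow> x = vzero"
    and left_complete: "complete_wrt (\<lambda>x. sqrt (norm (linner x x)))"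
    and left_full: "closure (cspan {linner x y | x y. x \<in> X \<and> y \<in> X}) = S"

locale full_right_hilbert_module = complex_vector_carrier X vadd vzero vscale
  for T :: "'b::cstar_algebra set"
    and X :: "'x set" and vadd vzero vscale +
  fixes ract :: "'x \<Rightarrow> 'b \<Rightarrow> 'x"
    and rinner :: "'x \<Rightarrow> 'x \<Rightarrow> 'b"
  assumes ract_closed: "\<lbrakk>x \<in> X; b \<in> T\<rbrakk> \<Longrightarrow> ract x b \<in> X"
    and ract_add_left: "\<lbrakk>x \<in> X; y \<in> X; b \<in> T\<rbrakk> \<Longrightarrow> ract (vadd x y) b = vadd (ract x b) (ract y b)"
    and ract_add_right: "\<lbrakk>x \<in> X; b \<in> T; d \<in> T\<rbrakk> \<Longrightarrow> ract x (b + d) = vadd (ract x b) (ract x d)"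
    and ract_scale_left: "\<lbrakk>x \<in> X; b \<in> T\<rbrakk> \<Longrightarrow> ract (vscale c x) b = vscale c (ract x b)"
    and ract_scale_right: "\<lbrakk>x \<in> X; b \<in> T\<rbrakk> \<Longrightarrow> ract x (c *\<^sub>C b) = vscale c (ract x b)"
    and ract_mult: "\<lbrakk>x \<in> X; b \<in> T; d \<in> T\<rbrakk> \<Longrightarrow> ract x (b * d) = ract (ract x b) d"
    and rinner_closed: "\<lbrakk>x \<in> X; y \<in> X\<rbrakk> \<Longrightarrow> rinner x y \<in> T"
    and rinner_add: "\<lbrakk>x \<in> X; y \<in> X; z \<in> X\<rbrakk> \<Longrightarrow> rinner x (vadd y z) = rinner x y + rinner x z"
    and rinner_scale: "\<lbrakk>x \<in> X; y \<in> X\<rbrakk> \<Longrightarrow> rinner x (vscale c y) = c *\<^sub>C rinner x y"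
    and rinner_ract: "\<lbrakk>x \<in> X; y \<in> X; b \<in> T\<rbrakk> \<Longrightarrow> rinner x (ract y b) = rinner x y * b"
    and rinner_adj: "\<lbrakk>x \<in> X; y \<in> X\<rbrakk> \<Longrightarrow> (rinner x y)\<^sup>\<star> = rinner y x"
    and rinner_positive: "x \<in> X \<Longrightarrow> positive_in T (rinner x x)"
    and rinner_definite: "\<lbrakk>x \<in> X; rinner x x = 0\<rbrakk> \<Longrightarrow> x = vzero"
    and right_complete: "complete_wrt (\<lambda>x. sqrt (norm (rinner x x)))"
    and right_full: "closure (cspan {rinner x y | x y. x \<in> X \<and> y \<in> X}) = T"

locale imprimitivity_bimodule =
  full_left_hilbert_module S X vadd vzero vscale lact linner +
  full_right_hilbert_module T X vadd vzero vscale ract rinner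
  for S :: "'a::cstar_algebra set" and T :: "'b::cstar_algebra set"
    and X :: "'x set" and vadd vzero vscale lact ract linner rinner +
  assumes lact_ract: "\<lbrakk>a \<in> S; x \<in> X; b \<in> T\<rbrakk> \<Longrightarrow> ract (lact a x) b = lact a (ract x b)"
    and rinner_lact: "\<lbrakk>a \<in> S; x \<in> X; y \<in> X\<rbrakk> \<Longrightarrow> rinner (lact a x) y = rinner x (lact (a\<^sup>\<star>) y)"
    and linner_ract: "\<lbrakk>x \<in> X; y \<in> X; b \<in> T\<rbrakk> \<Longrightarrow> linner (ract x b) y = linner x (ract y (b\<^sup>\<star>))"
    and linner_rinner: "\<lbrakk>x \<in> X; y \<in> X; z \<in> X\<rbrakk> \<Longrightarrow> lact (linner x y) z = ract x (rinner y z)"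

text \<open>Taking the underlying set of the bimodule inside \<open>'a \<times> 'b\<close> is no restriction: an
  \<open>S\<close>-\<open>T\<close>-imprimitivity bimodule \<open>X\<close> has cardinality at most that of \<open>S \<times> T\<close>. By factorisation
  \<open>X = X T\<close>, and for fixed \<open>b \<in> T\<close> fullness makes \<open>b\<close> a limit of finite sums of elements
  \<open>rinner y z\<close>, so that \<open>x b\<close> is determined by countably many elements \<open>linner x y\<close> of \<open>S\<close>;
  finally \<open>S\<close>, being a Banach space, has as many elements as countable sequences of elements.\<close>

definition morita_equivalent :: "'a::cstar_algebra set \<Rightarrow> 'b::cstar_algebra set \<Rightarrow> bool" where
  "morita_equivalent S T \<longleftrightarrow> cstar_subalgebra S \<and> cstar_subalgebra T \<and>
     (\<exists>(X :: ('a \<times> 'b) set) vadd vzero vscale lact ract linner rinner.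
        imprimitivity_bimodule S T X vadd vzero vscale lact ract linner rinner)"


section \<open>Diagonal pairs\<close>

definition free_normalisers :: "'b::cstar_algebra set \<Rightarrow> 'b set \<Rightarrow> 'b set" where
  "free_normalisers C D =
     {n \<in> C. (\<forall>d\<in>D. n\<^sup>\<star> * d * n \<in> D \<and> n * d * n\<^sup>\<star> \<in> D) \<and> n * n = 0}"

text \<open>Nets in \<open>D\<close> are represented by filters on the algebra.\<close>

definition contains_approximate_identity :: "'b::cstar_algebra set \<Rightarrow> 'b set \<Rightarrow> bool" where
  "contains_approximate_identity C D \<longleftrightarrow> (\<exists>F :: 'b filter. F \<noteq> bot \<and>
     eventually (\<lambda>e. positive_in D e \<and> norm e \<le> 1) F \<and>
     (\<forall>c\<in>C. ((\<lambda>e. e * c) \<longlongrightarrow> c) F \<and> ((\<lambda>e. c * e) \<longlongrightarrow> c) F))"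

definition faithful_conditional_expectation ::
    "'b::cstar_algebra set \<Rightarrow> 'b set \<Rightarrow> ('b \<Rightarrow> 'b) \<Rightarrow> bool" where
  "faithful_conditional_expectation C D P \<longleftrightarrow>
     P ` C \<subseteq> D \<and>
     (\<forall>x\<in>C. \<forall>y\<in>C. P (x + y) = P x + P y) \<and>
     (\<forall>z. \<forall>x\<in>C. P (z *\<^sub>C x) = z *\<^sub>C P x) \<and>
     (\<forall>c\<in>C. norm (P c) \<le> norm c) \<and>
     (\<forall>c. positive_in C c \<longrightarrow> positive_in D (P c)) \<and>
     (\<forall>d\<in>D. P d = d) \<and>
     (\<forall>c\<in>C. \<forall>d\<in>D. P (c * d) = P c * d \<and> P (d * c) = d * P c) \<and>
     (\<forall>c\<in>C. P (c\<^sup>\<star> * c) = 0 \<longrightarrow> c = 0)"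

definition diagonal_pair :: "'b::cstar_algebra set \<Rightarrow> 'b set \<Rightarrow> bool" where
  "diagonal_pair C D \<longleftrightarrow>
     cstar_subalgebra C \<and> separable_space (top_of_set C) \<and>
     cstar_subalgebra D \<and> D \<subseteq> C \<and> commutative_on D \<and>
     contains_approximate_identity C D \<and>
     (\<exists>P. faithful_conditional_expectation C D P \<and>
          {c \<in> C. P c = 0} = closure (cspan (free_normalisers C D)))"

end

theory Submission
  imports Defs
begin

text \<open>Writing \<open>b\<close> as an infinite matrix with entries \<open>b i j\<close> in \<open>A\<close>, the algebra \<open>C\<close> consists of the
  matrices with \<open>b i j\<close> in the closure of \<open>a i A a j\<close>, and \<open>D\<close> of the diagonal ones among them. The
  elements of \<open>C\<close> with a single non-zero entry, off the diagonal, are free normalisers whose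
  closed span is the kernel of the compression to the diagonal; conversely a free normaliser has zero diagonal because
  the corners \<open>a i A a i\<close> are commutative. The bimodule implementing the Morita equivalence is the
  first column of the closure of \<open>h (A \<otimes> \<K>)\<close>, and fullness on the side of \<open>A\<close> is the hypothesis that
  the \<open>a i\<close> generate \<open>A\<close>.

  The positivity clauses need square roots. These come from positivity of \<open>x\<^sup>\<star> x\<close> in the unitization,
  where square roots are limits of an iteration converging in norm, so that no spectral theory is
  involved.\<close>

section \<open>Subspaces and the adjoint\<close>

text \<open>Each positivity clause asks for a root inside a prescribed algebra: \<open>C\<close>,
  \<open>D\<close> or \<open>A\<close>. It is therefore essential that the limit of the iteration
  stays in every closed subalgebra that contains the data, and that a root of an element with scalar
  part 0 has scalar part 0 again.

  Without a unit in \<open>A\<close>, the multiplier given by 1 and \<open>\<Theta> i i\<close> is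
  not an element of the tensor product. Left and right multiplication by it are recovered as limits
  of multiplication by the elementary tensors of \<open>u n\<close> and \<open>\<Theta> i i\<close>,
  where \<open>u\<close> is a sequential approximate unit supplied by separability.

  The weights of \<open>h\<close> do two things: they tend to 0, so that the series converges, and
  they are nonzero, so that they can be cancelled entry by entry.

  The claim about the conditional expectation concerns every faithful expectation onto
  \<open>D\<close>. Hence uniqueness has to be proved as well; there commutativity of
  \<open>D\<close> forces an expectation to kill the entries off the diagonal.\<close>

lemma scaleC_minus_one: "(-1) *\<^sub>C x = - (x :: 'a::complex_vector)"
  using scaleC_of_real[of "-1" x] by simp

lemma bounded_linear_scaleC_right: "bounded_linear (\<lambda>x. c *\<^sub>C (x :: 'a::complex_normed_vector))"
  by (rule bounded_linear_scaleC) (rule bounded_linear_ident)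

lemma csubspaceD:
  assumes "csubspace S"
  shows "0 \<in> S" "\<And>x y. x \<in> S \<Longrightarrow> y \<in> S \<Longrightarrow> x + y \<in> S" "\<And>c x. x \<in> S \<Longrightarrow> c *\<^sub>C x \<in> S"
    "\<And>x y. x \<in> S \<Longrightarrow> y \<in> S \<Longrightarrow> x - y \<in> S" "\<And>r x. x \<in> S \<Longrightarrow> r *\<^sub>R x \<in> S"
    "\<And>x. x \<in> S \<Longrightarrow> - x \<in> S"
proof -
  show *: "0 \<in> S" "\<And>x y. x \<in> S \<Longrightarrow> y \<in> S \<Longrightarrow> x + y \<in> S" "\<And>c x. x \<in> S \<Longrightarrow> c *\<^sub>C x \<in> S"
    using assms by (auto simp: complex_vector.subspace_def)
  show n: "\<And>x. x \<in> S \<Longrightarrow> - x \<in> S"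
    using *(3)[of _ "-1"] by (simp add: scaleC_minus_one)
  show "\<And>x y. x \<in> S \<Longrightarrow> y \<in> S \<Longrightarrow> x - y \<in> S"
    using *(2) n by (metis diff_conv_add_uminus)
  show "\<And>r x. x \<in> S \<Longrightarrow> r *\<^sub>R x \<in> S"
    using *(3) by (metis scaleC_of_real)
qed

lemma csubspace_sum: "csubspace S \<Longrightarrow> (\<And>i. i \<in> I \<Longrightarrow> f i \<in> S) \<Longrightarrow> sum f I \<in> S"
  by (rule complex_vector.subspace_sum)

lemma csubspace_closure:
  fixes S :: "'a::complex_normed_vector set"
  assumes "csubspace S" shows "csubspace (closure S)"
  unfolding complex_vector.subspace_def
proof (intro conjI ballI allI)
  show "0 \<in> closure S" using csubspaceD(1)[OF assms] closure_subset by blast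
next
  fix x y assume "x \<in> closure S" "y \<in> closure S"
  then obtain f g where "\<forall>n. f n \<in> S" "f \<longlonglongrightarrow> x" "\<forall>n. g n \<in> S" "g \<longlonglongrightarrow> y"
    by (auto simp: closure_sequential)
  then show "x + y \<in> closure S"
    unfolding closure_sequential
    by (intro exI[of _ "\<lambda>n. f n + g n"]) (auto intro: tendsto_add csubspaceD[OF assms])
next
  fix c x assume "x \<in> closure S"
  then obtain f where "\<forall>n. f n \<in> S" "f \<longlonglongrightarrow> x" by (auto simp: closure_sequential)
  then show "c *\<^sub>C x \<in> closure S"
    unfolding closure_sequential
    by (intro exI[of _ "\<lambda>n. c *\<^sub>C f n"])
      (auto intro: bounded_linear.tendsto[OF bounded_linear_scaleC_right] csubspaceD[OF assms])
qed

lemma closure_cspan_minimal: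
  fixes S :: "'a::complex_normed_vector set"
  assumes "A \<subseteq> S" "csubspace S" "closed S"
  shows "closure (cspan A) \<subseteq> S"
  using assms by (meson closure_minimal complex_vector.span_minimal)

context
  fixes x y :: "'a::cstar_algebra"
begin

lemma adj_zero [simp]: "(0::'a)\<^sup>\<star> = 0"
  using adj_add[of 0 "0::'a"] by simp

lemma adj_minus: "(- x)\<^sup>\<star> = - (x\<^sup>\<star>)"
  using adj_add[of x "-x"] by (simp add: eq_neg_iff_add_eq_0 add.commute)

lemma adj_diff: "(x - y)\<^sup>\<star> = x\<^sup>\<star> - y\<^sup>\<star>"
  using adj_add[of x "-y"] adj_minus
  by (metis (no_types) adj_add add_diff_cancel diff_add_cancel)

lemma adj_scaleR: "(r *\<^sub>R x)\<^sup>\<star> = r *\<^sub>R x\<^sup>\<star>"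
  using adj_scaleC[of "complex_of_real r" x] by (simp add: scaleC_of_real)

lemma norm_adj [simp]: "norm (x\<^sup>\<star>) = norm x"
proof -
  have le: "norm z \<le> norm (z\<^sup>\<star>)" for z :: 'a
  proof (cases "z = 0")
    case False
    have "norm z * norm z \<le> norm (z\<^sup>\<star>) * norm z"
      using cstar_identity[of z] norm_mult_ineq[of "z\<^sup>\<star>" z] by (simp add: power2_eq_square)
    then show ?thesis using False by simp
  qed simp
  show ?thesis using le[of x] le[of "x\<^sup>\<star>"] by (simp add: adj_adj)
qed

lemma norm_mult_adj: "norm (x * x\<^sup>\<star>) = (norm x)\<^sup>2"
  using cstar_identity[of "x\<^sup>\<star>"] by (simp add: adj_adj)

lemma adj_mult_eq_0_iff: "x\<^sup>\<star> * x = 0 \<longleftrightarrow> x = 0"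
  using cstar_identity[of x] by (metis norm_eq_zero power_eq_0_iff mult_zero_right zero_neq_numeral)

lemma norm_selfadjoint_square: "x\<^sup>\<star> = x \<Longrightarrow> norm (x * x) = (norm x)\<^sup>2"
  using cstar_identity[of x] by simp

end

lemma norm_mult_contraction:
  fixes e x :: "'a::real_normed_algebra"
  assumes "norm e \<le> 1"
  shows "norm (e * x) \<le> norm x" "norm (x * e) \<le> norm x"
  using order_trans[OF norm_mult_ineq[of e x] mult_right_mono[OF assms, of "norm x"]]
    order_trans[OF norm_mult_ineq[of x e] mult_left_mono[OF assms, of "norm x"]]
  by simp_all

lemma closure_range_sequence:
  fixes x :: "'x::metric_space"
  assumes "x \<in> closure (range f)"
  obtains g where "(\<lambda>n::nat. f (g n)) \<longlonglongrightarrow> x"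
proof -
  obtain y where y: "\<forall>n. y n \<in> range f" "y \<longlonglongrightarrow> x"
    using assms unfolding closure_sequential by blast
  then have "y n = f (inv f (y n))" for n by (simp add: f_inv_into_f)
  with y(2) show thesis by (intro that[of "\<lambda>n. inv f (y n)"]) simp
qed

lemma bounded_linear_adj: "bounded_linear (adj :: 'a::cstar_algebra \<Rightarrow> 'a)"
  by (rule bounded_linear_intro[of _ 1]) (simp_all add: adj_add adj_scaleR)

lemmas tendsto_adj = bounded_linear.tendsto[OF bounded_linear_adj]

lemma adj_sum: "(sum f I)\<^sup>\<star> = (\<Sum>i\<in>I. (f i :: 'a::cstar_algebra)\<^sup>\<star>)"
  by (induction I rule: infinite_finite_induct) (simp_all add: adj_add)

lemma cstar_subalgebraD:
  assumes "cstar_subalgebra S"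
  shows "csubspace S" "closed S" "\<And>x y. x \<in> S \<Longrightarrow> y \<in> S \<Longrightarrow> x * y \<in> S" "\<And>x. x \<in> S \<Longrightarrow> x\<^sup>\<star> \<in> S"
  using assms by (auto simp: cstar_subalgebra_def)

section \<open>Unitization\<close>

text \<open>The pair (\<open>c\<close>, \<open>b\<close>) stands for the element c 1 + b of the
  unitization, acting on the algebra by left multiplication. The operator norm of this action is one
  of the two ingredients of the norm on the unitization.\<close>

definition affine_mult :: "complex \<Rightarrow> 'a::cstar_algebra \<Rightarrow> 'a \<Rightarrow> 'a" where
  "affine_mult c b x = c *\<^sub>C x + b * x"

lemma bounded_linear_affine_mult: "bounded_linear (affine_mult c b)"
  unfolding affine_mult_def
  by (intro bounded_linear_add bounded_linear_scaleC_right bounded_linear_mult_right)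

lemma onorm_affine_mult_add:
  "onorm (affine_mult (c + d) (b + e)) \<le> onorm (affine_mult c b) + onorm (affine_mult d (e::'a::cstar_algebra))"
proof -
  have "affine_mult (c + d) (b + e) = (\<lambda>x. affine_mult c b x + affine_mult d e x)"
    by (simp add: affine_mult_def fun_eq_iff scaleC_add_left algebra_simps)
  then show ?thesis
    using onorm_triangle[OF bounded_linear_affine_mult bounded_linear_affine_mult] by metis
qed

lemma onorm_affine_mult_mult:
  "onorm (affine_mult (c * d) (c *\<^sub>C e + d *\<^sub>C b + b * e))
    \<le> onorm (affine_mult c b) * onorm (affine_mult d (e::'a::cstar_algebra))"
proof -
  have "affine_mult (c * d) (c *\<^sub>C e + d *\<^sub>C b + b * e) = affine_mult c b \<circ> affine_mult d e"
    by (simp add: affine_mult_def fun_eq_iff scaleC_add_left scaleC_add_right scaleC_scaleC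
        distrib_left distrib_right mult_scaleC_left mult_scaleC_right mult.assoc)
  then show ?thesis
    using onorm_compose[OF bounded_linear_affine_mult bounded_linear_affine_mult] by metis
qed

lemma onorm_affine_mult_scale:
  "onorm (affine_mult (k * c) (k *\<^sub>C b)) = cmod k * onorm (affine_mult c (b::'a::cstar_algebra))"
proof -
  have *: "norm (affine_mult (k * c) (k *\<^sub>C b) x) = norm (cmod k *\<^sub>R affine_mult c b x)" for x
  proof -
    have "affine_mult (k * c) (k *\<^sub>C b) x = k *\<^sub>C affine_mult c b x"
      by (simp add: affine_mult_def scaleC_add_right scaleC_scaleC mult_scaleC_left)
    then show ?thesis by (simp add: norm_scaleC)
  qed
  have "onorm (affine_mult (k * c) (k *\<^sub>C b)) = onorm (\<lambda>x. cmod k *\<^sub>R affine_mult c b x)"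
    unfolding onorm_def * ..
  then show ?thesis
    using onorm_scaleR[OF bounded_linear_affine_mult, of "cmod k" c b] by simp
qed

text \<open>For the operator T of left multiplication, the square of \<open>norm (T x)\<close> is
  the norm of the product of \<open>x\<^sup>\<star>\<close> with T*T x, hence at most
  \<open>norm x\<close> times the norm of T*T x. The parameters on the right-hand side are those of
  T*T.\<close>

lemma onorm_affine_mult_cstar:
  "(onorm (affine_mult c b))\<^sup>2 \<le> onorm (affine_mult (cnj c * c) (cnj c *\<^sub>C b + c *\<^sub>C b\<^sup>\<star> + b\<^sup>\<star> * (b::'a::cstar_algebra)))"
  (is "_ \<le> ?R")
proof -
  have R0: "0 \<le> ?R" by (rule onorm_pos_le[OF bounded_linear_affine_mult])
  have "onorm (affine_mult c b) \<le> sqrt ?R"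
  proof (rule onorm_bound)
    fix x
    have "(norm (affine_mult c b x))\<^sup>2 = norm (x\<^sup>\<star> * affine_mult (cnj c * c) (cnj c *\<^sub>C b + c *\<^sub>C b\<^sup>\<star> + b\<^sup>\<star> * b) x)"
      by (simp add: affine_mult_def adj_add adj_scaleC adj_mult scaleC_add_right scaleC_scaleC
        distrib_left distrib_right mult_scaleC_left mult_scaleC_right mult.assoc ac_simps flip: cstar_identity)
    also have "\<dots> \<le> norm x * norm (affine_mult (cnj c * c) (cnj c *\<^sub>C b + c *\<^sub>C b\<^sup>\<star> + b\<^sup>\<star> * b) x)"
      by (metis norm_mult_ineq norm_adj)
    also have "\<dots> \<le> norm x * (?R * norm x)"
      by (intro mult_left_mono onorm[OF bounded_linear_affine_mult]) simp
    also have "\<dots> = (sqrt ?R * norm x)\<^sup>2"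
      using R0 by (simp add: power_mult_distrib power2_eq_square mult.assoc)
    finally show "norm (affine_mult c b x) \<le> sqrt ?R * norm x"
      by (rule power2_le_imp_le) (simp add: R0)
  qed (simp add: R0)
  then show ?thesis
    using R0 by (metis onorm_pos_le[OF bounded_linear_affine_mult] power_mono real_sqrt_pow2)
qed

text \<open>The norm is attained at a multiple of \<open>b\<^sup>\<star>\<close>, by
  \<open>norm_mult_adj\<close>. This makes the embedding of the algebra into its unitization
  isometric.\<close>

lemma onorm_affine_mult_0: "onorm (affine_mult 0 b) = norm (b::'a::cstar_algebra)"
proof (rule antisym)
  show "onorm (affine_mult 0 b) \<le> norm b"
    by (rule onorm_bound) (simp_all add: affine_mult_def norm_mult_ineq)
  have "norm (affine_mult 0 b (b\<^sup>\<star>)) \<le> onorm (affine_mult 0 b) * norm (b\<^sup>\<star>)"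
    by (rule onorm[OF bounded_linear_affine_mult])
  then have "norm b * norm b \<le> onorm (affine_mult 0 b) * norm b"
    by (simp add: affine_mult_def norm_mult_adj power2_eq_square)
  then show "norm b \<le> onorm (affine_mult 0 b)"
    by (cases "b = 0") (auto simp: onorm_pos_le[OF bounded_linear_affine_mult])
qed

lemma onorm_affine_mult_scalar: "onorm (affine_mult c (0::'a::cstar_algebra)) \<le> cmod c"
  by (rule onorm_bound) (simp_all add: affine_mult_def norm_scaleC)

datatype 'a unitization = Unitize (scalar_part: complex) (algebra_part: 'a)

class unital_cstar_algebra = cstar_algebra + real_normed_algebra_1

instantiation unitization :: (cstar_algebra) complex_vector
begin
definition "0 = Unitize 0 0"
definition "x + y = Unitize (scalar_part x + scalar_part y) (algebra_part x + algebra_part y)"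
definition "- x = Unitize (- scalar_part x) (- algebra_part x)"
definition "x - y = Unitize (scalar_part x - scalar_part y) (algebra_part x - algebra_part y)"
definition "c *\<^sub>C x = Unitize (c * scalar_part x) (c *\<^sub>C algebra_part x)"
definition "r *\<^sub>R x = Unitize (r *\<^sub>R scalar_part x) (r *\<^sub>R algebra_part x)"
instance
  by standard (simp_all add: zero_unitization_def plus_unitization_def uminus_unitization_def
      minus_unitization_def scaleC_unitization_def scaleR_unitization_def unitization.expand
      algebra_simps scaleC_add_left scaleC_add_right scaleC_scaleC scaleC_of_real scaleR_conv_of_real)
end

instantiation unitization :: (cstar_algebra) real_normed_vector
begin
text \<open>If the algebra already has a unit e, then 1 - e acts as zero on it and the operator norm
  alone is only a seminorm. The modulus of the scalar part, itself a C*-seminorm, removes this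
  defect.\<close>

definition "norm x = max (cmod (scalar_part x)) (onorm (affine_mult (scalar_part x) (algebra_part x)))"
definition dist_unitization :: "'a unitization \<Rightarrow> 'a unitization \<Rightarrow> real" where
  "dist_unitization x y = norm (x - y)"
definition sgn_unitization :: "'a unitization \<Rightarrow> 'a unitization" where
  "sgn_unitization x = x /\<^sub>R norm x"
definition uniformity_unitization :: "('a unitization \<times> 'a unitization) filter" where
  "uniformity_unitization = (INF e\<in>{0<..}. principal {(x, y). dist x y < e})"
definition open_unitization :: "'a unitization set \<Rightarrow> bool" where
  "open_unitization U \<longleftrightarrow> (\<forall>x\<in>U. eventually (\<lambda>(x', y). x' = x \<longrightarrow> y \<in> U) uniformity)"
instance
proof
  fix x y :: "'a unitization" and r :: real
  show "norm x = 0 \<longleftrightarrow> x = 0"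
  proof
    assume "norm x = 0"
    then have "cmod (scalar_part x) \<le> 0" and o: "onorm (affine_mult (scalar_part x) (algebra_part x)) \<le> 0"
      by (metis norm_unitization_def max.cobounded1 max.cobounded2)+
    then have "scalar_part x = 0" by simp
    with o show "x = 0"
      by (cases x) (simp add: zero_unitization_def onorm_affine_mult_0)
  qed (simp add: norm_unitization_def zero_unitization_def onorm_affine_mult_0)
  show "norm (x + y) \<le> norm x + norm y"
    using onorm_affine_mult_add[of "scalar_part x" "scalar_part y" "algebra_part x" "algebra_part y"]
      norm_triangle_ineq[of "scalar_part x" "scalar_part y"]
    unfolding norm_unitization_def plus_unitization_def unitization.sel
    by linarith
  show "norm (r *\<^sub>R x) = \<bar>r\<bar> * norm x"
    using onorm_affine_mult_scale[of r "scalar_part x" "algebra_part x"]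
    by (simp add: norm_unitization_def scaleR_unitization_def scaleC_of_real scaleR_conv_of_real
        norm_mult max_mult_distrib_left)
qed (rule dist_unitization_def sgn_unitization_def uniformity_unitization_def open_unitization_def)+
end

instance unitization :: (cstar_algebra) complex_normed_vector
  by standard
    (simp add: norm_unitization_def scaleC_unitization_def onorm_affine_mult_scale norm_mult
      max_mult_distrib_left)

instantiation unitization :: (cstar_algebra) real_normed_algebra_1
begin
definition "1 = Unitize 1 0"
definition "x * y = Unitize (scalar_part x * scalar_part y)
  (scalar_part x *\<^sub>C algebra_part y + scalar_part y *\<^sub>C algebra_part x + algebra_part x * algebra_part y)"
instance
proof
  fix x y z :: "'a unitization" and r :: real
  show "x * y * z = x * (y * z)"
    by (simp add: times_unitization_def scaleC_add_right scaleC_scaleC distrib_left distrib_right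
        mult_scaleC_left mult_scaleC_right mult.assoc ac_simps)
  show "(x + y) * z = x * z + y * z" "x * (y + z) = x * y + x * z"
    by (simp_all add: times_unitization_def plus_unitization_def scaleC_add_right scaleC_add_left
        distrib_left distrib_right ac_simps)
  have "c *\<^sub>C x * y = c *\<^sub>C (x * y)" "x * c *\<^sub>C y = c *\<^sub>C (x * y)" for c
    by (simp_all add: times_unitization_def scaleC_unitization_def scaleC_add_right scaleC_scaleC
        mult_scaleC_left mult_scaleC_right ac_simps)
  from this[of "complex_of_real r"] show "r *\<^sub>R x * y = r *\<^sub>R (x * y)" "x * r *\<^sub>R y = r *\<^sub>R (x * y)"
    by (simp_all add: scaleC_of_real)
  show "1 * x = x" "x * 1 = x"
    by (simp_all add: times_unitization_def one_unitization_def)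
  show "norm (x * y) \<le> norm x * norm y"
    unfolding norm_unitization_def times_unitization_def
  proof (simp, intro conjI)
    let ?m = "\<lambda>x::'a unitization. max (cmod (scalar_part x)) (onorm (affine_mult (scalar_part x) (algebra_part x)))"
    show "cmod (scalar_part x * scalar_part y) \<le> ?m x * ?m y"
      unfolding norm_mult by (intro mult_mono max.cobounded1 norm_ge_zero max.coboundedI1)
    show "onorm (affine_mult (scalar_part x * scalar_part y) (scalar_part x *\<^sub>C algebra_part y +
         scalar_part y *\<^sub>C algebra_part x + algebra_part x * algebra_part y)) \<le> ?m x * ?m y"
      by (rule order_trans[OF onorm_affine_mult_mult])
        (intro mult_mono max.cobounded2 max.coboundedI1[OF norm_ge_zero] onorm_pos_le[OF bounded_linear_affine_mult])
  qed
  show "(0::'a unitization) \<noteq> 1" by (simp add: zero_unitization_def one_unitization_def)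
  show "norm (1::'a unitization) = 1"
    using onorm_affine_mult_scalar[of 1, where 'a = 'a]
    by (simp add: norm_unitization_def one_unitization_def)
qed
end

lemma norm_Unitize_0: "norm (Unitize 0 b) = norm (b::'a::cstar_algebra)"
  by (simp add: norm_unitization_def onorm_affine_mult_0)

lemma norm_scalar_part_le: "cmod (scalar_part x) \<le> norm (x::'a::cstar_algebra unitization)"
  by (simp add: norm_unitization_def)

text \<open>The factor 2 comes from subtracting the scalar part, whose modulus is at most the norm.
  Both coordinates are then continuous, and completeness of the unitization is inherited from
  them.\<close>

lemma norm_algebra_part_le: "norm (algebra_part x) \<le> 2 * norm (x::'a::cstar_algebra unitization)"
proof -
  have "Unitize 0 (algebra_part x) = x - scalar_part x *\<^sub>C 1"
    by (simp add: one_unitization_def minus_unitization_def scaleC_unitization_def)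
  then have "norm (algebra_part x) \<le> norm x + norm (scalar_part x *\<^sub>C (1::'a unitization))"
    using norm_triangle_ineq4 norm_Unitize_0 by metis
  then show ?thesis
    using norm_scalar_part_le[of x] by (simp only: norm_scaleC norm_one mult_1_right)
qed

lemma bounded_linear_scalar_part: "bounded_linear (scalar_part :: 'a::cstar_algebra unitization \<Rightarrow> complex)"
  by (rule bounded_linear_intro[of _ 1])
    (simp_all add: plus_unitization_def scaleR_unitization_def norm_scalar_part_le)

lemma bounded_linear_algebra_part: "bounded_linear (algebra_part :: 'a::cstar_algebra unitization \<Rightarrow> 'a)"
  by (rule bounded_linear_intro[of _ 2])
    (simp_all add: plus_unitization_def scaleR_unitization_def order_trans[OF norm_algebra_part_le])

lemma bounded_linear_Unitize_0: "bounded_linear (Unitize 0 :: 'a::cstar_algebra \<Rightarrow> _)"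
  by (rule bounded_linear_intro[of _ 1])
    (simp_all add: plus_unitization_def scaleR_unitization_def norm_Unitize_0)

instantiation unitization :: (cstar_algebra) cstar_algebra
begin
definition "x\<^sup>\<star> = Unitize (cnj (scalar_part x)) ((algebra_part x)\<^sup>\<star>)"
instance
proof
  fix x y :: "'a unitization" and c :: complex and f :: "nat \<Rightarrow> 'a unitization"
  show "c *\<^sub>C x * y = c *\<^sub>C (x * y)" "x * c *\<^sub>C y = c *\<^sub>C (x * y)"
    by (simp_all add: times_unitization_def scaleC_unitization_def scaleC_add_right scaleC_scaleC
        mult_scaleC_left mult_scaleC_right ac_simps)
  show "(x\<^sup>\<star>)\<^sup>\<star> = x" "(x + y)\<^sup>\<star> = x\<^sup>\<star> + y\<^sup>\<star>" "(c *\<^sub>C x)\<^sup>\<star> = cnj c *\<^sub>C x\<^sup>\<star>"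
    "(x * y)\<^sup>\<star> = y\<^sup>\<star> * x\<^sup>\<star>"
    by (simp_all add: adj_unitization_def plus_unitization_def scaleC_unitization_def
        times_unitization_def adj_adj adj_add adj_scaleC adj_mult add.commute mult.commute)
  \<comment> \<open>Only this half of the C*-identity is proved by hand. With submultiplicativity it
    forces the adjoint to be isometric, and that gives the other half.\<close>
  have sq: "(norm z)\<^sup>2 \<le> norm (z\<^sup>\<star> * z)" for z :: "'a unitization"
  proof -
    have "(cmod (scalar_part z))\<^sup>2 = cmod (cnj (scalar_part z) * scalar_part z)"
      by (simp add: norm_mult power2_eq_square)
    moreover have "(onorm (affine_mult (scalar_part z) (algebra_part z)))\<^sup>2
        \<le> onorm (affine_mult (scalar_part (z\<^sup>\<star> * z)) (algebra_part (z\<^sup>\<star> * z)))"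
      using onorm_affine_mult_cstar[of "scalar_part z" "algebra_part z"]
      by (simp add: times_unitization_def adj_unitization_def)
    ultimately show ?thesis
      by (auto simp: norm_unitization_def times_unitization_def adj_unitization_def max_def)
  qed
  have le: "norm z \<le> norm (z\<^sup>\<star>)" for z :: "'a unitization"
  proof (cases "z = 0")
    case False
    have "norm z * norm z \<le> norm (z\<^sup>\<star>) * norm z"
      using sq[of z] norm_mult_ineq[of "z\<^sup>\<star>" z] by (simp add: power2_eq_square)
    then show ?thesis using False by simp
  qed simp
  have "norm (x\<^sup>\<star>) = norm x"
    using le[of x] le[of "x\<^sup>\<star>"] \<open>(x\<^sup>\<star>)\<^sup>\<star> = x\<close> by simp
  then show "norm (x\<^sup>\<star> * x) = (norm x)\<^sup>2"
    using sq[of x] norm_mult_ineq[of "x\<^sup>\<star>" x] by (simp add: power2_eq_square)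
  assume "Cauchy f"
  then have "convergent (\<lambda>n. scalar_part (f n))" "convergent (\<lambda>n. algebra_part (f n))"
    by (simp_all add: Cauchy_convergent_iff[symmetric]
        bounded_linear.Cauchy[OF bounded_linear_scalar_part]
        bounded_linear.Cauchy[OF bounded_linear_algebra_part])
  then obtain c b where "(\<lambda>n. scalar_part (f n)) \<longlonglongrightarrow> c" "(\<lambda>n. algebra_part (f n)) \<longlonglongrightarrow> b"
    by (auto simp: convergent_def)
  moreover have bl: "bounded_linear (\<lambda>c. c *\<^sub>C (1 :: 'a unitization))"
  proof (rule bounded_linear_intro[of _ 1])
    show "(r *\<^sub>R c) *\<^sub>C (1 :: 'a unitization) = r *\<^sub>R c *\<^sub>C 1" for r c
      using scaleC_scaleC[of "complex_of_real r" c "1 :: 'a unitization"]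
      by (simp only: scaleC_of_real scaleR_conv_of_real)
  qed (simp_all add: scaleC_add_left norm_scaleC)
  ultimately have "(\<lambda>n. scalar_part (f n) *\<^sub>C 1 + Unitize 0 (algebra_part (f n))) \<longlonglongrightarrow> c *\<^sub>C 1 + Unitize 0 b"
    by (intro tendsto_add bounded_linear.tendsto[OF bounded_linear_Unitize_0] bounded_linear.tendsto[OF bl])
  then show "convergent f"
    by (auto simp: convergent_def one_unitization_def plus_unitization_def scaleC_unitization_def)
qed
end

instance unitization :: (cstar_algebra) unital_cstar_algebra ..

lemma Unitize_0_mult: "Unitize 0 (x * y) = Unitize 0 x * Unitize 0 (y::'a::cstar_algebra)"
  by (simp add: times_unitization_def)

lemma Unitize_0_adj: "Unitize 0 (x\<^sup>\<star>) = (Unitize 0 (x::'a::cstar_algebra))\<^sup>\<star>"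
  by (simp add: adj_unitization_def)

lemma scalar_part_simps [simp]:
  fixes x y :: "'a::cstar_algebra unitization"
  shows "scalar_part (x * y) = scalar_part x * scalar_part y"
    "scalar_part (x + y) = scalar_part x + scalar_part y"
    "scalar_part (x - y) = scalar_part x - scalar_part y"
    "scalar_part (1::'a unitization) = 1" "scalar_part (x ^ n) = scalar_part x ^ n"
    "scalar_part (sum f I) = (\<Sum>i\<in>I. scalar_part (f i :: 'a unitization))"
proof -
  show m: "scalar_part (x * y) = scalar_part x * scalar_part y" for x y :: "'a unitization"
    by (simp add: times_unitization_def)
  show "scalar_part (x + y) = scalar_part x + scalar_part y"
    "scalar_part (x - y) = scalar_part x - scalar_part y"
    by (simp_all add: plus_unitization_def minus_unitization_def)
  show o: "scalar_part (1::'a unitization) = 1" by (simp add: one_unitization_def)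
  show "scalar_part (x ^ n) = scalar_part x ^ n"
    by (induction n) (simp_all add: m o)
  show "scalar_part (sum f I) = (\<Sum>i\<in>I. scalar_part (f i :: 'a unitization))"
    by (rule linear_sum[OF bounded_linear.linear[OF bounded_linear_scalar_part]])
qed

lemma Unitize_algebra_part: "scalar_part x = 0 \<Longrightarrow> Unitize 0 (algebra_part x) = x"
  by (cases x) simp

section \<open>Positive elements of unital C*-algebras\<close>

text \<open>The iteration \<open>w \<mapsto> (z + w\<^sup>2) / 2\<close> started at \<open>0\<close> converges to \<open>1 - \<surd>(1 - z)\<close>; the scalar iteration
  for \<open>z = 1\<close> dominates it.\<close>

fun visser :: "'u::real_normed_algebra \<Rightarrow> nat \<Rightarrow> 'u" where
  "visser z 0 = 0"
| "visser z (Suc n) = (1/2) *\<^sub>R (z + visser z n * visser z n)"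

lemma visser_one_bounds: "0 \<le> visser (1::real) n" "visser (1::real) n \<le> 1"
proof (induction n)
  case (Suc n)
  { case 1 then show ?case using Suc by simp }
  { case 2 then show ?case using Suc mult_le_one[of "visser 1 n" "visser 1 n"] by simp }
qed simp_all

lemma norm_visser_le:
  assumes "norm z \<le> 1" shows "norm (visser z n) \<le> visser 1 n"
proof (induction n)
  case (Suc n)
  have "norm (visser z n * visser z n) \<le> visser 1 n * visser 1 n"
    by (rule order_trans[OF norm_mult_ineq mult_mono]) (use Suc visser_one_bounds in auto)
  then have "norm (z + visser z n * visser z n) \<le> 1 + visser 1 n * visser 1 n"
    by (intro order_trans[OF norm_triangle_ineq] add_mono assms)
  then show ?case by simp
qed simp

lemma visser_commute: "c * z = z * c \<Longrightarrow> c * visser z n = visser z n * c"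
proof (induction n)
  case (Suc n)
  then show ?case
    by (simp add: distrib_left distrib_right) (metis mult.assoc)
qed simp

text \<open>Successive iterates are polynomials in \<open>z\<close> and commute, so a difference of
  squares factors as (v - w)(v + w). Both factors are bounded by their scalar counterparts, and half
  the product of these bounds is exactly the next scalar increment.\<close>

lemma norm_visser_diff_le:
  assumes "norm z \<le> 1"
  shows "norm (visser z (Suc n) - visser z n) \<le> visser 1 (Suc n) - visser 1 n"
proof (induction n)
  case 0
  then show ?case using assms by simp
next
  case (Suc n)
  let ?v = "visser z (Suc n)" and ?w = "visser z n"
  let ?s = "visser (1::real) (Suc n)" and ?t = "visser (1::real) n"
  have c: "?v * ?w = ?w * ?v"
    by (rule visser_commute) (rule visser_commute[symmetric], simp)
  have "visser z (Suc (Suc n)) - ?v = (1/2) *\<^sub>R (?v * ?v - ?w * ?w)"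
    by (simp only: visser.simps(2)[of z "Suc n"] visser.simps(2)[of z n] scaleR_diff_right)
      (simp add: algebra_simps)
  also have "?v * ?v - ?w * ?w = (?v - ?w) * (?v + ?w)"
    using c by (simp only: distrib_left left_diff_distrib) simp
  finally have "norm (visser z (Suc (Suc n)) - ?v) = (1/2) * norm ((?v - ?w) * (?v + ?w))"
    by simp
  also have "norm ((?v - ?w) * (?v + ?w)) \<le> norm (?v - ?w) * norm (?v + ?w)"
    by (rule norm_mult_ineq)
  also have "\<dots> \<le> (?s - ?t) * (?s + ?t)"
  proof (rule mult_mono[OF Suc])
    show "norm (?v + ?w) \<le> ?s + ?t"
      by (rule order_trans[OF norm_triangle_ineq add_mono]) (rule norm_visser_le[OF assms])+
    show "0 \<le> ?s - ?t"
      using Suc by (rule order_trans[OF norm_ge_zero])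
  qed simp
  also have "(1/2) * ((?s - ?t) * (?s + ?t)) = visser 1 (Suc (Suc n)) - ?s"
    by (simp only: visser.simps(2)[of "1::real" "Suc n"] visser.simps(2)[of "1::real" n])
      (simp add: algebra_simps)
  finally show ?case by simp
qed

text \<open>The scalar iterates increase and are bounded by 1, so their increments form a convergent
  telescoping series, which dominates the one for \<open>z\<close>.\<close>

lemma visser_convergent:
  fixes z :: "'u::{real_normed_algebra, banach}"
  assumes "norm z \<le> 1"
  shows "convergent (visser z)"
proof -
  have mono: "incseq (visser (1::real))"
    by (rule incseq_SucI)
      (use norm_visser_diff_le[of "1::real"] norm_ge_zero order_trans in force)
  have "convergent (visser (1::real))"
    using visser_one_bounds by (intro Bseq_mono_convergent) (auto simp: Bseq_def incseqD[OF mono] intro!: exI[of _ 1])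
  then have "summable (\<lambda>n. visser (1::real) (Suc n) - visser 1 n)"
    by (auto simp: convergent_def simp del: visser.simps intro: sums_summable telescope_sums)
  then have "summable (\<lambda>n. visser z (Suc n) - visser z n)"
    by (rule summable_comparison_test'[where N = 0]) (rule norm_visser_diff_le[OF assms])
  then have "convergent (\<lambda>n. \<Sum>i<n. visser z (Suc i) - visser z i)"
    by (simp add: summable_iff_convergent)
  then show ?thesis by (simp only: sum_lessThan_telescope visser.simps(1) diff_zero)
qed

text \<open>A real subspace without closure under the adjoint: weak enough for the commutant of a
  single arbitrary element to qualify, strong enough to contain the limits of the iteration.\<close>

definition closed_subalgebra :: "'u::real_normed_algebra set \<Rightarrow> bool" where
  "closed_subalgebra S \<longleftrightarrow> closed S \<and> subspace S \<and> (\<forall>x\<in>S. \<forall>y\<in>S. x * y \<in> S)"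

lemma visser_sqrt:
  fixes z :: "'u::unital_cstar_algebra"
  assumes "norm z \<le> 1" "z\<^sup>\<star> = z"
  obtains w where "norm w \<le> 1" "w\<^sup>\<star> = w" "(1 - w) * (1 - w) = 1 - z"
    "\<forall>S. closed_subalgebra S \<longrightarrow> z \<in> S \<longrightarrow> w \<in> S"
proof -
  obtain w where w: "visser z \<longlonglongrightarrow> w"
    using visser_convergent[OF assms(1)] by (auto simp: convergent_def)
  \<comment> \<open>The iteration starts at 0, so all iterates are polynomials in \<open>z\<close>
    without constant term. This keeps them in \<open>S\<close> even when \<open>S\<close> has no
    unit.\<close>
  have in_closed: "w \<in> S" if "closed_subalgebra S" "z \<in> S" for S
  proof (rule closed_sequentially[OF _ _ w])
    show "visser z n \<in> S" for n
      using that by (induction n) (auto simp: closed_subalgebra_def intro!: subspace_add subspace_0 subspace_scale)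
    show "closed S" using that by (simp add: closed_subalgebra_def)
  qed
  have "norm w \<le> 1"
    by (rule LIMSEQ_le_const2[OF tendsto_norm[OF w]])
      (use norm_visser_le[OF assms(1)] visser_one_bounds order_trans in blast)
  moreover have "w\<^sup>\<star> = w"
  proof -
    have "(visser z n)\<^sup>\<star> = visser z n" for n
      by (induction n) (simp_all add: adj_scaleR adj_add adj_mult assms)
    then have "visser z \<longlonglongrightarrow> w\<^sup>\<star>" using tendsto_adj[OF w] by (simp only:)
    then show ?thesis using w by (rule LIMSEQ_unique)
  qed
  moreover have "(1 - w) * (1 - w) = 1 - z"
  proof -
    have "(\<lambda>n. visser z (Suc n)) \<longlonglongrightarrow> (1/2) *\<^sub>R (z + w * w)"
      unfolding visser.simps by (intro tendsto_intros w)
    then have "w = (1/2) *\<^sub>R (z + w * w)"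
      using LIMSEQ_unique[OF LIMSEQ_Suc[OF w]] by blast
    then have "w + w = z + w * w"
      by (metis scaleR_half_double scaleR_add_right)
    then show ?thesis by (simp add: algebra_simps)
  qed
  ultimately show thesis using in_closed that by blast
qed

text \<open>With this form of positivity roots are available at once. That every
  \<open>x\<^sup>\<star> * x\<close> is of this form is the difficult point, settled in
  \<open>positive_adj_mult\<close>.\<close>

definition positive :: "'u::unital_cstar_algebra \<Rightarrow> bool" where
  "positive y \<longleftrightarrow> (\<exists>r. r\<^sup>\<star> = r \<and> y = r * r)"

lemma adj_one [simp]: "(1::'u::unital_cstar_algebra)\<^sup>\<star> = 1"
  using adj_mult[of "1\<^sup>\<star>" "1::'u"] by (simp add: adj_adj)

lemma adj_of_real [simp]: "(of_real s :: 'u::unital_cstar_algebra)\<^sup>\<star> = of_real s"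
  by (simp add: of_real_def adj_scaleR)

lemma adj_power: "(x ^ n)\<^sup>\<star> = (x\<^sup>\<star>) ^ n" for x :: "'u::unital_cstar_algebra"
  by (induction n) (simp_all add: adj_mult power_commutes)

lemma positive_selfadjoint: "positive y \<Longrightarrow> y\<^sup>\<star> = y"
  by (auto simp: positive_def adj_mult)

text \<open>The norm estimate plays the part of a spectrum contained in [0, 2s]: it says that
  \<open>z\<close>, which is 1 - y/s, is a contraction. The root satisfies an estimate of the same
  kind and is therefore positive in turn.\<close>

lemma positive_sqrt:
  fixes y :: "'u::unital_cstar_algebra"
  assumes "y\<^sup>\<star> = y" "0 < s" "norm (of_real s - y) \<le> s"
  obtains r where "r\<^sup>\<star> = r" "r * r = y" "norm (of_real (sqrt s) - r) \<le> sqrt s"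
    "\<forall>S. closed_subalgebra S \<longrightarrow> 1 \<in> S \<longrightarrow> y \<in> S \<longrightarrow> r \<in> S"
proof -
  define z where "z = 1 - (1/s) *\<^sub>R y"
  have "z = (1/s) *\<^sub>R (of_real s - y)"
    using assms(2) by (simp add: z_def scaleR_diff_right of_real_def)
  then have "norm z \<le> 1"
    using assms(2,3) by (simp add: divide_simps)
  moreover have "z\<^sup>\<star> = z"
    by (simp add: z_def adj_diff adj_scaleR assms)
  ultimately obtain w where w: "norm w \<le> 1" "w\<^sup>\<star> = w" "(1 - w) * (1 - w) = 1 - z"
    "\<forall>S. closed_subalgebra S \<longrightarrow> z \<in> S \<longrightarrow> w \<in> S"
    using visser_sqrt[of z] by blast
  define r where "r = sqrt s *\<^sub>R (1 - w)"
  have "r\<^sup>\<star> = r" by (simp add: r_def adj_scaleR adj_diff w)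
  moreover have "r * r = y"
    using assms(2) by (simp add: r_def w(3) z_def)
  moreover have "norm (of_real (sqrt s) - r) \<le> sqrt s"
  proof -
    have "of_real (sqrt s) - r = sqrt s *\<^sub>R w"
      by (simp add: r_def of_real_def scaleR_diff_right)
    then show ?thesis
      using w(1) assms(2) by (simp add: mult_left_le)
  qed
  moreover have "r \<in> S" if S: "closed_subalgebra S" "1 \<in> S" "y \<in> S" for S
  proof -
    have sub: "subspace S" using S by (simp add: closed_subalgebra_def)
    have "z \<in> S" unfolding z_def by (intro subspace_diff[OF sub] subspace_scale[OF sub] S)
    then show ?thesis
      unfolding r_def using w(4) S by (intro subspace_scale[OF sub] subspace_diff[OF sub]) auto
  qed
  ultimately show thesis using that by blast
qed

text \<open>For this closed subalgebra, the last clause of \<open>positive_sqrt\<close> says that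
  whatever commutes with \<open>y\<close> commutes with its root.\<close>

lemma closed_subalgebra_commutant:
  fixes c :: "'u::real_normed_algebra"
  shows "closed_subalgebra {x. c * x = x * c}"
  unfolding closed_subalgebra_def
proof (intro conjI ballI)
  show "closed {x. c * x = x * c}"
    by (intro closed_Collect_eq continuous_intros)
  show "subspace {x. c * x = x * c}"
    by (auto simp: subspace_def algebra_simps)
  show "x * y \<in> {x. c * x = x * c}" if "x \<in> {x. c * x = x * c}" "y \<in> {x. c * x = x * c}" for x y
    using that by simp (metis mult.assoc)
qed

text \<open>Put u = r + i t. Commutation makes \<open>u\<^sup>\<star> * u\<close> equal to r^2 +
  t^2, so \<open>norm u\<close> is the square root of \<open>s\<close>; and r is the real part of u.
  This stands in for the order on self-adjoint elements.\<close>

lemma norm_le_of_square_sum: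
  fixes r t :: "'u::unital_cstar_algebra"
  assumes "r\<^sup>\<star> = r" "t\<^sup>\<star> = t" "r * t = t * r" "r * r + t * t = of_real s" "0 \<le> s"
  shows "(norm r)\<^sup>2 \<le> s"
proof -
  define u where "u = r + \<i> *\<^sub>C t"
  have adj: "u\<^sup>\<star> = r - \<i> *\<^sub>C t"
    by (simp add: u_def adj_add adj_scaleC assms)
  have "u\<^sup>\<star> * u = r * r + t * t"
    unfolding adj by (simp add: u_def algebra_simps mult_scaleC_left mult_scaleC_right scaleC_scaleC
        assms(3) scaleC_minus_one)
  then have n: "(norm u)\<^sup>2 = s"
    using cstar_identity[of u] assms(4,5) by simp
  have "r = (1/2) *\<^sub>R (u + u\<^sup>\<star>)"
    unfolding adj by (simp add: u_def flip: scaleR_2)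
  then have "norm r \<le> norm u"
    using norm_triangle_ineq[of u "u\<^sup>\<star>"] by simp
  then have "(norm r)\<^sup>2 \<le> (norm u)\<^sup>2"
    by (rule power_mono) simp
  then show ?thesis using n by simp
qed

text \<open>If w is the limit of the iteration for r^2, then 1 - w commutes with r and (1 - w)^2 +
  r^2 = 1, so \<open>norm_le_of_square_sum\<close> bounds 1 - w.\<close>

lemma norm_one_minus_square:
  fixes r :: "'u::unital_cstar_algebra"
  assumes "r\<^sup>\<star> = r" "norm r \<le> 1"
  shows "norm (1 - r * r) \<le> 1"
proof -
  have "norm (r * r) \<le> 1"
    using assms by (simp add: norm_selfadjoint_square power_le_one)
  moreover have "(r * r)\<^sup>\<star> = r * r"
    by (simp add: adj_mult assms)
  ultimately obtain w where w: "norm w \<le> 1" "w\<^sup>\<star> = w" "(1 - w) * (1 - w) = 1 - r * r"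
    "\<forall>S. closed_subalgebra S \<longrightarrow> r * r \<in> S \<longrightarrow> w \<in> S"
    using visser_sqrt[of "r * r"] by blast
  have "w \<in> {x. r * x = x * r}"
    by (rule w(4)[rule_format, OF closed_subalgebra_commutant]) (simp add: mult.assoc)
  then have c: "(1 - w) * r = r * (1 - w)" by (simp add: algebra_simps)
  have sa: "(1 - w)\<^sup>\<star> = 1 - w" by (simp add: adj_diff w)
  have "(norm (1 - w))\<^sup>2 \<le> 1"
    by (rule norm_le_of_square_sum[OF sa assms(1) c]) (simp_all add: w)
  then show ?thesis
    using norm_selfadjoint_square[OF sa] w(3) by simp
qed

lemma norm_diff_square_le:
  fixes r :: "'u::unital_cstar_algebra"
  assumes "r\<^sup>\<star> = r" "(norm r)\<^sup>2 \<le> s" "0 < s"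
  shows "norm (of_real s - r * r) \<le> s"
proof -
  let ?r = "(1 / sqrt s) *\<^sub>R r"
  have "norm ?r \<le> 1"
    using assms real_le_rsqrt[of "norm r" s] by (simp add: divide_simps)
  then have "norm (1 - ?r * ?r) \<le> 1"
    by (intro norm_one_minus_square) (simp_all add: adj_scaleR assms)
  moreover have "of_real s - r * r = s *\<^sub>R (1 - ?r * ?r)"
    using assms(3) by (simp add: of_real_def scaleR_diff_right)
  ultimately show ?thesis using assms(3) by (simp add: mult_left_le)
qed

text \<open>A converse of \<open>positiveI_norm\<close>. Together they turn positivity into a norm
  estimate that is stable under addition, whence \<open>positive_add\<close>.\<close>

lemma norm_diff_positive_le:
  assumes "positive y" "norm y \<le> s" "0 < s"
  shows "norm (of_real s - y) \<le> s"
proof -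
  obtain r where r: "r\<^sup>\<star> = r" "y = r * r" using assms(1) unfolding positive_def by blast
  have "(norm r)\<^sup>2 \<le> s"
    using assms(2) unfolding r(2) norm_selfadjoint_square[OF r(1)] .
  then show ?thesis
    unfolding r(2) by (rule norm_diff_square_le[OF r(1) _ assms(3)])
qed

lemma positiveI_norm:
  assumes "y\<^sup>\<star> = y" "0 < s" "norm (of_real s - y) \<le> s"
  shows "positive y"
  using positive_sqrt[OF assms] unfolding positive_def by metis

lemma positive_add:
  fixes x y :: "'u::unital_cstar_algebra"
  assumes "positive x" "positive y" shows "positive (x + y)"
proof (rule positiveI_norm)
  let ?s = "norm x + 1" and ?t = "norm y + 1"
  show "(x + y)\<^sup>\<star> = x + y"
    using assms by (simp add: adj_add positive_selfadjoint)
  show "0 < ?s + ?t" by (simp add: add_pos_nonneg add_nonneg_pos)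
  have "of_real (?s + ?t) - (x + y) = (of_real ?s - x) + (of_real ?t - y)"
    by (simp add: algebra_simps)
  also have "norm \<dots> \<le> ?s + ?t"
    by (intro order_trans[OF norm_triangle_ineq] add_mono norm_diff_positive_le assms)
      (simp_all add: add_nonneg_pos)
  finally show "norm (of_real (?s + ?t) - (x + y)) \<le> ?s + ?t" .
qed

lemma positive_square: "r\<^sup>\<star> = r \<Longrightarrow> positive (r * r)"
  by (auto simp: positive_def)

lemma positive_0 [simp]: "positive 0"
  using positive_square[of 0] by simp

lemma positive_scaleR: "positive y \<Longrightarrow> 0 \<le> c \<Longrightarrow> positive (c *\<^sub>R y)"
proof -
  assume "positive y" "0 \<le> c"
  then obtain r where "r\<^sup>\<star> = r" "y = r * r" by (auto simp: positive_def)
  with \<open>0 \<le> c\<close> show ?thesis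
    unfolding positive_def by (intro exI[of _ "sqrt c *\<^sub>R r"]) (simp add: adj_scaleR)
qed

lemma positive_sum: "(\<And>i. i \<in> I \<Longrightarrow> positive (f i)) \<Longrightarrow> positive (sum f I)"
  by (induction I rule: infinite_finite_induct) (simp_all add: positive_add)

lemma positive_sqrt_commuting:
  fixes y :: "'u::unital_cstar_algebra"
  assumes "positive y"
  obtains r where "r\<^sup>\<star> = r" "r * r = y" "positive r" "\<And>c. c * y = y * c \<Longrightarrow> c * r = r * c"
proof -
  define s where "s = norm y + 1"
  have s: "0 < s" "norm (of_real s - y) \<le> s"
    by (simp_all add: s_def add_nonneg_pos norm_diff_positive_le[OF assms] del: of_real_add)
  obtain r where r: "r\<^sup>\<star> = r" "r * r = y" "norm (of_real (sqrt s) - r) \<le> sqrt s"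
    "\<forall>S. closed_subalgebra S \<longrightarrow> 1 \<in> S \<longrightarrow> y \<in> S \<longrightarrow> r \<in> S"
    using positive_sqrt[OF positive_selfadjoint[OF assms] s] by blast
  have "c * r = r * c" if "c * y = y * c" for c
    using r(4)[rule_format, OF closed_subalgebra_commutant[of c]] that by simp
  moreover have "positive r"
    by (rule positiveI_norm[OF r(1) _ r(3)]) (use s in simp)
  ultimately show thesis using that r by blast
qed

text \<open>The roots of y and of -y can be taken to commute, and their squares add up to 0.\<close>

lemma positive_antisym:
  assumes "positive y" "positive (- y)"
  shows "y = 0"
proof -
  obtain r where r: "r\<^sup>\<star> = r" "r * r = y" "\<And>c. c * y = y * c \<Longrightarrow> c * r = r * c"
    using positive_sqrt_commuting[OF assms(1)] by metis
  obtain t where t: "t\<^sup>\<star> = t" "t * t = - y" "\<And>c. c * - y = - y * c \<Longrightarrow> c * t = t * c"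
    using positive_sqrt_commuting[OF assms(2)] by metis
  have "r * y = y * r" by (metis r(2) mult.assoc)
  then have c: "r * t = t * r" by (intro t(3)) simp
  have "(norm r)\<^sup>2 \<le> 0"
    by (rule norm_le_of_square_sum[OF r(1) t(1) c]) (simp_all add: r(2) t(2))
  then show ?thesis using r(2) by simp
qed

text \<open>For \<open>s\<close> above the norm of the sum, s - x = (s - x - y) + y is positive. Its
  root commutes with a root of x, and their squares add up to \<open>s\<close>.\<close>

lemma norm_le_norm_add_positive:
  fixes x y :: "'u::unital_cstar_algebra"
  assumes "positive x" "positive y"
  shows "norm x \<le> norm (x + y)"
proof (rule field_le_epsilon)
  fix e :: real assume "0 < e"
  \<comment> \<open>The summand \<open>e\<close> keeps \<open>s\<close> strictly positive, as
    \<open>positiveI_norm\<close> demands, even when x + y = 0.\<close>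
  define s where "s = norm (x + y) + e"
  have s: "0 < s" "norm (x + y) \<le> s" using \<open>0 < e\<close> by (auto simp: s_def add_nonneg_pos)
  have "positive (of_real s - (x + y))"
    by (rule positiveI_norm[OF _ s(1)])
      (use s assms in \<open>simp_all add: adj_diff adj_add positive_selfadjoint add.commute[of y x]\<close>)
  from positive_add[OF this assms(2)] have "positive (of_real s - x)"
    by (simp add: algebra_simps)
  then obtain t where t: "t\<^sup>\<star> = t" "t * t = of_real s - x"
      "\<And>c. c * (of_real s - x) = (of_real s - x) * c \<Longrightarrow> c * t = t * c"
    using positive_sqrt_commuting by metis
  obtain r where r: "r\<^sup>\<star> = r" "x = r * r" using assms(1) by (auto simp: positive_def)
  have c: "r * t = t * r"
    by (rule t(3)) (simp add: r(2) algebra_simps of_real_def)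
  have "(norm r)\<^sup>2 \<le> s"
    by (rule norm_le_of_square_sum[OF r(1) t(1) c]) (use s r t(2) in simp_all)
  then show "norm x \<le> norm (x + y) + e"
    using norm_selfadjoint_square[OF r(1)] by (simp only: r(2) s_def)
qed

text \<open>\<open>a\<close> and \<open>b\<close> are the real and imaginary parts of
  \<open>z\<close>; the mixed terms cancel when both orders are added.\<close>

lemma square_adj_add:
  fixes z :: "'u::unital_cstar_algebra"
  shows "positive (z\<^sup>\<star> * z + z * z\<^sup>\<star>)"
proof -
  define a where "a = (1/2) *\<^sub>R (z + z\<^sup>\<star>)"
  define b where "b = (1/2) *\<^sub>R (\<i> *\<^sub>C z\<^sup>\<star> + (- \<i>) *\<^sub>C z)"
  have "a\<^sup>\<star> = a" by (simp add: a_def adj_scaleR adj_add adj_adj add.commute)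
  moreover have "b\<^sup>\<star> = b"
    by (simp add: b_def adj_scaleR adj_add adj_diff adj_adj adj_scaleC)
  moreover have "z\<^sup>\<star> * z + z * z\<^sup>\<star> = 2 *\<^sub>R (a * a) + 2 *\<^sub>R (b * b)"
  proof -
    have "(\<i> *\<^sub>C z\<^sup>\<star> + (- \<i>) *\<^sub>C z) * (\<i> *\<^sub>C z\<^sup>\<star> + (- \<i>) *\<^sub>C z) = - ((z\<^sup>\<star> - z) * (z\<^sup>\<star> - z))"
      by (simp add: distrib_left distrib_right left_diff_distrib right_diff_distrib
          mult_scaleC_left mult_scaleC_right scaleC_scaleC complex_vector.scale_right_diff_distrib scaleC_minus_one)
    then have "4 *\<^sub>R (b * b) = - ((z\<^sup>\<star> - z) * (z\<^sup>\<star> - z))"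
      unfolding b_def mult_scaleR_left mult_scaleR_right by simp
    moreover have "4 *\<^sub>R (a * a) = (z + z\<^sup>\<star>) * (z + z\<^sup>\<star>)" by (simp add: a_def)
    ultimately have "4 *\<^sub>R (a * a) + 4 *\<^sub>R (b * b) = 2 *\<^sub>R (z\<^sup>\<star> * z + z * z\<^sup>\<star>)"
      by (simp add: algebra_simps scaleR_2)
    then have "(1/2) *\<^sub>R (4 *\<^sub>R (a * a) + 4 *\<^sub>R (b * b)) = z\<^sup>\<star> * z + z * z\<^sup>\<star>" by simp
    then show ?thesis by (simp add: scaleR_add_right)
  qed
  ultimately show ?thesis
    by (simp add: positive_add positive_scaleR positive_square)
qed

text \<open>The usual proof compares the spectra of \<open>z\<^sup>\<star> * z\<close> and
  \<open>z * z\<^sup>\<star>\<close>. Here \<open>square_adj_add\<close> first makes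
  \<open>z * z\<^sup>\<star>\<close> a square t^2. Applied again, to w = z s, it makes -(s^4 + t^4)
  positive, hence also -t^4, and \<open>positive_antisym\<close> gives t^4 = 0.\<close>

lemma adj_mult_negative_eq_0:
  fixes z :: "'u::unital_cstar_algebra"
  assumes "positive (- (z\<^sup>\<star> * z))"
  shows "z = 0"
proof -
  obtain s where s: "s\<^sup>\<star> = s" "- (z\<^sup>\<star> * z) = s * s" using assms by (auto simp: positive_def)
  have "positive ((z\<^sup>\<star> * z + z * z\<^sup>\<star>) + - (z\<^sup>\<star> * z))"
    by (rule positive_add[OF square_adj_add assms])
  then obtain t where t: "t\<^sup>\<star> = t" "z * z\<^sup>\<star> = t * t" by (auto simp: positive_def)
  define w where "w = z * s"
  have "w * w\<^sup>\<star> = z * (s * s) * z\<^sup>\<star>"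
    by (simp add: w_def adj_mult s mult.assoc)
  also have "\<dots> = - ((t * t) * (t * t))"
    unfolding s(2)[symmetric] t(2)[symmetric] by (simp add: mult.assoc)
  finally have ww: "w * w\<^sup>\<star> = - ((t * t) * (t * t))" .
  have "w\<^sup>\<star> * w = s * (z\<^sup>\<star> * z) * s"
    by (simp add: w_def adj_mult s mult.assoc)
  also have "z\<^sup>\<star> * z = - (s * s)" using s(2) by (metis minus_minus)
  finally have ww': "w\<^sup>\<star> * w = - ((s * s) * (s * s))" by (simp add: mult.assoc)
  have "positive ((t * t) * (t * t))" "positive ((s * s) * (s * s))"
    by (rule positive_square, simp add: adj_mult s t)+
  moreover have "positive (w\<^sup>\<star> * w + w * w\<^sup>\<star>)" by (rule square_adj_add)
  ultimately have "positive ((t * t) * (t * t))" "positive (- ((t * t) * (t * t)))"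
    using positive_add[of "w\<^sup>\<star> * w + w * w\<^sup>\<star>" "(s * s) * (s * s)"] by (simp_all add: ww ww')
  then have "(t * t) * (t * t) = 0" by (rule positive_antisym)
  then have "t * t = 0"
    using adj_mult_eq_0_iff[of "t * t"] by (simp add: adj_mult t)
  then show ?thesis
    using t(2) adj_mult_eq_0_iff[of "z\<^sup>\<star>"] by (simp add: adj_adj) (metis adj_adj adj_zero)
qed

text \<open>With \<open>v = \<bar>y\<bar> - y\<close>, the element \<open>z = x v\<close> satisfies \<open>z\<^sup>\<star> z = v y v = - \<bar>y\<bar> v\<^sup>2 \<le> 0\<close>.\<close>

lemma positive_adj_mult:
  fixes x :: "'u::unital_cstar_algebra"
  shows "positive (x\<^sup>\<star> * x)"
proof -
  define y where "y = x\<^sup>\<star> * x"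
  have y: "y\<^sup>\<star> = y" by (simp add: y_def adj_mult adj_adj)
  obtain p where p: "p\<^sup>\<star> = p" "p * p = y * y" "positive p" "\<And>c. c * (y * y) = (y * y) * c \<Longrightarrow> c * p = p * c"
    using positive_sqrt_commuting[OF positive_square[OF y]] by metis
  \<comment> \<open>The root \<open>q\<close> of p = |y| writes v p v as the square of the
    self-adjoint element q v.\<close>
  obtain q where q: "q\<^sup>\<star> = q" "q * q = p" "\<And>c. c * p = p * c \<Longrightarrow> c * q = q * c"
    using positive_sqrt_commuting[OF p(3)] by metis
  have yp: "y * p = p * y" by (rule p(4)) (simp add: mult.assoc)
  have yq: "y * q = q * y" by (rule q(3)[OF yp])
  have pq: "p * q = q * p" by (simp flip: q(2) add: mult.assoc)
  define v where "v = p - y"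
  have v: "v\<^sup>\<star> = v" by (simp add: v_def adj_diff p y)
  have yv: "y * v = - (p * v)"
    by (simp add: v_def algebra_simps p(2) yp)
  have qv: "q * v = v * q" by (simp add: v_def algebra_simps yq pq)
  have pv: "p * v = v * p" by (simp add: v_def algebra_simps yp)
  have "(x * v)\<^sup>\<star> * (x * v) = v * (y * v)"
    by (simp add: adj_mult v y_def mult.assoc)
  also have "\<dots> = - (v * (q * (q * v)))" by (simp add: yv mult.assoc flip: q(2))
  also have "\<dots> = - ((q * v) * (q * v))" by (simp add: qv mult.assoc)
  finally have e: "(x * v)\<^sup>\<star> * (x * v) = - ((q * v) * (q * v))" .
  have "positive ((q * v) * (q * v))"
    by (rule positive_square) (simp add: adj_mult q v qv)
  then have xv: "x * v = 0"
    by (intro adj_mult_negative_eq_0) (simp add: e)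
  then have "y * v = 0" by (simp add: y_def mult.assoc)
  with yv have "p * v = 0" by simp
  with \<open>y * v = 0\<close> have "v * v = 0" by (simp add: v_def left_diff_distrib)
  then have "v = 0" using adj_mult_eq_0_iff[of v] v by simp
  then show ?thesis using p(3) by (simp add: v_def y_def)
qed

lemma positive_conj:
  fixes c :: "'u::unital_cstar_algebra"
  assumes "positive p" shows "positive (c\<^sup>\<star> * p * c)"
proof -
  obtain r where r: "r\<^sup>\<star> = r" "p = r * r" using assms unfolding positive_def by blast
  have "c\<^sup>\<star> * p * c = (r * c)\<^sup>\<star> * (r * c)"
    unfolding r(2) adj_mult r(1) by (simp only: mult.assoc)
  then show ?thesis using positive_adj_mult by metis
qed

lemma norm_conj_le:
  fixes c :: "'u::unital_cstar_algebra"
  assumes "positive p" "positive q"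
  shows "norm (c\<^sup>\<star> * p * c) \<le> norm (c\<^sup>\<star> * (p + q) * c)"
  using norm_le_norm_add_positive[OF positive_conj[OF assms(1), of c] positive_conj[OF assms(2), of c]]
  by (simp only: distrib_left distrib_right)

section \<open>Powers of 1 - a for a positive contraction a\<close>

lemma geometric_sum_left:
  fixes a :: "'u::ring_1"
  shows "a * (\<Sum>j<n. (1 - a) ^ j) = 1 - (1 - a) ^ n"
proof (induction n)
  case (Suc n)
  have "a * (\<Sum>j<Suc n. (1 - a) ^ j) = 1 - (1 - a) ^ n + a * (1 - a) ^ n"
    by (simp only: sum.lessThan_Suc distrib_left Suc)
  then show ?case by (simp add: left_diff_distrib)
qed simp

text \<open>The third claim is a rate for a (1 - a)^n -> 0. Since the powers of w = 1 - a decrease,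
  n a w^n is dominated by the sum of a w^k over k < n, which equals 1 - w^n.\<close>

lemma positive_contraction_powers:
  fixes a :: "'u::unital_cstar_algebra"
  assumes "positive a" "norm a \<le> 1"
  shows "norm ((1 - a) ^ n) \<le> 1" "norm (1 - (1 - a) ^ n) \<le> 1"
    "real n * norm (a * (1 - a) ^ n) \<le> 1"
proof -
  define w where "w = 1 - a"
  have a: "a\<^sup>\<star> = a" by (rule positive_selfadjoint[OF assms(1)])
  have w: "w\<^sup>\<star> = w" by (simp add: w_def adj_diff a)
  have nw: "norm w \<le> 1"
    using norm_diff_positive_le[OF assms, of] by (simp add: w_def)
  have "positive w"
    by (rule positiveI_norm[OF w, of 1]) (use assms(2) in \<open>simp_all add: w_def\<close>)
  \<comment> \<open>Powers of the root \<open>v\<close> exhibit \<open>w ^ n\<close> as a square,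
    and together with \<open>a\<close> or its root \<open>r\<close> also the products below.\<close>
  then obtain v where v: "v\<^sup>\<star> = v" "v * v = w" "\<And>c. c * w = w * c \<Longrightarrow> c * v = v * c"
    using positive_sqrt_commuting by blast
  obtain r where r: "r\<^sup>\<star> = r" "r * r = a" using assms(1) unfolding positive_def by blast
  have av: "a * v = v * a" by (rule v(3)) (simp add: w_def algebra_simps)
  have rv: "r * v = v * r"
    by (rule v(3)) (simp add: w_def algebra_simps flip: r(2))
  have avn: "a * v ^ n = v ^ n * a" and rvn: "r * v ^ n = v ^ n * r" for n
    using power_commuting_commutes[of v a n] power_commuting_commutes[of v r n] av rv by simp_all
  have vw: "v ^ n * v ^ n = w ^ n" for n
    unfolding v(2)[symmetric] by (metis power2_eq_square power_mult mult.commute power_add mult_2)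
  have vn: "(v ^ n)\<^sup>\<star> = v ^ n" for n by (simp add: adj_power v(1))
  have wn: "norm (w ^ n) \<le> 1" for n
    by (rule order_trans[OF norm_power_ineq]) (simp add: nw power_le_one)
  have "(norm (v ^ n))\<^sup>2 \<le> 1" for n
    using wn[of n] norm_selfadjoint_square[OF vn, of n] by (simp add: vw)
  then have nv: "norm (v ^ n) \<le> 1" for n
    using power_le_one_iff[of "norm (v ^ n)" 2] by simp
  have one: "norm (1 - w ^ n) \<le> 1" for n
    using norm_one_minus_square[OF vn nv, of n] by (simp add: vw)
  have sq: "positive (a * a * w ^ n)" for n
  proof -
    have "a * a * w ^ n = (a * v ^ n) * (a * v ^ n)"
      unfolding vw[symmetric] by (metis avn mult.assoc)
    moreover have "(a * v ^ n)\<^sup>\<star> = a * v ^ n" by (simp add: adj_mult a vn avn)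
    ultimately show ?thesis using positive_square by metis
  qed
  have pw: "positive (a * w ^ n)" for n
  proof -
    have "a * w ^ n = (r * v ^ n) * (r * v ^ n)"
      unfolding vw[symmetric] r(2)[symmetric] by (metis rvn mult.assoc)
    moreover have "(r * v ^ n)\<^sup>\<star> = r * v ^ n" by (simp add: adj_mult r(1) vn rvn)
    ultimately show ?thesis using positive_square by metis
  qed
  \<comment> \<open>Passing from n to n + 1 adds the positive element (n + 1) a^2 w^n.\<close>
  have key: "positive (1 - w ^ n - real n *\<^sub>R (a * w ^ n))" for n
  proof (induction n)
    case (Suc n)
    have Suc_eq: "w ^ Suc n = w ^ n - a * w ^ n"
      by (simp add: w_def left_diff_distrib)
    have "1 - w ^ Suc n - real (Suc n) *\<^sub>R (a * w ^ Suc n) =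
        (1 - w ^ n - real n *\<^sub>R (a * w ^ n)) + real (Suc n) *\<^sub>R (a * a * w ^ n)"
      unfolding Suc_eq by (simp add: algebra_simps)
    then show ?case
      using positive_add[OF Suc positive_scaleR[OF sq[of n] of_nat_0_le_iff[of "Suc n"]]] by (simp only:)
  qed simp
  show "norm ((1 - a) ^ n) \<le> 1" "norm (1 - (1 - a) ^ n) \<le> 1"
    using wn one by (simp_all add: w_def)
  have "norm (real n *\<^sub>R (a * w ^ n)) \<le> norm (1 - w ^ n)"
    using norm_le_norm_add_positive[OF positive_scaleR[OF pw[of n], of "real n"] key[of n]] by simp
  then show "real n * norm (a * (1 - a) ^ n) \<le> 1"
    using one[of n] by (simp add: w_def)
qed

section \<open>Positive elements of C*-subalgebras\<close>

text \<open>Pulls a subalgebra, possibly without unit, back to a closed subalgebra of the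
  unitization that contains 1, so that roots taken there come down to \<open>S\<close>.\<close>

lemma closed_subalgebra_algebra_part:
  fixes S :: "'a::cstar_algebra set"
  assumes "cstar_subalgebra S"
  shows "closed_subalgebra {x. algebra_part x \<in> S}" "1 \<in> {x. algebra_part x \<in> S}"
proof -
  note S = cstar_subalgebraD[OF assms]
  note sub = csubspaceD[OF S(1)]
  show "1 \<in> {x. algebra_part x \<in> S}" by (simp add: one_unitization_def sub)
  have "closed (algebra_part -` S)"
    by (rule closed_vimage[OF S(2)])
      (rule linear_continuous_on[OF bounded_linear_algebra_part])
  then show "closed_subalgebra {x. algebra_part x \<in> S}"
    by (auto simp: closed_subalgebra_def vimage_def subspace_def zero_unitization_def
        plus_unitization_def scaleR_unitization_def times_unitization_def
        intro!: sub S(3))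
qed

lemma positive_Unitize:
  assumes "positive_in UNIV (y::'a::cstar_algebra)"
  shows "positive (Unitize 0 y)"
  using assms positive_adj_mult by (auto simp: positive_in_def Unitize_0_mult Unitize_0_adj)

text \<open>The root exists in the unitization. Its scalar part squares to 0, so it lies in the
  algebra itself, and \<open>closed_subalgebra_algebra_part\<close> puts it into
  \<open>S\<close>.\<close>

lemma positive_sqrt_in_subalgebra:
  fixes S :: "'a::cstar_algebra set"
  assumes "cstar_subalgebra S" "y \<in> S" "positive (Unitize 0 y)"
  obtains r where "r \<in> S" "r\<^sup>\<star> = r" "y = r * r"
proof -
  let ?y = "Unitize 0 y" and ?s = "norm (Unitize 0 y) + 1"
  have s: "0 < ?s" by (simp add: add_nonneg_pos)
  obtain r where r: "r\<^sup>\<star> = r" "r * r = ?y"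
      "\<forall>S. closed_subalgebra S \<longrightarrow> 1 \<in> S \<longrightarrow> ?y \<in> S \<longrightarrow> r \<in> S"
    using positive_sqrt[OF positive_selfadjoint[OF assms(3)] s norm_diff_positive_le[OF assms(3) _ s]]
    by (metis (no_types, lifting) less_add_one order_less_imp_le)
  have "r \<in> {x. algebra_part x \<in> S}"
    by (rule r(3)[rule_format, OF closed_subalgebra_algebra_part[OF assms(1)]]) (simp add: assms)
  then have rS: "algebra_part r \<in> S" by simp
  have "scalar_part r * scalar_part r = 0"
    using scalar_part_simps(1)[of r r] by (simp add: r(2))
  then have u: "Unitize 0 (algebra_part r) = r"
    by (intro Unitize_algebra_part) simp
  have "(algebra_part r)\<^sup>\<star> = algebra_part r"
    using arg_cong[OF r(1), of algebra_part] by (simp add: adj_unitization_def)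
  moreover have "y = algebra_part r * algebra_part r"
  proof -
    have "Unitize 0 y = Unitize 0 (algebra_part r * algebra_part r)"
      by (simp only: Unitize_0_mult u r(2))
    then show ?thesis by simp
  qed
  ultimately show thesis using rS that by blast
qed

lemma positive_in_subalgebra:
  fixes S :: "'a::cstar_algebra set"
  assumes "cstar_subalgebra S" "y \<in> S" "positive_in UNIV y"
  shows "positive_in S y"
proof -
  obtain r where "r \<in> S" "r\<^sup>\<star> = r" "y = r * r"
    using positive_sqrt_in_subalgebra[OF assms(1,2) positive_Unitize[OF assms(3)]] by blast
  then show ?thesis unfolding positive_in_def by metis
qed

text \<open>The approximate unit is 1 - (1 - a)^n, which has scalar part 0. The geometric sum g_n
  satisfies a g_n = e_n, so y_n = g_n e_n satisfies a y_n = e_n^2. Thus a is a limit of products a a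
  y_n, which later puts a into its own corner and into the ideal spanned by the inner products of
  the bimodule.\<close>

lemma approximate_unit_positive:
  fixes a :: "'a::cstar_algebra"
  assumes "positive_in UNIV a" "norm a \<le> 1" "cstar_subalgebra S" "a \<in> S"
  obtains e y where "\<And>n. e n \<in> S" "\<And>n. positive_in S (e n)" "\<And>n. (e n)\<^sup>\<star> = e n" "\<And>n. norm (e n) \<le> 1"
    "(\<lambda>n::nat. e n * a) \<longlonglongrightarrow> a" "(\<lambda>n. a * e n) \<longlonglongrightarrow> a"
    "(\<lambda>n. a * (a * y n)) \<longlonglongrightarrow> a" "\<And>n. a * y n = y n * a"
proof -
  define A where "A = Unitize 0 a"
  define E where "E n = 1 - (1 - A) ^ n" for n
  define g where "g n = (\<Sum>j<n. (1 - A) ^ j)" for n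
  define e where "e n = algebra_part (E n)" for n
  define y where "y n = algebra_part (g n * E n)" for n
  have A: "positive A" "norm A \<le> 1"
    using positive_Unitize[OF assms(1)] assms(2) by (simp_all add: A_def norm_Unitize_0)
  note pow = positive_contraction_powers[OF A]
  have Asa: "A\<^sup>\<star> = A" by (rule positive_selfadjoint[OF A(1)])
  have Esa: "(E n)\<^sup>\<star> = E n" for n by (simp add: E_def adj_diff adj_power Asa)
  have sA: "scalar_part A = 0" by (simp add: A_def)
  have sE: "scalar_part (E n) = 0" for n by (simp add: E_def sA)
  have UE: "Unitize 0 (e n) = E n" for n
    unfolding e_def by (rule Unitize_algebra_part[OF sE])
  have Uy: "Unitize 0 (y n) = g n * E n" for n
    unfolding y_def by (rule Unitize_algebra_part) (simp add: sE)
  have Ag: "A * g n = E n" for n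
    unfolding g_def E_def by (rule geometric_sum_left)
  have comA: "A * (1 - A) ^ n = (1 - A) ^ n * A" for n
    using power_commuting_commutes[of "1 - A" A n] by (simp add: algebra_simps)
  have AE: "A * E n = E n * A" for n by (simp add: E_def algebra_simps comA)
  have gA: "g n * A = A * g n" for n
    unfolding g_def by (simp add: sum_distrib_left sum_distrib_right comA)
  have Epos: "positive (E n)" for n
    by (rule positiveI_norm[OF Esa, of 1]) (simp_all add: E_def pow)
  have eS: "e n \<in> S" for n
  proof -
    note cl = closed_subalgebra_algebra_part[OF assms(3)]
    have "1 - A \<in> {x. algebra_part x \<in> S}"
      by (rule subspace_diff) (use cl assms(4) in \<open>auto simp: closed_subalgebra_def A_def\<close>)
    then have "(1 - A) ^ n \<in> {x. algebra_part x \<in> S}"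
      using cl by (induction n) (auto simp: closed_subalgebra_def)
    then have "E n \<in> {x. algebra_part x \<in> S}"
      unfolding E_def using cl by (intro subspace_diff) (auto simp: closed_subalgebra_def)
    then show ?thesis by (simp add: e_def)
  qed
  have lim: "(\<lambda>n. norm (A * (1 - A) ^ n)) \<longlonglongrightarrow> 0"
  proof (rule tendsto_sandwich[OF _ _ tendsto_const lim_inverse_n'])
    show "eventually (\<lambda>n. norm (A * (1 - A) ^ n) \<le> 1 / real n) sequentially"
      using eventually_gt_at_top[of 0]
    proof eventually_elim
      case (elim n)
      then show ?case using pow(3)[of n] by (simp add: field_simps)
    qed
  qed simp
  have EA: "(\<lambda>n. A * E n) \<longlonglongrightarrow> A"
  proof (rule Lim_transform2[OF tendsto_const])
    show "(\<lambda>n. A - A * E n) \<longlonglongrightarrow> 0"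
      using lim by (simp add: E_def right_diff_distrib tendsto_norm_zero_iff)
  qed
  have EAE: "(\<lambda>n. (A * E n) * E n) \<longlonglongrightarrow> A"
  proof (rule Lim_transform2[OF EA], rule Lim_null_comparison[OF _ lim])
    show "\<forall>\<^sub>F n in sequentially. norm (A * E n - A * E n * E n) \<le> norm (A * (1 - A) ^ n)"
    proof (rule always_eventually, rule allI)
      fix n
      have "A * E n - A * E n * E n = A * (1 - E n) * E n"
        by (simp add: algebra_simps AE)
      also have "\<dots> = (A * (1 - A) ^ n) * E n" by (simp add: E_def)
      also have "norm \<dots> \<le> norm (A * (1 - A) ^ n) * norm (E n)" by (rule norm_mult_ineq)
      also have "\<dots> \<le> norm (A * (1 - A) ^ n) * 1"
        by (intro mult_left_mono) (simp_all add: E_def pow)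
      finally show "norm (A * E n - A * E n * E n) \<le> norm (A * (1 - A) ^ n)" by simp
    qed
  qed
  have descend: "X \<longlonglongrightarrow> x" if "(\<lambda>n. Unitize 0 (X n)) \<longlonglongrightarrow> Unitize 0 x" for X :: "nat \<Rightarrow> 'a" and x
    using bounded_linear.tendsto[OF bounded_linear_algebra_part that] by simp
  show thesis
  proof (rule that[of e y])
    show "e n \<in> S" for n by (rule eS)
    show "norm (e n) \<le> 1" for n
      using norm_Unitize_0[of "e n"] pow(2)[of n] by (simp only: UE E_def)
    show "(e n)\<^sup>\<star> = e n" for n
      using arg_cong[OF Esa, of algebra_part] by (simp add: adj_unitization_def e_def)
    show "positive_in S (e n)" for n
    proof -
      obtain r where "r \<in> S" "r\<^sup>\<star> = r" "e n = r * r"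
        using positive_sqrt_in_subalgebra[OF assms(3) eS, of n] Epos[of n] unfolding UE by blast
      then show ?thesis unfolding positive_in_def by metis
    qed
    show "(\<lambda>n. e n * a) \<longlonglongrightarrow> a" "(\<lambda>n. a * e n) \<longlonglongrightarrow> a"
      by (rule descend; unfold Unitize_0_mult UE A_def[symmetric]; use EA AE in simp)+
    have "A * (A * (g n * E n)) = A * E n * E n" for n
      by (metis Ag mult.assoc)
    then show "(\<lambda>n. a * (a * y n)) \<longlonglongrightarrow> a"
      by (intro descend) (unfold Unitize_0_mult Uy A_def[symmetric], use EAE in simp)
    show "a * y n = y n * a" for n
    proof -
      have "Unitize 0 (a * y n) = Unitize 0 (y n * a)"
        unfolding Unitize_0_mult Uy A_def[symmetric] by (metis AE gA mult.assoc)
      then show ?thesis by simp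
    qed
  qed
qed

text \<open>One positive element \<open>K\<close> controls all the f_i at once: it dominates both
  products of f_i with its adjoint. With V = 1 - u, the squares of the norms to be estimated are
  therefore at most the norm of V K V, by \<open>norm_conj_le\<close>.\<close>

lemma approximate_unit_finite:
  fixes f :: "nat \<Rightarrow> 'a::cstar_algebra"
  assumes "0 < \<epsilon>"
  obtains u where "norm u \<le> 1" "\<And>i. i < N \<Longrightarrow> norm (f i - u * f i) < \<epsilon>"
    "\<And>i. i < N \<Longrightarrow> norm (f i - f i * u) < \<epsilon>"
proof -
  define F where "F i = Unitize 0 (f i)" for i
  define K where "K = (\<Sum>i<N. F i * (F i)\<^sup>\<star> + (F i)\<^sup>\<star> * F i)"
  define k where "k = algebra_part K"
  have pos: "positive (X * X\<^sup>\<star>)" for X :: "'a unitization"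
    using positive_adj_mult[of "X\<^sup>\<star>"] by (simp add: adj_adj)
  have pos2: "positive (F i * (F i)\<^sup>\<star> + (F i)\<^sup>\<star> * F i)" for i
    by (rule positive_add[OF pos positive_adj_mult])
  have Kpos: "positive K" unfolding K_def by (rule positive_sum) (rule pos2)
  have Uk: "Unitize 0 k = K"
    unfolding k_def by (rule Unitize_algebra_part) (simp add: K_def F_def)
  define c where "c = 1 / (norm k + 1)"
  have c: "0 < c" by (simp add: c_def add_nonneg_pos)
  have "Unitize 0 (c *\<^sub>R k) = c *\<^sub>R K" by (simp add: Uk[symmetric] scaleR_unitization_def)
  then have "positive (Unitize 0 (c *\<^sub>R k))" using positive_scaleR[OF Kpos, of c] c by simp
  then obtain r where "r\<^sup>\<star> = r" "c *\<^sub>R k = r * r"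
    by (rule positive_sqrt_in_subalgebra[of UNIV, rotated 2])
      (auto simp: cstar_subalgebra_def complex_vector.subspace_UNIV)
  then have ck: "positive_in UNIV (c *\<^sub>R k)" unfolding positive_in_def by (metis UNIV_I)
  have nck: "norm (c *\<^sub>R k) \<le> 1"
    by (simp add: c_def divide_simps add_nonneg_pos)
  obtain e where e: "\<And>n. (e n)\<^sup>\<star> = e n" "\<And>n. norm (e n) \<le> 1" "(\<lambda>n::nat. e n * (c *\<^sub>R k)) \<longlonglongrightarrow> c *\<^sub>R k"
    by (rule approximate_unit_positive[OF ck nck, of UNIV])
      (auto simp: cstar_subalgebra_def complex_vector.subspace_UNIV)
  have "(\<lambda>n. (1/c) *\<^sub>R (e n * (c *\<^sub>R k))) \<longlonglongrightarrow> (1/c) *\<^sub>R (c *\<^sub>R k)"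
    by (intro tendsto_intros e)
  then have "(\<lambda>n. e n * k) \<longlonglongrightarrow> k" using c by simp
  then have "(\<lambda>n. norm (e n * k - k)) \<longlonglongrightarrow> 0"
    by (simp add: LIM_zero tendsto_norm_zero)
  \<comment> \<open>As \<open>norm V\<close> is at most 2, the norm of V K V is at most twice that
    of V K; half of the squared tolerance therefore suffices.\<close>
  then have "eventually (\<lambda>n. norm (e n * k - k) < \<epsilon>\<^sup>2 / 2) sequentially"
    by (rule order_tendstoD) (use assms in simp)
  then obtain n where n: "norm (e n * k - k) < \<epsilon>\<^sup>2 / 2" by (auto simp: eventually_sequentially)
  define V where "V = 1 - Unitize 0 (e n)"
  have V: "V\<^sup>\<star> = V" by (simp add: V_def adj_diff e Unitize_0_adj[symmetric])
  have nV: "norm V \<le> 2"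
    unfolding V_def using norm_triangle_ineq4[of 1 "Unitize 0 (e n)"] e(2)[of n]
    by (simp add: norm_Unitize_0)
  have "norm (V * K * V) \<le> norm (V * K) * 2"
    using mult_left_mono[OF nV, of "norm (V * K)"] norm_mult_ineq[of "V * K" V] by simp
  moreover have "norm (V * K) = norm (e n * k - k)"
  proof -
    have "V * K = - Unitize 0 (e n * k - k)"
      by (simp add: V_def Uk[symmetric] Unitize_0_mult[symmetric] left_diff_distrib
          linear_diff[OF bounded_linear.linear[OF bounded_linear_Unitize_0]])
    then show ?thesis by (simp add: norm_Unitize_0)
  qed
  ultimately have VKV: "norm (V * K * V) < \<epsilon>\<^sup>2" using n by simp
  have small: "norm (V * F i) < \<epsilon> \<and> norm (V * (F i)\<^sup>\<star>) < \<epsilon>" if "i < N" for i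
  proof -
    define R where "R = (\<Sum>i\<in>{..<N} - {i}. F i * (F i)\<^sup>\<star> + (F i)\<^sup>\<star> * F i)"
    have R: "positive R" unfolding R_def by (rule positive_sum) (rule pos2)
    have K: "K = (F i * (F i)\<^sup>\<star> + (F i)\<^sup>\<star> * F i) + R"
      unfolding K_def R_def using that by (intro sum.remove) auto
    have sq: "(norm (V * X))\<^sup>2 = norm (V\<^sup>\<star> * (X * X\<^sup>\<star>) * V)" for X
      using norm_mult_adj[of "V * X"] by (simp add: adj_mult V mult.assoc)
    have "norm (V\<^sup>\<star> * (F i * (F i)\<^sup>\<star>) * V) \<le> norm (V\<^sup>\<star> * (F i * (F i)\<^sup>\<star> + ((F i)\<^sup>\<star> * F i + R)) * V)"
      by (rule norm_conj_le[OF pos positive_add[OF positive_adj_mult R]])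
    also have "\<dots> = norm (V * K * V)" by (simp add: K V add.assoc)
    finally have "(norm (V * F i))\<^sup>2 < \<epsilon>\<^sup>2" using VKV sq by simp
    moreover have "norm (V\<^sup>\<star> * ((F i)\<^sup>\<star> * F i) * V) \<le> norm (V\<^sup>\<star> * ((F i)\<^sup>\<star> * F i + (F i * (F i)\<^sup>\<star> + R)) * V)"
      by (rule norm_conj_le[OF positive_adj_mult positive_add[OF pos R]])
    then have "norm (V\<^sup>\<star> * ((F i)\<^sup>\<star> * F i) * V) \<le> norm (V * K * V)"
      by (simp add: K V ac_simps)
    then have "(norm (V * (F i)\<^sup>\<star>))\<^sup>2 < \<epsilon>\<^sup>2" using VKV sq[of "(F i)\<^sup>\<star>"] by (simp add: adj_adj)
    ultimately show ?thesis
      using assms by (meson less_imp_le power_less_imp_less_base)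
  qed
  have VF: "V * F i = Unitize 0 (f i - e n * f i)" for i
    by (simp add: V_def F_def left_diff_distrib Unitize_0_mult[symmetric]
        linear_diff[OF bounded_linear.linear[OF bounded_linear_Unitize_0]])
  have VF': "(V * (F i)\<^sup>\<star>)\<^sup>\<star> = Unitize 0 (f i - f i * e n)" for i
    by (simp add: adj_mult adj_adj V)
      (simp add: V_def F_def right_diff_distrib Unitize_0_mult[symmetric]
        linear_diff[OF bounded_linear.linear[OF bounded_linear_Unitize_0]])
  show thesis
  proof (rule that[of "e n"])
    show "norm (f i - e n * f i) < \<epsilon>" if "i < N" for i
      using small[OF that] VF[of i] by (simp add: norm_Unitize_0)
    show "norm (f i - f i * e n) < \<epsilon>" if "i < N" for i
      using small[OF that] VF'[of i] norm_adj[of "V * (F i)\<^sup>\<star>"] by (metis norm_Unitize_0)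
  qed (rule e)
qed

section \<open>Approximate units of separable algebras\<close>

lemma separable_dense_sequence:
  assumes "separable_space (euclidean :: 'x::metric_space topology)"
  obtains q :: "nat \<Rightarrow> 'x::metric_space" where "closure (range q) = UNIV"
proof -
  obtain Q :: "'x::metric_space set" where Q: "countable Q" "closure Q = UNIV"
    using assms by (auto simp: separable_space_def euclidean_closure_of)
  moreover have "Q \<noteq> {}" using Q(2) by auto
  ultimately have "range (from_nat_into Q) = Q" by (simp add: range_from_nat_into)
  then show thesis using that Q(2) by metis
qed

lemma closed_tendsto_ident:
  fixes T :: "nat \<Rightarrow> 'x::real_normed_vector \<Rightarrow> 'x"
  assumes "\<And>n. bounded_linear (T n)" "\<And>n x. norm (T n x) \<le> norm x"
  shows "closed {x. (\<lambda>n. T n x) \<longlonglongrightarrow> x}"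
  unfolding closed_sequential_limits
proof (intro allI impI, simp, rule LIMSEQ_I)
  fix f l and e :: real
  assume fl: "(\<forall>n. (\<lambda>m. T m (f n)) \<longlonglongrightarrow> f n) \<and> f \<longlonglongrightarrow> l" and e: "0 < e"
  then obtain k where k: "norm (f k - l) < e / 3"
    using LIMSEQ_D[of f l "e / 3"] by auto
  obtain M where M: "\<And>n. n \<ge> M \<Longrightarrow> norm (T n (f k) - f k) < e / 3"
    using LIMSEQ_D[of "\<lambda>m. T m (f k)" "f k" "e / 3"] fl e by auto
  show "\<exists>no. \<forall>n\<ge>no. norm (T n l - l) < e"
  proof (intro exI allI impI)
    fix n assume n: "M \<le> n"
    have "T n l - l = (T n (f k) - f k) + (f k - l) - T n (f k - l)"
      by (simp add: linear_diff[OF bounded_linear.linear[OF assms(1)]])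
    also have "norm \<dots> \<le> norm (T n (f k) - f k) + norm (f k - l) + norm (T n (f k - l))"
      by (intro order_trans[OF norm_triangle_ineq4] add_mono norm_triangle_ineq order_refl)
    finally show "norm (T n l - l) < e" using M[OF n] k assms(2)[of n "f k - l"] by linarith
  qed
qed

text \<open>The n-th element is adapted to the first n terms of a dense sequence with tolerance 1/(n
  + 1). Contractivity extends the convergence from the dense sequence to all
  \<open>x\<close>.\<close>

lemma approximate_unit_separable:
  assumes "separable_space (euclidean :: 'a::cstar_algebra topology)"
  obtains u :: "nat \<Rightarrow> 'a::cstar_algebra" where "\<And>n. norm (u n) \<le> 1" "\<And>x. (\<lambda>n. u n * x) \<longlonglongrightarrow> x" "\<And>x. (\<lambda>n. x * u n) \<longlonglongrightarrow> x"
proof -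
  obtain q :: "nat \<Rightarrow> 'a" where q: "closure (range q) = UNIV"
    using separable_dense_sequence[OF assms] .
  have "\<exists>u. norm u \<le> 1 \<and> (\<forall>i<n. norm (q i - u * q i) < 1 / real (Suc n)) \<and>
      (\<forall>i<n. norm (q i - q i * u) < 1 / real (Suc n))" for n
  proof -
    have "0 < 1 / real (Suc n)" by simp
    then show ?thesis
      by (rule approximate_unit_finite[where f = q and N = n]) blast
  qed
  then obtain u where u: "\<And>n. norm (u n) \<le> 1" "\<And>n i. i < n \<Longrightarrow> norm (q i - u n * q i) < 1 / real (Suc n)"
      "\<And>n i. i < n \<Longrightarrow> norm (q i - q i * u n) < 1 / real (Suc n)"
    by metis
  have conv: "(\<lambda>n. T n x) \<longlonglongrightarrow> x"
    if T: "\<And>n. bounded_linear (T n)" "\<And>n x. norm (T n x) \<le> norm x"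
      "\<And>n i. i < n \<Longrightarrow> norm (q i - T n (q i)) < 1 / real (Suc n)"
    for T :: "nat \<Rightarrow> 'a \<Rightarrow> 'a" and x
  proof -
    have "(\<lambda>n. q i - T n (q i)) \<longlonglongrightarrow> 0" for i
    proof (rule Lim_null_comparison)
      show "\<forall>\<^sub>F n in sequentially. norm (q i - T n (q i)) \<le> 1 / real (Suc n)"
        using eventually_gt_at_top[of i] by eventually_elim (intro less_imp_le T(3))
      show "(\<lambda>n. 1 / real (Suc n)) \<longlonglongrightarrow> 0"
        using LIMSEQ_inverse_real_of_nat by (simp add: inverse_eq_divide)
    qed
    then have "(\<lambda>n. T n (q i)) \<longlonglongrightarrow> q i" for i
      by (rule Lim_transform2[OF tendsto_const])
    then have "closure (range q) \<subseteq> {x. (\<lambda>n. T n x) \<longlonglongrightarrow> x}"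
      by (intro closure_minimal closed_tendsto_ident T) blast
    then show ?thesis using q by auto
  qed
  show thesis
  proof (rule that[of u])
    show "(\<lambda>n. u n * x) \<longlonglongrightarrow> x" for x
      by (rule conv[of "\<lambda>n x. u n * x"]) (rule bounded_linear_mult_right norm_mult_contraction u; assumption?)+
    show "(\<lambda>n. x * u n) \<longlonglongrightarrow> x" for x
      by (rule conv[of "\<lambda>n x. x * u n"]) (rule bounded_linear_mult_left norm_mult_contraction u; assumption?)+
  qed (rule u(1))
qed

section \<open>Matrix units and compact operators on \<open>\<ell>\<^sup>2\<close>\<close>

lemma ell2_eqI: "(\<And>i. Rep_ell2 x i = Rep_ell2 y i) \<Longrightarrow> x = y"
  by (metis Rep_ell2_inject ext)

lemma Rep_ell2_sum: "Rep_ell2 (sum f I) j = (\<Sum>i\<in>I. Rep_ell2 (f i) j)"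
  by (induction I rule: infinite_finite_induct) (simp_all add: zero_ell2.rep_eq plus_ell2.rep_eq)

lemma norm_ell2_has_sum: "((\<lambda>i. (cmod (Rep_ell2 x i))\<^sup>2) has_sum (norm x)\<^sup>2) UNIV"
proof -
  have "(norm x)\<^sup>2 = (\<Sum>\<^sub>\<infinity>i. (cmod (Rep_ell2 x i))\<^sup>2)"
    by (simp add: power2_norm_eq_inner inner_ell2_def cinner_self)
  then show ?thesis using Rep_ell2[of x] by (simp add: has_sum_infsum)
qed

lemma norm_ell2_basis [simp]: "norm (ell2_basis i) = 1"
proof -
  have "((\<lambda>j. (cmod (Rep_ell2 (ell2_basis i) j))\<^sup>2) has_sum (cmod (Rep_ell2 (ell2_basis i) i))\<^sup>2) UNIV"
    by (rule has_sum_finite_neutralI[where B = "{i}"]) (auto simp: ell2_basis.rep_eq)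
  then have "(norm (ell2_basis i))\<^sup>2 = 1"
    using has_sum_unique[OF norm_ell2_has_sum] by (fastforce simp: ell2_basis.rep_eq)
  then show ?thesis by (metis norm_ge_zero power2_eq_iff_nonneg power_one zero_le_one)
qed

lemma matrix_unit_apply: "blinfun_apply (\<Theta> i j) x = Rep_ell2 x j *\<^sub>C ell2_basis i"
  by (simp add: matrix_unit.rep_eq cinner_ell2_basis)

lemma Rep_matrix_unit: "Rep_ell2 (blinfun_apply (\<Theta> i j) x) l = (if l = i then Rep_ell2 x j else 0)"
  by (simp add: matrix_unit_apply scaleC_ell2.rep_eq ell2_basis.rep_eq)

lemma clinear_matrix_unit: "clinear (blinfun_apply (\<Theta> i j))"
  by (simp add: clinear_def matrix_unit_apply plus_ell2.rep_eq scaleC_ell2.rep_eq scaleC_add_left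
      scaleC_scaleC)

lemma matrix_unit_compose: "\<Theta> i j o\<^sub>L \<Theta> k l = (if j = k then \<Theta> i l else 0)"
  by (rule blinfun_eqI) (auto simp: matrix_unit_apply scaleC_ell2.rep_eq ell2_basis.rep_eq)

lemma matrix_unit_adjoint: "adjoint_pair (\<Theta> i j) (\<Theta> j i)"
  unfolding adjoint_pair_def
proof (intro allI)
  fix u v :: "'a ell2"
  have "cinner (Rep_ell2 u j *\<^sub>C ell2_basis i) v = cnj (Rep_ell2 u j) * Rep_ell2 v i"
    by (simp add: cinner_scaleC_left cinner_ell2_basis)
  also have "\<dots> = cnj (cinner (Rep_ell2 v i *\<^sub>C ell2_basis j) u)"
    by (simp add: cinner_scaleC_left cinner_ell2_basis)
  also have "\<dots> = cinner u (Rep_ell2 v i *\<^sub>C ell2_basis j)"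
    by (rule cinner_commute[symmetric])
  finally show "cinner (blinfun_apply (\<Theta> i j) u) v = cinner u (blinfun_apply (\<Theta> j i) v)"
    by (simp only: matrix_unit_apply)
qed

lemma norm_matrix_unit [simp]: "norm (\<Theta> i j) = 1"
proof (rule antisym)
  show "norm (\<Theta> i j) \<le> 1"
    by (rule norm_blinfun_bound) (simp_all add: matrix_unit_apply norm_scaleC norm_ell2_coordinate)
  show "1 \<le> norm (\<Theta> i j)"
    using norm_blinfun[of "\<Theta> i j" "ell2_basis j"]
    by (simp add: matrix_unit_apply norm_scaleC ell2_basis.rep_eq)
qed

lemma compact_operatorI:
  assumes "clinear (blinfun_apply T)" "T ` cball 0 1 \<subseteq> K" "compact K"
  shows "T \<in> compact_operators"
proof -
  have "closure (T ` cball 0 1) \<subseteq> K"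
    using assms(2,3) by (simp add: closure_minimal compact_imp_closed)
  then have "compact (closure (T ` cball 0 1))"
    using assms(3) by (metis closed_closure compact_Int_closed inf.absorb2)
  then show ?thesis using assms(1) by (simp add: compact_operators_def)
qed

lemma compact_operatorD:
  assumes "T \<in> compact_operators"
  shows "clinear (blinfun_apply T)" "compact (closure (T ` cball 0 1))"
    "\<And>x. x \<in> cball 0 1 \<Longrightarrow> T x \<in> closure (T ` cball 0 1)"
  using assms closure_subset[of "T ` cball 0 1"] by (auto simp: compact_operators_def)

lemma matrix_unit_compact: "\<Theta> i j \<in> compact_operators"
proof (rule compact_operatorI[OF clinear_matrix_unit])
  have "bounded_linear (\<lambda>c. c *\<^sub>C ell2_basis i)"
  proof (rule bounded_linear_intro[of _ 1])
    show "(r *\<^sub>R c) *\<^sub>C ell2_basis i = r *\<^sub>R c *\<^sub>C ell2_basis i" for r c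
      using scaleC_scaleC[of "complex_of_real r" c "ell2_basis i"]
      by (simp only: scaleC_of_real scaleR_conv_of_real)
  qed (simp_all add: scaleC_add_left norm_scaleC)
  then show "compact ((\<lambda>c. c *\<^sub>C ell2_basis i) ` cball 0 1)"
    by (intro compact_continuous_image linear_continuous_on) simp_all
  show "\<Theta> i j ` cball 0 1 \<subseteq> (\<lambda>c. c *\<^sub>C ell2_basis i) ` cball 0 1"
    by (auto simp: matrix_unit_apply intro!: imageI order_trans[OF norm_ell2_coordinate])
qed

lemma csubspace_compact_operators: "csubspace (compact_operators :: 'i operator set)"
  unfolding complex_vector.subspace_def
proof (intro conjI ballI allI)
  show "(0 :: 'i operator) \<in> compact_operators"
    by (rule compact_operatorI[where K = "{0}"]) (auto simp: clinear_def)
  fix S T :: "'i operator" and c :: complex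
  assume S: "S \<in> compact_operators"
  note S' = compact_operatorD[OF S]
  show "c *\<^sub>C S \<in> compact_operators"
  proof (rule compact_operatorI)
    show "clinear (blinfun_apply (c *\<^sub>C S))"
      using S'(1) by (simp add: clinear_def scaleC_blinfun.rep_eq scaleC_add_right scaleC_scaleC mult.commute)
    show "(c *\<^sub>C S) ` cball 0 1 \<subseteq> (\<lambda>x. c *\<^sub>C x) ` closure (S ` cball 0 1)"
      using S'(3) by (auto simp: scaleC_blinfun.rep_eq)
    show "compact ((\<lambda>x. c *\<^sub>C x) ` closure (S ` cball 0 1))"
      by (intro compact_continuous_image S' linear_continuous_on bounded_linear_scaleC_right)
  qed
  assume T: "T \<in> compact_operators"
  note T' = compact_operatorD[OF T]
  show "S + T \<in> compact_operators"
  proof (rule compact_operatorI)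
    show "clinear (blinfun_apply (S + T))"
      using S'(1) T'(1) by (simp add: clinear_def blinfun.add_left scaleC_add_right)
    show "(S + T) ` cball 0 1 \<subseteq> {x + y |x y. x \<in> closure (S ` cball 0 1) \<and> y \<in> closure (T ` cball 0 1)}"
      using S'(3) T'(3) unfolding blinfun.add_left by blast
    show "compact {x + y |x y. x \<in> closure (S ` cball 0 1) \<and> y \<in> closure (T ` cball 0 1)}"
      by (intro compact_sums S' T')
  qed
qed

lemma compose_compact:
  assumes "T \<in> compact_operators" "clinear (blinfun_apply S)"
  shows "S o\<^sub>L T \<in> compact_operators"
proof (rule compact_operatorI)
  note T = compact_operatorD[OF assms(1)]
  show "clinear (blinfun_apply (S o\<^sub>L T))"
    using T(1) assms(2) by (simp add: clinear_def)
  show "(S o\<^sub>L T) ` cball 0 1 \<subseteq> S ` closure (T ` cball 0 1)"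
    using T(3) by auto
  show "compact (S ` closure (T ` cball 0 1))"
    by (intro compact_continuous_image T linear_continuous_on blinfun.bounded_linear_right)
qed

text \<open>The bound on \<open>S\<close> keeps the image of the unit ball inside the unit ball.
  Matrix units, of norm 1, meet it.\<close>

lemma compact_compose_contraction:
  assumes "T \<in> compact_operators" "clinear (blinfun_apply S)" "norm S \<le> 1"
  shows "T o\<^sub>L S \<in> compact_operators"
proof (rule compact_operatorI)
  note T = compact_operatorD[OF assms(1)]
  show "clinear (blinfun_apply (T o\<^sub>L S))"
    using T(1) assms(2) by (simp add: clinear_def)
  have "S x \<in> cball 0 1" if "x \<in> cball 0 1" for x
  proof -
    have "norm (S x) \<le> norm S * norm x" by (rule norm_blinfun)
    also have "\<dots> \<le> 1 * 1" by (intro mult_mono assms) (use that in auto)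
    finally show ?thesis by simp
  qed
  then show "(T o\<^sub>L S) ` cball 0 1 \<subseteq> closure (T ` cball 0 1)"
    using T(3) by auto
qed (rule compact_operatorD[OF assms(1)])

section \<open>Coordinate projections and finite sections\<close>

definition truncation :: "nat \<Rightarrow> nat operator" where
  "truncation n = (\<Sum>i<n. \<Theta> i i)"

lemma Rep_truncation: "Rep_ell2 (truncation n x) j = (if j < n then Rep_ell2 x j else 0)"
  by (simp add: truncation_def blinfun.sum_left Rep_ell2_sum Rep_matrix_unit)

lemma norm_truncation: "(norm (truncation n x))\<^sup>2 = (\<Sum>j<n. (cmod (Rep_ell2 x j))\<^sup>2)"
proof -
  have "((\<lambda>j. (cmod (Rep_ell2 (truncation n x) j))\<^sup>2) has_sum (\<Sum>j<n. (cmod (Rep_ell2 x j))\<^sup>2)) UNIV"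
    by (rule has_sum_finite_neutralI[where B = "{..<n}"]) (auto simp: Rep_truncation)
  then show ?thesis
    using has_sum_unique[OF norm_ell2_has_sum] by blast
qed

lemma norm_truncation_complement:
  "(norm (x - truncation n x))\<^sup>2 = (norm x)\<^sup>2 - (\<Sum>j<n. (cmod (Rep_ell2 x j))\<^sup>2)"
proof -
  have "((\<lambda>j. (cmod (Rep_ell2 x j))\<^sup>2 + - (cmod (Rep_ell2 (truncation n x) j))\<^sup>2) has_sum
      (norm x)\<^sup>2 + - (norm (truncation n x))\<^sup>2) UNIV"
    by (intro has_sum_add norm_ell2_has_sum) (simp only: has_sum_uminus minus_minus norm_ell2_has_sum)
  moreover have "(\<lambda>j. (cmod (Rep_ell2 x j))\<^sup>2 + - (cmod (Rep_ell2 (truncation n x) j))\<^sup>2) =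
      (\<lambda>j. (cmod (Rep_ell2 (x - truncation n x) j))\<^sup>2)"
    by (auto simp: Rep_truncation minus_ell2.rep_eq)
  ultimately show ?thesis
    using has_sum_unique[OF norm_ell2_has_sum[of "x - truncation n x"]] by (simp add: norm_truncation)
qed

lemma norm_truncation_complement_le: "norm (x - truncation n x) \<le> norm x"
proof (rule power2_le_imp_le)
  show "(norm (x - truncation n x))\<^sup>2 \<le> (norm x)\<^sup>2"
    unfolding norm_truncation_complement by (simp add: sum_nonneg)
qed simp

lemma truncation_tendsto: "(\<lambda>n. truncation n x) \<longlonglongrightarrow> x"
proof -
  have "(\<lambda>j. (cmod (Rep_ell2 x j))\<^sup>2) sums (norm x)\<^sup>2"
    by (rule has_sum_imp_sums[OF norm_ell2_has_sum])
  then have "(\<lambda>n. (norm x)\<^sup>2 - (\<Sum>j<n. (cmod (Rep_ell2 x j))\<^sup>2)) \<longlonglongrightarrow> (norm x)\<^sup>2 - (norm x)\<^sup>2"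
    unfolding sums_def by (intro tendsto_intros)
  then have "(\<lambda>n. (norm (x - truncation n x))\<^sup>2) \<longlonglongrightarrow> 0"
    by (simp add: norm_truncation_complement)
  then have "(\<lambda>n. sqrt ((norm (x - truncation n x))\<^sup>2)) \<longlonglongrightarrow> sqrt 0"
    by (rule tendsto_real_sqrt)
  then have "(\<lambda>n. x - truncation n x) \<longlonglongrightarrow> 0"
    by (simp add: tendsto_norm_zero_iff)
  then show ?thesis by (rule Lim_transform2[OF tendsto_const])
qed

text \<open>Strong convergence of the truncations is uniform on the totally bounded image of the
  unit ball: it is checked on a finite net, and the complementary projections, being contractive, do
  not enlarge the distance to the net.\<close>

lemma truncation_compose_tendsto:
  assumes "T \<in> compact_operators"
  shows "(\<lambda>n. truncation n o\<^sub>L T) \<longlonglongrightarrow> T"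
proof (rule LIMSEQ_I)
  fix e :: real assume e: "0 < e"
  note T = compact_operatorD[OF assms]
  have "\<exists>F. finite F \<and> F \<subseteq> closure (T ` cball 0 1) \<and> closure (T ` cball 0 1) \<subseteq> (\<Union>y\<in>F. ball y (e/4))"
    using compact_imp_seq_compact[OF T(2)] e
    by (intro seq_compact_imp_totally_bounded[rule_format]) simp_all
  then obtain F where F: "finite F" "closure (T ` cball 0 1) \<subseteq> (\<Union>y\<in>F. ball y (e/4))" by blast
  have "eventually (\<lambda>n. \<forall>y\<in>F. dist (truncation n y) y < e/4) sequentially"
    using F(1) e by (intro eventually_ball_finite ballI tendstoD[OF truncation_tendsto]) simp_all
  then obtain N where N: "\<And>n y. n \<ge> N \<Longrightarrow> y \<in> F \<Longrightarrow> dist (truncation n y) y < e/4"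
    by (auto simp: eventually_sequentially)
  show "\<exists>N. \<forall>n\<ge>N. norm ((truncation n o\<^sub>L T) - T) < e"
  proof (intro exI allI impI)
    fix n assume n: "N \<le> n"
    have ball: "norm (((truncation n o\<^sub>L T) - T) x) \<le> e / 2" if "norm x \<le> 1" for x
    proof -
      have "T x \<in> closure (T ` cball 0 1)" using T(3)[of x] that by simp
      then obtain y where y: "y \<in> F" "dist y (T x) < e/4" using F(2) by auto
      have "T x - truncation n (T x) =
          (T x - y - truncation n (T x - y)) + (y - truncation n y)"
        by (simp add: blinfun.diff_right)
      also have "norm \<dots> \<le> norm (T x - y) + norm (y - truncation n y)"
        by (intro order_trans[OF norm_triangle_ineq] add_mono norm_truncation_complement_le order_refl)
      also have "\<dots> \<le> e / 4 + e / 4"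
        using y(2) N[OF n y(1)] by (simp add: dist_norm norm_minus_commute)
      finally have "norm (T x - truncation n (T x)) \<le> e / 2" by simp
      then show ?thesis
        by (simp only: blinfun.diff_left blinfun_apply_blinfun_compose norm_minus_commute)
    qed
    have "norm ((truncation n o\<^sub>L T) - T) \<le> e / 2"
    proof (rule norm_blinfun_bound)
      fix x
      show "norm (((truncation n o\<^sub>L T) - T) x) \<le> e / 2 * norm x"
      proof (cases "x = 0")
        case False
        have "norm (((truncation n o\<^sub>L T) - T) ((1 / norm x) *\<^sub>R x)) \<le> e / 2"
          by (rule ball) simp
        then have "norm (((truncation n o\<^sub>L T) - T) x) / norm x \<le> e / 2"
          unfolding blinfun.scaleR_right by simp
        then show ?thesis using False by (simp add: pos_divide_le_eq)
      qed simp
    qed (use e in simp)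
    then show "norm ((truncation n o\<^sub>L T) - T) < e" using e by simp
  qed
qed

text \<open>The \<open>i\<close>-th row of an operator is square summable, so that it is approximated in norm by its
  finite sections.\<close>

lemma matrix_row_in_closure:
  fixes T :: "nat operator"
  assumes "clinear (blinfun_apply T)"
  shows "\<Theta> i i o\<^sub>L T \<in> closure (cspan (range (case_prod \<Theta>)))"
proof -
  define \<phi> where "\<phi> x = Rep_ell2 (T x) i" for x
  define c where "c j = \<phi> (ell2_basis j)" for j
  have add: "\<phi> (x + y) = \<phi> x + \<phi> y" and scale: "\<phi> (z *\<^sub>C x) = z * \<phi> x" for x y z
    using assms by (simp_all add: \<phi>_def clinear_def plus_ell2.rep_eq scaleC_ell2.rep_eq)
  have zero: "\<phi> 0 = 0" using scale[of 0 0] by simp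
  have sum: "\<phi> (sum f I) = (\<Sum>j\<in>I. \<phi> (f j))" for f :: "nat \<Rightarrow> nat ell2" and I
    by (induction I rule: infinite_finite_induct) (simp_all add: add zero)
  have bound: "cmod (\<phi> x) \<le> norm T * norm x" for x
    unfolding \<phi>_def using norm_ell2_coordinate norm_blinfun by (rule order_trans)
  have trunc: "truncation n x = (\<Sum>j<n. Rep_ell2 x j *\<^sub>C ell2_basis j)" for n x
    by (simp add: truncation_def blinfun.sum_left matrix_unit_apply)
  have \<phi>_trunc: "\<phi> (truncation n x) = (\<Sum>j<n. Rep_ell2 x j * c j)" for n x
    by (simp add: trunc sum scale c_def)
  have sq: "(\<Sum>j<n. (cmod (c j))\<^sup>2) \<le> (norm T)\<^sup>2" for n
  proof -
    \<comment> \<open>The vector representing the functional up to index \<open>n\<close>: the value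
      at \<open>v\<close> is the square of \<open>norm v\<close>, so boundedness of the functional
      gives \<open>norm v\<close> at most \<open>norm T\<close>.\<close>
    define v where "v = (\<Sum>j<n. cnj (c j) *\<^sub>C ell2_basis j)"
    let ?s = "\<Sum>j<n. (cmod (c j))\<^sup>2"
    have Rv: "Rep_ell2 v j = (if j < n then cnj (c j) else 0)" for j
      by (simp add: v_def Rep_ell2_sum scaleC_ell2.rep_eq ell2_basis.rep_eq
          if_distrib[of "(*) _"] sum.delta' cong: if_cong)
    have "truncation n v = v"
      by (rule ell2_eqI) (simp add: Rep_truncation Rv)
    then have nv: "(norm v)\<^sup>2 = ?s"
      using norm_truncation[of n v] by (simp add: Rv)
    have "\<phi> v = (\<Sum>j<n. cnj (c j) * c j)"
      by (simp add: v_def sum scale c_def)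
    also have "\<dots> = of_real ?s"
      by (simp add: complex_norm_square mult.commute del: of_real_power)
    finally have \<phi>v: "\<phi> v = of_real ?s" .
    have "0 \<le> ?s" by (simp add: sum_nonneg)
    then have "?s \<le> norm T * norm v"
      using bound[of v] unfolding \<phi>v norm_of_real by (simp only: abs_of_nonneg)
    then have "norm v * norm v \<le> norm T * norm v"
      using nv by (simp add: power2_eq_square)
    then have "norm v \<le> norm T" by (cases "v = 0") auto
    then show ?thesis using nv by (metis norm_ge_zero power_mono)
  qed
  have summ: "summable (\<lambda>j. (cmod (c j))\<^sup>2)"
    by (rule summableI_nonneg_bounded[OF _ sq]) simp
  \<comment> \<open>The tail of the square sum. By Cauchy-Schwarz, its square root bounds the
    distance of the row from its first \<open>m\<close> coefficients.\<close>
  define t where "t m = (\<Sum>j. (cmod (c j))\<^sup>2) - (\<Sum>j<m. (cmod (c j))\<^sup>2)" for m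
  have t0: "t \<longlonglongrightarrow> 0"
    using tendsto_diff[OF tendsto_const[of "\<Sum>j. (cmod (c j))\<^sup>2"] summable_LIMSEQ[OF summ]]
    by (simp add: t_def[abs_def])
  have t_nonneg: "0 \<le> t m" for m
    by (simp add: t_def sum_le_suminf[OF summ])
  have tail: "cmod (\<phi> x - \<phi> (truncation m x)) \<le> sqrt (t m) * norm x" for m x
  proof (rule LIMSEQ_le_const2)
    have "(\<lambda>n. \<phi> (truncation n x)) \<longlonglongrightarrow> \<phi> x"
    proof (rule Lim_null_comparison[THEN LIM_zero_cancel])
      show "\<forall>\<^sub>F n in sequentially. norm (\<phi> (truncation n x) - \<phi> x) \<le> norm T * norm (truncation n x - x)"
        using bound add by (intro always_eventually allI) (metis add_diff_cancel_right' diff_add_cancel)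
      show "(\<lambda>n. norm T * norm (truncation n x - x)) \<longlonglongrightarrow> 0"
        using tendsto_mult_right_zero[OF tendsto_norm_zero[OF LIM_zero[OF truncation_tendsto]]] .
    qed
    then show "(\<lambda>n. cmod (\<phi> (truncation n x) - \<phi> (truncation m x))) \<longlonglongrightarrow> cmod (\<phi> x - \<phi> (truncation m x))"
      by (intro tendsto_intros)
    show "\<exists>N. \<forall>n\<ge>N. cmod (\<phi> (truncation n x) - \<phi> (truncation m x)) \<le> sqrt (t m) * norm x"
    proof (intro exI allI impI)
      fix n assume mn: "m \<le> n"
      have split: "(\<Sum>j<n. f j) - (\<Sum>j<m. f j) = (\<Sum>j=m..<n. f j)" for f :: "nat \<Rightarrow> 'z::ab_group_add"
        using mn sum_diff_nat_ivl[of 0 m n f] by (simp add: atLeast0LessThan)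
      have "cmod (\<phi> (truncation n x) - \<phi> (truncation m x)) \<le> (\<Sum>j=m..<n. cmod (Rep_ell2 x j) * cmod (c j))"
        unfolding \<phi>_trunc split by (rule order_trans[OF norm_sum]) (simp add: norm_mult)
      also have "\<dots> \<le> sqrt (t m) * norm x"
      proof (rule power2_le_imp_le)
        have "(\<Sum>j=m..<n. cmod (Rep_ell2 x j) * cmod (c j))\<^sup>2 \<le>
            (\<Sum>j=m..<n. (cmod (Rep_ell2 x j))\<^sup>2) * (\<Sum>j=m..<n. (cmod (c j))\<^sup>2)"
          by (rule Cauchy_Schwarz_ineq_sum)
        also have "\<dots> \<le> (norm x)\<^sup>2 * t m"
        proof (intro mult_mono)
          have "(\<Sum>j=m..<n. (cmod (Rep_ell2 x j))\<^sup>2) \<le> (\<Sum>j<n. (cmod (Rep_ell2 x j))\<^sup>2)"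
            by (intro sum_mono2) auto
          also have "\<dots> \<le> (norm x)\<^sup>2"
            using norm_truncation_complement[of x n] by (metis diff_ge_0_iff_ge zero_le_power2)
          finally show "(\<Sum>j=m..<n. (cmod (Rep_ell2 x j))\<^sup>2) \<le> (norm x)\<^sup>2" .
          show "(\<Sum>j=m..<n. (cmod (c j))\<^sup>2) \<le> t m"
            unfolding split[symmetric] t_def by (simp add: sum_le_suminf[OF summ])
        qed (simp_all add: sum_nonneg)
        also have "\<dots> = (sqrt (t m) * norm x)\<^sup>2"
          by (simp add: power_mult_distrib t_nonneg)
        finally show "(\<Sum>j=m..<n. cmod (Rep_ell2 x j) * cmod (c j))\<^sup>2 \<le> (sqrt (t m) * norm x)\<^sup>2" .
      qed (simp add: t_nonneg)
      finally show "cmod (\<phi> (truncation n x) - \<phi> (truncation m x)) \<le> sqrt (t m) * norm x" .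
    qed
  qed
  define R where "R m = (\<Sum>j<m. c j *\<^sub>C \<Theta> i j)" for m
  have R: "((\<Theta> i i o\<^sub>L T) - R m) x = (\<phi> x - \<phi> (truncation m x)) *\<^sub>C ell2_basis i" for m x
  proof -
    have "R m x = (\<Sum>j<m. c j *\<^sub>C Rep_ell2 x j *\<^sub>C ell2_basis i)"
      by (simp add: R_def blinfun.sum_left scaleC_blinfun.rep_eq matrix_unit_apply)
    also have "\<dots> = \<phi> (truncation m x) *\<^sub>C ell2_basis i"
      by (simp add: \<phi>_trunc scaleC_scaleC complex_vector.scale_sum_left mult.commute)
    finally show ?thesis
      by (simp add: blinfun.diff_left matrix_unit_apply complex_vector.scale_left_diff_distrib flip: \<phi>_def)
  qed
  have "R \<longlonglongrightarrow> (\<Theta> i i o\<^sub>L T)"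
  proof (rule Lim_transform2[OF tendsto_const], rule Lim_null_comparison)
    show "\<forall>\<^sub>F m in sequentially. norm ((\<Theta> i i o\<^sub>L T) - R m) \<le> sqrt (t m)"
      by (intro always_eventually allI norm_blinfun_bound)
        (simp_all add: R norm_scaleC tail t_nonneg)
    show "(\<lambda>m. sqrt (t m)) \<longlonglongrightarrow> 0"
      using tendsto_real_sqrt[OF t0] by simp
  qed
  moreover have "R m \<in> cspan (range (case_prod \<Theta>))" for m
    unfolding R_def
    by (intro complex_vector.span_sum complex_vector.span_scale complex_vector.span_base)
      (auto intro!: rangeI[of "case_prod \<Theta>" "(_, _)", simplified])
  ultimately show ?thesis
    unfolding closure_sequential by blast
qed

text \<open>Truncating on the left cuts \<open>T\<close> into finitely many rows
  \<open>\<Theta> i i o\<^sub>L T\<close>, each covered by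
  \<open>matrix_row_in_closure\<close>.\<close>

lemma compact_operators_subset_closure:
  "compact_operators \<subseteq> closure (cspan (range (case_prod (\<Theta> :: nat \<Rightarrow> nat \<Rightarrow> nat operator))))"
  (is "_ \<subseteq> ?S")
proof
  fix T :: "nat operator" assume T: "T \<in> compact_operators"
  have S: "csubspace ?S" by (rule csubspace_closure[OF complex_vector.subspace_span])
  have "truncation n o\<^sub>L T \<in> ?S" for n
  proof -
    have "truncation n o\<^sub>L T = (\<Sum>i<n. \<Theta> i i o\<^sub>L T)"
      by (rule blinfun_eqI) (simp add: truncation_def blinfun.sum_left)
    then show ?thesis
      by (simp add: csubspace_sum[OF S] matrix_row_in_closure compact_operatorD(1)[OF T])
  qed
  then show "T \<in> ?S"
    by (rule closed_sequentially[OF closed_closure _ truncation_compose_tendsto[OF T]])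
qed

section \<open>Systems of matrix entries\<close>

definition bounded_clinear :: "('x::complex_normed_vector \<Rightarrow> 'y::complex_normed_vector) \<Rightarrow> bool" where
  "bounded_clinear f \<longleftrightarrow> clinear f \<and> bounded_linear f"

lemma bounded_clinearI:
  assumes "\<And>x y. f (x + y) = f x + f y" "\<And>c x. f (c *\<^sub>C x) = c *\<^sub>C f x" "\<And>x. norm (f x) \<le> K * norm x"
  shows "bounded_clinear f"
  unfolding bounded_clinear_def clinear_def
proof (intro conjI allI)
  show "bounded_linear f"
    by (rule bounded_linear_intro[of _ K])
      (use assms(1,3) assms(2)[of "complex_of_real _"] in \<open>simp_all add: scaleC_of_real mult.commute[of K]\<close>)
qed (use assms in auto)

lemma bounded_clinearD:
  assumes "bounded_clinear f"
  shows "\<And>x y. f (x + y) = f x + f y" "\<And>c x. f (c *\<^sub>C x) = c *\<^sub>C f x" "\<And>x y. f (x - y) = f x - f y"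
    "f 0 = 0" "\<And>r x. f (r *\<^sub>R x) = r *\<^sub>R f x" "\<And>g I. f (sum g I) = (\<Sum>i\<in>I. f (g i))" "bounded_linear f"
    "\<And>g l F. (g \<longlongrightarrow> l) F \<Longrightarrow> ((\<lambda>x. f (g x)) \<longlongrightarrow> f l) F"
proof -
  note b = assms[unfolded bounded_clinear_def clinear_def]
  show "\<And>x y. f (x + y) = f x + f y" "\<And>c x. f (c *\<^sub>C x) = c *\<^sub>C f x" "bounded_linear f"
    using b by auto
  note l = bounded_linear.linear[OF conjunct2[OF b]]
  show "\<And>x y. f (x - y) = f x - f y" "f 0 = 0" "\<And>r x. f (r *\<^sub>R x) = r *\<^sub>R f x"
    "\<And>g I. f (sum g I) = (\<Sum>i\<in>I. f (g i))"
    using linear_diff[OF l] linear_0[OF l] linear_scale[OF l] linear_sum[OF l] by auto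
  show "\<And>g l F. (g \<longlongrightarrow> l) F \<Longrightarrow> ((\<lambda>x. f (g x)) \<longlongrightarrow> f l) F"
    using b bounded_linear.tendsto by blast
qed

lemma bounded_clinear_ident: "bounded_clinear (\<lambda>x. x)"
  by (rule bounded_clinearI[of _ 1]) simp_all

lemma bounded_clinear_zero: "bounded_clinear (\<lambda>x. 0)"
  by (rule bounded_clinearI[of _ 1]) simp_all

lemma bounded_clinear_mult:
  assumes "bounded_clinear f"
  shows "bounded_clinear (\<lambda>x. c * f x :: 'a::cstar_algebra)" "bounded_clinear (\<lambda>x. f x * c :: 'a)"
  using assms bounded_linear_compose[OF bounded_linear_mult_right[of c], of f]
    bounded_linear_compose[OF bounded_linear_mult_left[of c], of f]
  by (auto simp: bounded_clinear_def clinear_def distrib_left distrib_right mult_scaleC_left mult_scaleC_right)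

lemma bounded_clinear_compose: "bounded_clinear f \<Longrightarrow> bounded_clinear g \<Longrightarrow> bounded_clinear (\<lambda>x. f (g x))"
  using bounded_linear_compose[of f g] by (auto simp: bounded_clinear_def clinear_def)

lemma bounded_clinear_sum:
  assumes "\<And>i. i \<in> I \<Longrightarrow> bounded_clinear (f i)"
  shows "bounded_clinear (\<lambda>x. \<Sum>i\<in>I. f i x)"
  using assms bounded_linear_sum[of I f]
  by (auto simp: bounded_clinear_def clinear_def sum.distrib complex_vector.scale_sum_right)

lemma bounded_clinear_conj_adj:
  fixes f :: "'a::cstar_algebra \<Rightarrow> 'b::cstar_algebra"
  assumes "bounded_clinear f"
  shows "bounded_clinear (\<lambda>x. (f (x\<^sup>\<star>))\<^sup>\<star>)"
proof -
  have "bounded_linear (\<lambda>x. (f (x\<^sup>\<star>))\<^sup>\<star>)"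
    using assms unfolding bounded_clinear_def
    by (intro bounded_linear_compose[OF bounded_linear_adj] bounded_linear_compose[OF _ bounded_linear_adj]) auto
  then show ?thesis
    using assms by (auto simp: bounded_clinear_def clinear_def adj_add adj_scaleC)
qed

lemma closed_convergent:
  fixes T :: "nat \<Rightarrow> 'x::real_normed_vector \<Rightarrow> 'y::banach"
  assumes "\<And>n. bounded_linear (T n)" "\<And>n x. norm (T n x) \<le> norm x"
  shows "closed {x. convergent (\<lambda>n. T n x)}"
  unfolding closed_sequential_limits
proof (intro allI impI)
  fix f l assume fl: "(\<forall>n. f n \<in> {x. convergent (\<lambda>n. T n x)}) \<and> f \<longlonglongrightarrow> l"
  have "Cauchy (\<lambda>n. T n l)"
  proof (rule metric_CauchyI)
    fix e :: real assume e: "0 < e"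
    then obtain k where k: "dist (f k) l < e / 3"
      using fl tendstoD[of f l sequentially "e / 3"] by (auto simp: eventually_sequentially)
    have "Cauchy (\<lambda>n. T n (f k))" using fl by (simp add: Cauchy_convergent_iff)
    then obtain M where M: "\<And>m n. m \<ge> M \<Longrightarrow> n \<ge> M \<Longrightarrow> dist (T m (f k)) (T n (f k)) < e / 3"
      using metric_CauchyD[of _ "e / 3"] e by (metis zero_less_divide_iff zero_less_numeral)
    have le: "dist (T n l) (T n (f k)) \<le> dist (f k) l" for n
      using assms(2)[of n "l - f k"] linear_diff[OF bounded_linear.linear[OF assms(1)]]
      by (simp add: dist_norm norm_minus_commute)
    show "\<exists>M. \<forall>m\<ge>M. \<forall>n\<ge>M. dist (T m l) (T n l) < e"
    proof (intro exI allI impI)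
      fix m n assume "M \<le> m" "M \<le> n"
      then show "dist (T m l) (T n l) < e"
        using M[of m n] le[of m] le[of n] k dist_triangle[of "T m l" "T n l" "T m (f k)"]
          dist_triangle[of "T m (f k)" "T n l" "T n (f k)"] dist_commute[of "T n (f k)" "T n l"]
        by linarith
    qed
  qed
  then show "l \<in> {x. convergent (\<lambda>n. T n x)}" by (simp add: Cauchy_convergent_iff)
qed

text \<open>\<open>E i j x\<close> abstracts the elementary tensor of \<open>x\<close> and
  \<open>\<Theta> i j\<close>, so that the tensor product itself returns only in the last section.
  The approximate unit \<open>u\<close> is a parameter because the multipliers below are limits
  along it.\<close>

locale matrix_system =
  fixes E :: "nat \<Rightarrow> nat \<Rightarrow> 'a::cstar_algebra \<Rightarrow> 'b::cstar_algebra" and u :: "nat \<Rightarrow> 'a"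
  assumes E_add: "E i j (x + y) = E i j x + E i j y"
    and E_scaleC: "E i j (c *\<^sub>C x) = c *\<^sub>C E i j x"
    and E_mult: "E i j x * E k l y = (if j = k then E i l (x * y) else 0)"
    and E_adj: "(E i j x)\<^sup>\<star> = E j i (x\<^sup>\<star>)"
    and E_norm [simp]: "norm (E i j x) = norm x"
    and E_dense: "closure (cspan {E i j x | i j x. True}) = UNIV"
    and u_norm: "norm (u n) \<le> 1"
    and u_left: "(\<lambda>n. u n * x) \<longlonglongrightarrow> x"
    and u_right: "(\<lambda>n. x * u n) \<longlonglongrightarrow> x"
begin

lemma bounded_clinear_E: "bounded_clinear (E i j)"
  by (rule bounded_clinearI[of _ 1]) (simp_all add: E_add E_scaleC)

lemmas E_diff = bounded_clinearD(3)[OF bounded_clinear_E]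
  and E_0 [simp] = bounded_clinearD(4)[OF bounded_clinear_E]
  and E_scaleR = bounded_clinearD(5)[OF bounded_clinear_E]
  and tendsto_E = bounded_clinearD(8)[OF bounded_clinear_E]

lemma E_eq_iff [simp]: "E i j x = E i j y \<longleftrightarrow> x = y"
proof
  assume "E i j x = E i j y"
  then have "norm (E i j (x - y)) = 0" by (simp only: E_diff) simp
  then show "x = y" by simp
qed simp

lemma E_eq_0_iff [simp]: "E i j x = 0 \<longleftrightarrow> x = 0"
  using E_eq_iff[of i j x 0] by simp

lemma E_induct:
  assumes "csubspace S" "closed S" "\<And>i j x. E i j x \<in> S"
  shows "b \<in> S"
proof -
  have "{E i j x | i j x. True} \<subseteq> S" using assms(3) by blast
  then show ?thesis using closure_cspan_minimal[OF _ assms(1,2)] E_dense by blast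
qed

lemma E_ext:
  assumes "bounded_clinear f" "bounded_clinear g" "\<And>i j x. f (E i j x) = g (E i j x)"
  shows "f b = g b"
proof -
  note f = bounded_clinearD[OF assms(1)] and g = bounded_clinearD[OF assms(2)]
  have "b \<in> {b. f b = g b}"
  proof (rule E_induct)
    show "csubspace {b. f b = g b}" by (simp add: complex_vector.subspace_def f g)
    show "closed {b. f b = g b}"
      by (intro closed_Collect_eq linear_continuous_on f(7) g(7))
  qed (simp add: assms)
  then show ?thesis by simp
qed

text \<open>The points at which contractions converge form a closed subspace, so the elementary
  elements decide. The multipliers and the compression to the diagonal are obtained as limits in
  this way.\<close>

lemma contractions_converge:
  fixes T :: "nat \<Rightarrow> 'b \<Rightarrow> 'b"
  assumes "\<And>n. bounded_clinear (T n)" "\<And>n b. norm (T n b) \<le> norm b"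
    "\<And>i j x. convergent (\<lambda>n. T n (E i j x))"
  shows "convergent (\<lambda>n. T n b)" "bounded_clinear (\<lambda>b. lim (\<lambda>n. T n b))"
    "norm (lim (\<lambda>n. T n b)) \<le> norm b"
proof -
  note T = bounded_clinearD[OF assms(1)]
  have "b \<in> {b. convergent (\<lambda>n. T n b)}" for b
  proof (rule E_induct)
    show "closed {b. convergent (\<lambda>n. T n b)}" by (rule closed_convergent[OF T(7) assms(2)])
    show "csubspace {b. convergent (\<lambda>n. T n b)}"
      unfolding complex_vector.subspace_def mem_Collect_eq T
    proof (intro conjI allI ballI)
      fix c x assume "x \<in> {b. convergent (\<lambda>n. T n b)}"
      then obtain L where "(\<lambda>n. T n x) \<longlonglongrightarrow> L" by (auto simp: convergent_def)
      then have "(\<lambda>n. c *\<^sub>C T n x) \<longlonglongrightarrow> c *\<^sub>C L"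
        by (rule bounded_linear.tendsto[OF bounded_linear_scaleC_right])
      then show "convergent (\<lambda>n. c *\<^sub>C T n x)" by (auto simp: convergent_def)
    qed (simp_all add: convergent_const convergent_add)
  qed (simp add: assms)
  then have conv: "convergent (\<lambda>n. T n b)" for b by simp
  then show "convergent (\<lambda>n. T n b)" .
  have lim: "(\<lambda>n. T n b) \<longlonglongrightarrow> lim (\<lambda>n. T n b)" for b
    using conv by (simp add: convergent_LIMSEQ_iff)
  have le: "norm (lim (\<lambda>n. T n b)) \<le> norm b" for b
    by (rule LIMSEQ_le_const2[OF tendsto_norm[OF lim]]) (use assms(2) in blast)
  then show "norm (lim (\<lambda>n. T n b)) \<le> norm b" .
  show "bounded_clinear (\<lambda>b. lim (\<lambda>n. T n b))"
  proof (rule bounded_clinearI[of _ 1])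
    show "lim (\<lambda>n. T n (x + y)) = lim (\<lambda>n. T n x) + lim (\<lambda>n. T n y)" for x y
      by (rule limI) (simp only: T tendsto_add lim)
    show "lim (\<lambda>n. T n (c *\<^sub>C x)) = c *\<^sub>C lim (\<lambda>n. T n x)" for c x
      by (rule limI) (simp only: T bounded_linear.tendsto[OF bounded_linear_scaleC_right lim])
  qed (simp add: le)
qed

text \<open>\<open>row_part i\<close> and \<open>column_part i\<close> are left and right multiplication by the multiplier \<open>1 \<otimes> \<Theta> i i\<close>.\<close>

definition row_part :: "nat \<Rightarrow> 'b \<Rightarrow> 'b" where
  "row_part i b = lim (\<lambda>n. E i i (u n) * b)"

definition column_part :: "nat \<Rightarrow> 'b \<Rightarrow> 'b" where
  "column_part i b = (row_part i (b\<^sup>\<star>))\<^sup>\<star>"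

lemma row_tendsto: "(\<lambda>n. E i i (u n) * b) \<longlonglongrightarrow> row_part i b"
    and bounded_clinear_row: "bounded_clinear (row_part i)"
    and norm_row_le: "norm (row_part i b) \<le> norm b"
proof -
  have 1: "bounded_clinear (\<lambda>b. E i i (u n) * b)" for n
    by (intro bounded_clinear_mult bounded_clinear_ident)
  have 2: "norm (E i i (u n) * b) \<le> norm b" for n b
    by (rule norm_mult_contraction) (simp add: u_norm)
  have 3: "convergent (\<lambda>n. E i i (u n) * E k l x)" for k l x
  proof (cases "i = k")
    case True
    then show ?thesis
      using tendsto_E[OF u_left[of x], of k l] by (auto simp: E_mult convergent_def)
  qed (simp add: E_mult convergent_const)
  note c = contractions_converge[OF 1 2 3]
  show "(\<lambda>n. E i i (u n) * b) \<longlonglongrightarrow> row_part i b"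
    using c(1) by (simp add: convergent_LIMSEQ_iff row_part_def)
  show "bounded_clinear (row_part i)" using c(2) by (simp add: row_part_def[abs_def])
  show "norm (row_part i b) \<le> norm b" using c(3) by (simp add: row_part_def)
qed

lemma bounded_clinear_column: "bounded_clinear (column_part i)"
  unfolding column_part_def[abs_def] by (rule bounded_clinear_conj_adj[OF bounded_clinear_row])

lemma norm_column_le: "norm (column_part i b) \<le> norm b"
  using norm_row_le[of i "b\<^sup>\<star>"] by (simp add: column_part_def)

lemmas row_simps = bounded_clinearD(1-6)[OF bounded_clinear_row]
  and column_simps = bounded_clinearD(1-6)[OF bounded_clinear_column]

lemma row_E: "row_part i (E k l x) = (if i = k then E k l x else 0)"
proof (rule LIMSEQ_unique[OF row_tendsto])
  show "(\<lambda>n. E i i (u n) * E k l x) \<longlonglongrightarrow> (if i = k then E k l x else 0)"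
    using tendsto_E[OF u_left[of x], of k l] by (simp add: E_mult)
qed

lemma row_adj: "(row_part i b)\<^sup>\<star> = column_part i (b\<^sup>\<star>)"
  and column_adj: "(column_part i b)\<^sup>\<star> = row_part i (b\<^sup>\<star>)"
  by (simp_all add: column_part_def adj_adj)

lemma column_E: "column_part i (E k l x) = (if i = l then E k l x else 0)"
  by (simp add: column_part_def E_adj row_E adj_adj)

lemma row_mult: "row_part i (b * c) = row_part i b * c"
proof (rule LIMSEQ_unique[OF row_tendsto])
  show "(\<lambda>n. E i i (u n) * (b * c)) \<longlonglongrightarrow> row_part i b * c"
    unfolding mult.assoc[symmetric] by (intro tendsto_mult row_tendsto tendsto_const)
qed

lemma column_mult: "column_part i (b * c) = b * column_part i c"
  by (simp add: column_part_def adj_mult row_mult adj_adj)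

text \<open>The balance condition of a double centralizer, tested on elementary elements in both
  variables.\<close>

lemma column_times: "column_part i b * c = b * row_part i c"
proof (rule E_ext[of "\<lambda>b. column_part i b * c"])
  show "bounded_clinear (\<lambda>b. column_part i b * c)" "bounded_clinear (\<lambda>b. b * row_part i c)"
    by (intro bounded_clinear_mult bounded_clinear_column bounded_clinear_ident)+
  fix k l x
  show "column_part i (E k l x) * c = E k l x * row_part i c"
  proof (rule E_ext[of "\<lambda>c. column_part i (E k l x) * c"])
    show "bounded_clinear (\<lambda>c. column_part i (E k l x) * c)" "bounded_clinear (\<lambda>c. E k l x * row_part i c)"
      by (intro bounded_clinear_mult bounded_clinear_row bounded_clinear_ident)+
  qed (simp add: row_E column_E E_mult)
qed

lemma row_row: "row_part i (row_part j b) = (if i = j then row_part i b else 0)"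
proof (rule E_ext[of "\<lambda>b. row_part i (row_part j b)"])
  show "bounded_clinear (\<lambda>b. row_part i (row_part j b))" "bounded_clinear (\<lambda>b. if i = j then row_part i b else 0)"
    by (cases "i = j"; simp add: bounded_clinear_compose[OF bounded_clinear_row bounded_clinear_row]
        bounded_clinear_row bounded_clinear_zero)+
qed (simp add: row_E row_simps)

lemma row_column: "row_part i (column_part j b) = column_part j (row_part i b)"
proof (rule E_ext[of "\<lambda>b. row_part i (column_part j b)"])
  show "bounded_clinear (\<lambda>b. row_part i (column_part j b))" "bounded_clinear (\<lambda>b. column_part j (row_part i b))"
    by (intro bounded_clinear_compose[OF bounded_clinear_row bounded_clinear_column]
        bounded_clinear_compose[OF bounded_clinear_column bounded_clinear_row])+
qed (simp add: row_E column_E row_simps column_simps)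

section \<open>Matrix entries\<close>

lemma closed_range_E: "closed (range (E i j))"
proof -
  have "complete (range (E i j))"
    by (rule complete_isometric_image[of 1])
      (simp_all add: bounded_clinearD(7)[OF bounded_clinear_E] complete_UNIV)
  then show ?thesis by (rule complete_imp_closed)
qed

definition entry :: "nat \<Rightarrow> nat \<Rightarrow> 'b \<Rightarrow> 'a" where
  "entry i j b = inv (E i j) (row_part i (column_part j b))"

text \<open>This justifies the \<open>inv\<close> in \<open>entry\<close>. The range of the isometry
  \<open>E i j\<close> is a closed subspace, so it is enough that elementary elements are sent into
  it.\<close>

lemma E_entry: "E i j (entry i j b) = row_part i (column_part j b)"
proof -
  have "b \<in> {b. row_part i (column_part j b) \<in> range (E i j)}"
  proof (rule E_induct)
    have "csubspace (range (E i j))"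
      by (auto simp: complex_vector.subspace_def simp flip: E_add E_scaleC intro: range_eqI[of 0 _ 0])
    then show "csubspace {b. row_part i (column_part j b) \<in> range (E i j)}"
      unfolding complex_vector.subspace_def mem_Collect_eq row_simps column_simps by blast
    have "closed ((\<lambda>b. row_part i (column_part j b)) -` range (E i j))"
      by (intro closed_vimage closed_range_E linear_continuous_on
          bounded_clinearD(7)[OF bounded_clinear_compose[OF bounded_clinear_row bounded_clinear_column]])
    then show "closed {b. row_part i (column_part j b) \<in> range (E i j)}" by (simp add: vimage_def)
    show "E k l x \<in> {b. row_part i (column_part j b) \<in> range (E i j)}" for k l x
      by (auto simp: row_E column_E row_simps intro: range_eqI[of 0 _ 0])
  qed
  then show ?thesis unfolding entry_def by (simp add: f_inv_into_f)
qed

lemma bounded_clinear_entry: "bounded_clinear (entry i j)"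
  and norm_entry_le: "norm (entry i j b) \<le> norm b"
proof -
  have le: "norm (entry i j b) \<le> norm b" for b
  proof -
    have "norm (entry i j b) = norm (row_part i (column_part j b))"
      by (simp add: E_norm[of i j, symmetric] E_entry del: E_norm)
    then show ?thesis using norm_row_le norm_column_le order_trans by metis
  qed
  show "norm (entry i j b) \<le> norm b" by (rule le)
  show "bounded_clinear (entry i j)"
  proof (rule bounded_clinearI[of _ 1])
    show "entry i j (x + y) = entry i j x + entry i j y" for x y
      by (rule E_eq_iff[of i j, THEN iffD1]) (simp only: E_add E_entry row_simps column_simps)
    show "entry i j (c *\<^sub>C x) = c *\<^sub>C entry i j x" for c x
      by (rule E_eq_iff[of i j, THEN iffD1]) (simp only: E_scaleC E_entry row_simps column_simps)
  qed (simp add: le)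
qed

lemmas entry_simps = bounded_clinearD(1-6)[OF bounded_clinear_entry]
  and tendsto_entry = bounded_clinearD(8)[OF bounded_clinear_entry]

lemma entry_E: "entry i j (E k l x) = (if i = k \<and> j = l then x else 0)"
proof -
  have "E i j (entry i j (E k l x)) = E i j (if i = k \<and> j = l then x else 0)"
    unfolding E_entry by (auto simp: row_E column_E row_simps)
  then show ?thesis by (simp only: E_eq_iff)
qed

lemma entry_adj: "entry i j (b\<^sup>\<star>) = (entry j i b)\<^sup>\<star>"
proof -
  have "E i j (entry i j (b\<^sup>\<star>)) = E i j ((entry j i b)\<^sup>\<star>)"
    unfolding E_entry E_adj[symmetric] row_adj column_adj by (simp only: row_column column_adj)
  then show ?thesis by simp
qed

lemma entry_mult_E: "entry i j (b * E k l x) = (if j = l then entry i k b * x else 0)"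
proof (rule E_ext[of "\<lambda>b. entry i j (b * E k l x)"])
  show "bounded_clinear (\<lambda>b. entry i j (b * E k l x))"
    by (intro bounded_clinear_compose[OF bounded_clinear_entry] bounded_clinear_mult bounded_clinear_ident)
  show "bounded_clinear (\<lambda>b. if j = l then entry i k b * x else 0)"
    by (cases "j = l") (simp_all add: bounded_clinear_zero bounded_clinear_mult bounded_clinear_entry)
qed (auto simp: E_mult entry_E entry_simps)

lemma entry_E_mult: "entry i j (E k l x * b) = (if i = k then x * entry l j b else 0)"
proof (rule E_ext[of "\<lambda>b. entry i j (E k l x * b)"])
  show "bounded_clinear (\<lambda>b. entry i j (E k l x * b))"
    by (intro bounded_clinear_compose[OF bounded_clinear_entry] bounded_clinear_mult bounded_clinear_ident)
  show "bounded_clinear (\<lambda>b. if i = k then x * entry l j b else 0)"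
    by (cases "i = k") (simp_all add: bounded_clinear_zero bounded_clinear_mult bounded_clinear_entry)
qed (auto simp: E_mult entry_E entry_simps)

text \<open>The partial sums \<open>P n\<close> act as multiplication by a projection: in the
  product of the adjoint of \<open>P n b\<close> with \<open>P n b\<close>, the first factor may be
  replaced by \<open>b\<^sup>\<star>\<close>. The C*-identity then makes \<open>P n\<close>
  contractive. On an elementary element \<open>P n\<close> is eventually the identity.\<close>

lemma sum_row_tendsto: "(\<lambda>n. \<Sum>i<n. row_part i b) \<longlonglongrightarrow> b"
  and norm_sum_row_le: "norm (\<Sum>i<n. row_part i b) \<le> norm b"
proof -
  define P where "P n b = (\<Sum>i<n. row_part i b)" for n b
  have lin: "bounded_clinear (P n)" for n
    unfolding P_def[abs_def] by (intro bounded_clinear_sum bounded_clinear_row)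
  have le: "norm (P n b) \<le> norm b" for n b
  proof -
    have rP: "row_part i (P n b) = row_part i b" if "i < n" for i
      using that by (simp add: P_def row_simps row_row)
    have "(P n b)\<^sup>\<star> = (\<Sum>i<n. column_part i (b\<^sup>\<star>))"
      by (simp only: P_def adj_sum row_adj)
    then have "(P n b)\<^sup>\<star> * P n b = (\<Sum>i<n. b\<^sup>\<star> * row_part i (P n b))"
      by (simp only: sum_distrib_right column_times)
    also have "\<dots> = b\<^sup>\<star> * P n b"
      unfolding P_def[of n b] sum_distrib_left by (simp add: rP[unfolded P_def])
    finally have "norm (P n b) * norm (P n b) \<le> norm b * norm (P n b)"
      using cstar_identity[of "P n b"] norm_mult_ineq[of "b\<^sup>\<star>" "P n b"] by (simp add: power2_eq_square)
    then show ?thesis by (cases "P n b = 0") auto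
  qed
  have E: "(\<lambda>n. P n (E i j x)) \<longlonglongrightarrow> E i j x" for i j x
  proof (rule tendsto_eventually)
    show "\<forall>\<^sub>F n in sequentially. P n (E i j x) = E i j x"
      using eventually_gt_at_top[of i] by eventually_elim (simp add: P_def row_E)
  qed
  then have conv: "convergent (\<lambda>n. P n (E i j x))" for i j x by (auto simp: convergent_def)
  note c = contractions_converge[OF lin le conv]
  have "lim (\<lambda>n. P n b) = b"
    by (rule E_ext[OF c(2) bounded_clinear_ident]) (simp add: limI E)
  then show "(\<lambda>n. \<Sum>i<n. row_part i b) \<longlonglongrightarrow> b"
    using c(1)[of b] by (simp add: convergent_LIMSEQ_iff P_def)
  show "norm (\<Sum>i<n. row_part i b) \<le> norm b" using le[of n b] by (simp add: P_def)
qed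

lemma sum_column_tendsto: "(\<lambda>n. \<Sum>i<n. column_part i b) \<longlonglongrightarrow> b"
  using tendsto_adj[OF sum_row_tendsto[of "b\<^sup>\<star>"]] by (simp add: adj_sum row_adj adj_adj)

lemma sum_entries_tendsto: "(\<lambda>n. \<Sum>i<n. \<Sum>j<n. E i j (entry i j b)) \<longlonglongrightarrow> b"
proof -
  have eq: "(\<Sum>i<n. \<Sum>j<n. E i j (entry i j b)) = (\<Sum>i<n. row_part i (\<Sum>j<n. column_part j b))" for n
    by (simp add: E_entry row_simps)
  \<comment> \<open>Two-sided sections are treated one side at a time: the error left by the columns
    passes through the contractive row sums.\<close>
  have "(\<lambda>n. (\<Sum>i<n. row_part i ((\<Sum>j<n. column_part j b) - b)) + (\<Sum>i<n. row_part i b)) \<longlonglongrightarrow> 0 + b"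
  proof (intro tendsto_add sum_row_tendsto)
    show "(\<lambda>n. \<Sum>i<n. row_part i ((\<Sum>j<n. column_part j b) - b)) \<longlonglongrightarrow> 0"
    proof (rule Lim_null_comparison)
      show "\<forall>\<^sub>F n in sequentially. norm (\<Sum>i<n. row_part i ((\<Sum>j<n. column_part j b) - b)) \<le> norm ((\<Sum>j<n. column_part j b) - b)"
        by (intro always_eventually allI norm_sum_row_le)
      show "(\<lambda>n. norm ((\<Sum>j<n. column_part j b) - b)) \<longlonglongrightarrow> 0"
        by (intro tendsto_norm_zero LIM_zero sum_column_tendsto)
    qed
  qed
  then show ?thesis
    unfolding eq by (simp only: row_simps sum_subtractf diff_add_cancel add_0)
qed

lemma entry_eqI:
  assumes "\<And>i j. entry i j b = entry i j c"
  shows "b = c"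
  using sum_entries_tendsto[of b] sum_entries_tendsto[of c] LIMSEQ_unique
  by (simp only: assms) blast

lemma entry_adj_mult_self: "E i i (entry i i (b\<^sup>\<star> * b)) = (column_part i b)\<^sup>\<star> * column_part i b"
  by (simp add: E_entry column_mult row_mult column_adj)

subsection \<open>Diagonal elements\<close>

lemma sum_diagonal_mult:
  "(\<Sum>i<n. E i i (d i)) * (\<Sum>i<n. E i i (e i)) = (\<Sum>i<n. E i i (d i * e i))"
  by (simp add: sum_product E_mult)

text \<open>The norm of a block-diagonal element, bounded without a representation. For self-adjoint
  entries, iterating the C*-identity expresses the 2^k-th power of the norm as the norm of a sum of
  \<open>n\<close> entries, crudely at most n K^(2^k). The factor n disappears as k grows.\<close>

lemma norm_sum_diagonal_le:
  assumes "\<And>i. i < n \<Longrightarrow> norm (d i) \<le> K" and K: "0 \<le> K"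
  shows "norm (\<Sum>i<n. E i i (d i)) \<le> K"
proof -
  have pow: "norm (\<Sum>i<n. E i i (d i)) ^ (2 ^ k) \<le> real n * K ^ (2 ^ k)"
    if "\<And>i. (d i)\<^sup>\<star> = d i" "\<And>i. i < n \<Longrightarrow> norm (d i) \<le> K" for d :: "nat \<Rightarrow> 'a" and K and k :: nat
    using that
  proof (induction k arbitrary: d K)
    case 0
    have "norm (\<Sum>i<n. E i i (d i)) \<le> (\<Sum>i<n. K)"
      by (rule sum_norm_le) (simp add: 0)
    then show ?case by simp
  next
    case (Suc k)
    have sa: "(\<Sum>i<n. E i i (d i))\<^sup>\<star> = (\<Sum>i<n. E i i (d i))"
      by (simp add: adj_sum E_adj Suc.prems)
    have "norm (\<Sum>i<n. E i i (d i)) ^ (2 ^ Suc k) = norm (\<Sum>i<n. E i i (d i * d i)) ^ (2 ^ k)"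
      unfolding sum_diagonal_mult[symmetric] norm_selfadjoint_square[OF sa]
      by (simp add: power_mult)
    also have "\<dots> \<le> real n * (K\<^sup>2) ^ (2 ^ k)"
    proof (rule Suc.IH)
      show "norm (d i * d i) \<le> K\<^sup>2" if "i < n" for i
        using norm_selfadjoint_square[OF Suc.prems(1)] power_mono[OF Suc.prems(2)[OF that], of 2] by simp
    qed (simp add: adj_mult Suc.prems)
    finally show ?case by (simp add: power_mult)
  qed
  \<comment> \<open>The general case reduces to the self-adjoint entries
    \<open>(d i)\<^sup>\<star> * d i\<close>, with \<open>K\<close> replaced by its square.\<close>
  define y where "y = norm (\<Sum>i<n. E i i ((d i)\<^sup>\<star> * d i))"
  have y: "y = (norm (\<Sum>i<n. E i i (d i)))\<^sup>2"
    unfolding y_def sum_diagonal_mult[symmetric] cstar_identity[symmetric] by (simp add: adj_sum E_adj)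
  have y_pow: "y ^ (2 ^ k) \<le> real n * (K\<^sup>2) ^ (2 ^ k)" for k
    unfolding y_def
  proof (rule pow)
    show "norm ((d i)\<^sup>\<star> * d i) \<le> K\<^sup>2" if "i < n" for i
      using power_mono[OF assms(1)[OF that], of 2] by (simp add: cstar_identity)
  qed (simp add: adj_mult adj_adj)
  have "y \<le> K\<^sup>2"
  proof (rule ccontr)
    assume less: "\<not> y \<le> K\<^sup>2"
    show False
    proof (cases "K = 0")
      case True
      then show ?thesis using y_pow[of 0] less by simp
    next
      case False
      then have K2: "0 < K\<^sup>2" using K by simp
      \<comment> \<open>If \<open>q\<close> exceeded 1, its powers would be unbounded, but along the
        exponents 2^m they stay below \<open>n\<close>.\<close>
      define q where "q = y / K\<^sup>2"
      have "1 < q" using less K2 by (simp add: q_def)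
      obtain m where m: "real n < q ^ m" using real_arch_pow[OF \<open>1 < q\<close>] by blast
      have "q ^ m \<le> q ^ (2 ^ m)"
        using \<open>1 < q\<close> by (intro power_increasing) (auto simp: less_imp_le)
      also have "\<dots> \<le> real n"
        using y_pow[of m] K2 by (simp add: q_def power_divide divide_simps mult.commute)
      finally show False using m by simp
    qed
  qed
  then show ?thesis
    unfolding y by (rule power2_le_imp_le[OF _ K])
qed

text \<open>A tail is bounded by the supremum of its entries and not by the sum of their norms, so
  convergence of the entries to 0 is enough.\<close>

lemma summable_diagonal:
  assumes "d \<longlonglongrightarrow> 0"
  shows "summable (\<lambda>i. E i i (d i))"
  unfolding summable_Cauchy
proof (intro allI impI)
  fix e :: real assume e: "0 < e"
  obtain N where N: "\<And>i. i \<ge> N \<Longrightarrow> norm (d i) < e / 2"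
    using LIMSEQ_D[OF assms, of "e / 2"] e by auto
  show "\<exists>N. \<forall>m\<ge>N. \<forall>n. norm (\<Sum>i=m..<n. E i i (d i)) < e"
  proof (intro exI allI impI)
    fix m n assume m: "N \<le> m"
    have "(\<Sum>i=m..<n. E i i (d i)) = (\<Sum>i<n. E i i (if m \<le> i then d i else 0))"
      by (rule sum.mono_neutral_cong_left) auto
    moreover have "norm (\<Sum>i<n. E i i (if m \<le> i then d i else 0)) \<le> e / 2"
      by (rule norm_sum_diagonal_le) (use N m e in \<open>auto simp: less_imp_le\<close>)
    ultimately show "norm (\<Sum>i=m..<n. E i i (d i)) < e" using e by auto
  qed
qed

lemma entry_sums_diagonal:
  assumes "(\<lambda>i. E i i (d i)) sums x"
  shows "entry i j x = (if i = j then d i else 0)"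
proof (rule LIMSEQ_unique)
  show "(\<lambda>n. entry i j (\<Sum>k<n. E k k (d k))) \<longlonglongrightarrow> entry i j x"
    using assms unfolding sums_def by (rule tendsto_entry)
  show "(\<lambda>n. entry i j (\<Sum>k<n. E k k (d k))) \<longlonglongrightarrow> (if i = j then d i else 0)"
  proof (rule tendsto_eventually)
    show "\<forall>\<^sub>F n in sequentially. entry i j (\<Sum>k<n. E k k (d k)) = (if i = j then d i else 0)"
      using eventually_gt_at_top[of i]
    proof eventually_elim
      case (elim n)
      have "entry i j (\<Sum>k<n. E k k (d k)) = (\<Sum>k<n. if k = i then (if i = j then d i else 0) else 0)"
        unfolding entry_simps by (intro sum.cong) (auto simp: entry_E)
      then show ?case using elim by simp
    qed
  qed
qed

lemma norm_sum_diagonal_entries_le: "norm (\<Sum>i<n. E i i (entry i i b)) \<le> norm b"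
  by (rule norm_sum_diagonal_le) (simp_all add: norm_entry_le)

definition diagonal_part :: "'b \<Rightarrow> 'b" where
  "diagonal_part b = lim (\<lambda>n. \<Sum>i<n. E i i (entry i i b))"

lemma diagonal_part_sums: "(\<lambda>i. E i i (entry i i b)) sums diagonal_part b"
  and bounded_clinear_diagonal_part: "bounded_clinear diagonal_part"
  and norm_diagonal_part_le: "norm (diagonal_part b) \<le> norm b"
proof -
  have 1: "bounded_clinear (\<lambda>b. \<Sum>i<n. E i i (entry i i b))" for n
    by (intro bounded_clinear_sum bounded_clinear_compose[OF bounded_clinear_E] bounded_clinear_entry)
  have 2: "convergent (\<lambda>n. \<Sum>k<n. E k k (entry k k (E i j x)))" for i j x
    unfolding convergent_def
  proof (intro exI tendsto_eventually)
    show "\<forall>\<^sub>F n in sequentially. (\<Sum>k<n. E k k (entry k k (E i j x))) = (if i = j then E i i x else 0)"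
      using eventually_gt_at_top[of i]
    proof eventually_elim
      case (elim n)
      have "(\<Sum>k<n. E k k (entry k k (E i j x))) = (\<Sum>k<n. if k = i then (if i = j then E i i x else 0) else 0)"
        by (intro sum.cong) (auto simp: entry_E)
      then show ?case using elim by simp
    qed
  qed
  note c = contractions_converge[OF 1 norm_sum_diagonal_entries_le 2]
  show "(\<lambda>i. E i i (entry i i b)) sums diagonal_part b"
    using c(1)[of b] by (simp add: sums_def convergent_LIMSEQ_iff diagonal_part_def)
  show "bounded_clinear diagonal_part" using c(2) by (simp add: diagonal_part_def[abs_def])
  show "norm (diagonal_part b) \<le> norm b" using c(3)[of b] by (simp add: diagonal_part_def)
qed

lemmas diagonal_part_simps = bounded_clinearD(1-6)[OF bounded_clinear_diagonal_part]

lemma entry_diagonal_part: "entry i j (diagonal_part b) = (if i = j then entry i i b else 0)"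
  by (rule entry_sums_diagonal[OF diagonal_part_sums])

end

section \<open>Hereditary subalgebras and separability\<close>

text \<open>Two different ends are allowed because the entries of \<open>C\<close> off the diagonal
  live in \<open>corner (a i) (a j)\<close>.\<close>

definition corner :: "'a::cstar_algebra \<Rightarrow> 'a \<Rightarrow> 'a set" where
  "corner p q = closure (range (\<lambda>x. p * x * q))"

lemma hereditary_subalgebra_eq_corner: "hereditary_subalgebra p = corner p p"
  by (simp add: hereditary_subalgebra_def corner_def)

lemma closed_corner: "closed (corner p q)"
  by (simp add: corner_def)

lemma corner_base: "p * x * q \<in> corner p q"
  unfolding corner_def by (rule subsetD[OF closure_subset]) (rule rangeI)

lemma corner_minimal: "closed S \<Longrightarrow> (\<And>x. p * x * q \<in> S) \<Longrightarrow> corner p q \<subseteq> S"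
  unfolding corner_def by (intro closure_minimal) auto

lemma csubspace_corner: "csubspace (corner p q)"
  unfolding corner_def
proof (rule csubspace_closure)
  show "csubspace (range (\<lambda>x. p * x * q))"
    unfolding complex_vector.subspace_def
  proof (intro conjI ballI allI)
    show "0 \<in> range (\<lambda>x. p * x * q)" by (rule range_eqI[of _ _ 0]) simp
    fix x c assume "x \<in> range (\<lambda>x. p * x * q)"
    then obtain x' where x: "x = p * x' * q" by blast
    show "c *\<^sub>C x \<in> range (\<lambda>x. p * x * q)"
      by (rule range_eqI[of _ _ "c *\<^sub>C x'"]) (simp add: x mult_scaleC_left mult_scaleC_right)
    fix y assume "y \<in> range (\<lambda>x. p * x * q)"
    then obtain y' where y: "y = p * y' * q" by blast
    show "x + y \<in> range (\<lambda>x. p * x * q)"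
      by (rule range_eqI[of _ _ "x' + y'"]) (simp add: x y algebra_simps)
  qed
qed

lemma corner_mult:
  assumes "x \<in> corner p q" "z \<in> corner r s"
  shows "x * y * z \<in> corner p s" "x * z \<in> corner p s"
proof -
  obtain f where f: "(\<lambda>n::nat. p * f n * q) \<longlonglongrightarrow> x" by (rule closure_range_sequence[OF assms(1)[unfolded corner_def]])
  obtain g where g: "(\<lambda>n::nat. r * g n * s) \<longlonglongrightarrow> z" by (rule closure_range_sequence[OF assms(2)[unfolded corner_def]])
  show "x * y * z \<in> corner p s"
  proof (rule closed_sequentially[OF closed_corner])
    show "(\<lambda>n. (p * f n * q) * y * (r * g n * s)) \<longlonglongrightarrow> x * y * z" by (intro tendsto_intros f g)
    show "(p * f n * q) * y * (r * g n * s) \<in> corner p s" for n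
      using corner_base[of p "f n * q * y * r * g n" s] by (simp only: mult.assoc)
  qed
  show "x * z \<in> corner p s"
  proof (rule closed_sequentially[OF closed_corner])
    show "(\<lambda>n. (p * f n * q) * (r * g n * s)) \<longlonglongrightarrow> x * z" by (intro tendsto_intros f g)
    show "(p * f n * q) * (r * g n * s) \<in> corner p s" for n
      using corner_base[of p "f n * q * r * g n" s] by (simp only: mult.assoc)
  qed
qed

lemma corner_adj:
  assumes "x \<in> corner p q" "p\<^sup>\<star> = p" "q\<^sup>\<star> = q"
  shows "x\<^sup>\<star> \<in> corner q p"
proof -
  obtain f where f: "(\<lambda>n::nat. p * f n * q) \<longlonglongrightarrow> x" by (rule closure_range_sequence[OF assms(1)[unfolded corner_def]])
  show ?thesis
  proof (rule closed_sequentially[OF closed_corner])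
    show "(\<lambda>n. (p * f n * q)\<^sup>\<star>) \<longlonglongrightarrow> x\<^sup>\<star>" by (intro tendsto_adj f)
    show "(p * f n * q)\<^sup>\<star> \<in> corner q p" for n
      using corner_base[of q "(f n)\<^sup>\<star>" p] by (simp add: adj_mult assms mult.assoc)
  qed
qed

lemma cstar_subalgebra_hereditary:
  assumes "p\<^sup>\<star> = p" shows "cstar_subalgebra (hereditary_subalgebra p)"
  unfolding cstar_subalgebra_def hereditary_subalgebra_eq_corner
  using csubspace_corner closed_corner corner_mult(2) corner_adj[OF _ assms assms] by blast

lemma cstar_subalgebra_UNIV: "cstar_subalgebra UNIV"
  by (simp add: cstar_subalgebra_def complex_vector.subspace_UNIV)

lemma contraction_mult_tendsto:
  fixes p q :: "'a::cstar_algebra"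
  assumes "\<And>n. norm (e n) \<le> 1"
  shows "(\<lambda>n. e n * p) \<longlonglongrightarrow> p \<Longrightarrow> x \<in> corner p q \<Longrightarrow> (\<lambda>n. e n * x) \<longlonglongrightarrow> x"
    and "(\<lambda>n. q * e n) \<longlonglongrightarrow> q \<Longrightarrow> x \<in> corner p q \<Longrightarrow> (\<lambda>n. x * e n) \<longlonglongrightarrow> x"
proof -
  note le = norm_mult_contraction[OF assms]
  { assume p: "(\<lambda>n. e n * p) \<longlonglongrightarrow> p" and x: "x \<in> corner p q"
    have "corner p q \<subseteq> {x. (\<lambda>n. e n * x) \<longlonglongrightarrow> x}"
    proof (rule corner_minimal)
      show "closed {x. (\<lambda>n. e n * x) \<longlonglongrightarrow> x}"
        by (rule closed_tendsto_ident[OF bounded_linear_mult_right le(1)])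
      show "p * x * q \<in> {x. (\<lambda>n. e n * x) \<longlonglongrightarrow> x}" for x
        using tendsto_mult[OF tendsto_mult[OF p tendsto_const[of x]] tendsto_const[of q]]
        by (simp add: mult.assoc)
    qed
    with x show "(\<lambda>n. e n * x) \<longlonglongrightarrow> x" by blast }
  { assume q: "(\<lambda>n. q * e n) \<longlonglongrightarrow> q" and x: "x \<in> corner p q"
    have "corner p q \<subseteq> {x. (\<lambda>n. x * e n) \<longlonglongrightarrow> x}"
    proof (rule corner_minimal)
      show "closed {x. (\<lambda>n. x * e n) \<longlonglongrightarrow> x}"
        by (rule closed_tendsto_ident[OF bounded_linear_mult_left le(2)])
      show "p * x * q \<in> {x. (\<lambda>n. x * e n) \<longlonglongrightarrow> x}" for x
        using tendsto_mult[OF tendsto_const[of "p * x"] q] by (simp add: mult.assoc)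
    qed
    with x show "(\<lambda>n. x * e n) \<longlonglongrightarrow> x" by blast }
qed

text \<open>A dense set of the whole space may miss \<open>X\<close>. From every ball of radius 1/(n
  + 1) around one of its points that meets \<open>X\<close>, a point of \<open>X\<close> is chosen
  instead.\<close>

lemma separable_space_subset:
  fixes X Q :: "'x::metric_space set"
  assumes "countable Q" "closure Q = UNIV"
  shows "separable_space (top_of_set X)"
proof -
  define pick where "pick q n = (SOME x. x \<in> X \<and> dist q x < 1 / real (Suc n))" for q n
  define S where "S = {pick q n | q n. q \<in> Q \<and> (\<exists>x\<in>X. dist q x < 1 / real (Suc n))}"
  have pick: "pick q n \<in> X \<and> dist q (pick q n) < 1 / real (Suc n)"
    if "\<exists>x\<in>X. dist q x < 1 / real (Suc n)" for q n
    unfolding pick_def by (rule someI_ex) (use that in blast)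
  have "S \<subseteq> (\<lambda>(q, n). pick q n) ` (Q \<times> UNIV)" by (auto simp: S_def)
  then have "countable S"
    by (rule countable_subset) (auto intro!: countable_image countable_SIGMA assms(1))
  moreover have "S \<subseteq> X" using pick by (auto simp: S_def)
  moreover have "X \<subseteq> closure S"
  proof
    fix x assume x: "x \<in> X"
    show "x \<in> closure S"
      unfolding closure_approachable
    proof (intro allI impI)
      fix e :: real assume "0 < e"
      then obtain n where n: "1 / real (Suc n) < e / 2" using nat_approx_posE[of "e / 2"] by auto
      have "x \<in> closure Q" using assms(2) by simp
      then obtain q where q: "q \<in> Q" "dist q x < 1 / real (Suc n)"
        unfolding closure_approachable by (meson of_nat_0_less_iff zero_less_Suc zero_less_divide_1_iff)
      then have ex: "\<exists>x\<in>X. dist q x < 1 / real (Suc n)" using x by blast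
      have "dist (pick q n) x < e"
        using pick[OF ex] q(2) n dist_triangle[of "pick q n" x q] dist_commute[of q "pick q n"] by linarith
      then show "\<exists>y\<in>S. dist y x < e" using q(1) ex unfolding S_def by blast
    qed
  qed
  ultimately show ?thesis
    unfolding separable_space_def by (intro exI[of _ S]) (auto simp: closure_of_subtopology Int_absorb1)
qed

lemma (in matrix_system) separable_space_subset_UNIV:
  assumes "separable_space (euclidean :: 'a topology)"
  shows "separable_space (top_of_set (X :: 'b set))"
proof -
  obtain q :: "nat \<Rightarrow> 'a" where q: "closure (range q) = UNIV"
    using separable_dense_sequence[OF assms] .
  \<comment> \<open>Finite sums of these elements are dense without scalar coefficients, because the
    scalar multiples of any \<open>x\<close> are themselves limits of terms of
    \<open>q\<close>.\<close>
  define W where "W = range (\<lambda>(i, j, k). E i j (q k))"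
  define Q where "Q = sum_list ` lists W"
  have "countable Q" unfolding Q_def W_def by (intro countable_image countable_lists) simp
  moreover have "closure Q = UNIV"
  proof -
    have add: "x + y \<in> closure Q" if xy: "x \<in> closure Q" "y \<in> closure Q" for x y
    proof -
      obtain f g where fg: "\<forall>n. f n \<in> Q" "f \<longlonglongrightarrow> x" "\<forall>n. g n \<in> Q" "g \<longlonglongrightarrow> y"
        using xy unfolding closure_sequential by blast
      have "s + t \<in> Q" if st: "s \<in> Q" "t \<in> Q" for s t
      proof -
        obtain k l where "k \<in> lists W" "s = sum_list k" "l \<in> lists W" "t = sum_list l"
          using st unfolding Q_def by blast
        then show ?thesis unfolding Q_def by (intro image_eqI[of _ _ "k @ l"]) auto
      qed
      then show ?thesis
        unfolding closure_sequential using fg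
        by (intro exI[of _ "\<lambda>n. f n + g n"] conjI allI tendsto_add) blast+
    qed
    have zero: "0 \<in> closure Q"
      by (rule subsetD[OF closure_subset]) (auto simp: Q_def intro: image_eqI[of _ _ "[]"])
    have E: "E i j x \<in> closure Q" for i j x
    proof -
      have "x \<in> closure (range q)" by (simp add: q)
      then obtain f where f: "\<forall>n. f n \<in> range q" "f \<longlonglongrightarrow> x" unfolding closure_sequential by blast
      have "E i j (f n) \<in> Q" for n
      proof -
        have "E i j (f n) \<in> W" using f(1)[rule_format, of n] by (auto simp: W_def intro!: image_eqI[of _ _ "(i, j, _)"])
        then show ?thesis unfolding Q_def by (intro image_eqI[of _ _ "[E i j (f n)]"]) auto
      qed
      moreover have "(\<lambda>n. E i j (f n)) \<longlonglongrightarrow> E i j x" by (rule tendsto_E[OF f(2)])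
      ultimately show ?thesis unfolding closure_sequential by (intro exI[of _ "\<lambda>n. E i j (f n)"]) blast
    qed
    have sums: "sum g I \<in> closure Q" if "\<And>i. i \<in> I \<Longrightarrow> g i \<in> closure Q" for g :: "nat \<Rightarrow> 'b" and I
      using that by (induction I rule: infinite_finite_induct) (simp_all add: zero add)
    have "b \<in> closure Q" for b
      by (rule closed_sequentially[OF closed_closure _ sum_entries_tendsto]) (intro sums E)
    then show ?thesis by blast
  qed
  ultimately show ?thesis by (rule separable_space_subset)
qed

section \<open>The diagonal pair\<close>

lemma (in matrix_system) entry_diagonal_mult:
  assumes "(\<lambda>i. E i i (d i)) sums x"
  shows "entry i j (x * b) = d i * entry i j b"
proof (rule LIMSEQ_unique)
  show "(\<lambda>n. entry i j ((\<Sum>k<n. E k k (d k)) * b)) \<longlonglongrightarrow> entry i j (x * b)"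
    using assms unfolding sums_def by (intro tendsto_entry tendsto_mult tendsto_const)
  show "(\<lambda>n. entry i j ((\<Sum>k<n. E k k (d k)) * b)) \<longlonglongrightarrow> d i * entry i j b"
  proof (rule tendsto_eventually)
    show "\<forall>\<^sub>F n in sequentially. entry i j ((\<Sum>k<n. E k k (d k)) * b) = d i * entry i j b"
      using eventually_gt_at_top[of i]
      by eventually_elim (simp add: sum_distrib_right entry_simps entry_E_mult)
  qed
qed

lemma (in matrix_system) entry_mult_diagonal:
  assumes "(\<lambda>i. E i i (d i)) sums x"
  shows "entry i j (b * x) = entry i j b * d j"
proof -
  have "(\<lambda>i. E i i ((d i)\<^sup>\<star>)) sums x\<^sup>\<star>"
    using bounded_linear.sums[OF bounded_linear_adj assms] by (simp add: E_adj)
  then have "entry j i (x\<^sup>\<star> * b\<^sup>\<star>) = (d j)\<^sup>\<star> * entry j i (b\<^sup>\<star>)"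
    by (rule entry_diagonal_mult)
  then show ?thesis
    using entry_adj[of j i "b * x"] by (metis adj_adj adj_mult entry_adj)
qed

text \<open>Indices start at 0, so the weight 1/i of the i-th element becomes 1/(i + 1).\<close>

locale abelian_sequence = matrix_system E u
  for E :: "nat \<Rightarrow> nat \<Rightarrow> 'a::cstar_algebra \<Rightarrow> 'b::cstar_algebra" and u :: "nat \<Rightarrow> 'a" +
  fixes a :: "nat \<Rightarrow> 'a" and h :: 'b
  assumes a_abelian: "abelian_element (a i)"
    and a_norm: "norm (a i) = 1"
    and h_def: "h = (\<Sum>i. (1 / real (i + 1)) *\<^sub>R E i i (a i))"
begin

text \<open>A description by entries, suited to computation. \<open>D_eq\<close> identifies it with
  the c_0-direct sum of the statement.\<close>

definition D :: "'b set" where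
  "D = {b. (\<forall>i. entry i i b \<in> corner (a i) (a i)) \<and> (\<forall>i j. i \<noteq> j \<longrightarrow> entry i j b = 0)}"

abbreviation C :: "'b set" where
  "C \<equiv> hereditary_subalgebra h"

lemma a_positive: "positive_in UNIV (a i)"
  using a_abelian by (simp add: abelian_element_def)

lemma a_selfadjoint: "(a i)\<^sup>\<star> = a i"
  using a_positive[of i] by (auto simp: positive_in_def adj_mult adj_adj)

lemma corner_commute: "x \<in> corner (a i) (a i) \<Longrightarrow> y \<in> corner (a i) (a i) \<Longrightarrow> x * y = y * x"
  using a_abelian[of i] by (simp add: abelian_element_def commutative_on_def hereditary_subalgebra_eq_corner)

lemma a_factor: obtains y where "(\<lambda>n::nat. a i * (a i * y n)) \<longlonglongrightarrow> a i" "\<And>n. a i * y n = y n * a i"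
  using approximate_unit_positive[OF a_positive _ cstar_subalgebra_UNIV UNIV_I, of i] a_norm[of i]
  by (metis order_refl)

text \<open>Not immediate without a unit: a_i is the limit of a_i a_i y_n, which equals a_i y_n a_i
  because y_n commutes with a_i.\<close>

lemma a_in_corner: "a i \<in> corner (a i) (a i)"
proof -
  obtain y where y: "(\<lambda>n::nat. a i * (a i * y n)) \<longlonglongrightarrow> a i" "\<And>n. a i * y n = y n * a i"
    using a_factor[of i] by blast
  have "a i * (a i * y n) \<in> corner (a i) (a i)" for n
    using corner_base[of "a i" "y n" "a i"] y(2)[of n] by (metis mult.assoc)
  then show ?thesis by (rule closed_sequentially[OF closed_corner _ y(1)])
qed

lemma corner_approximate_unit:
  obtains e where "\<And>n. e n \<in> corner (a i) (a i)"
    "\<And>j y. y \<in> corner (a i) (a j) \<Longrightarrow> (\<lambda>n::nat. e n * y) \<longlonglongrightarrow> y"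
proof -
  have S: "cstar_subalgebra (corner (a i) (a i))"
    using cstar_subalgebra_hereditary[OF a_selfadjoint] by (simp add: hereditary_subalgebra_eq_corner)
  obtain e where e: "\<And>n. e n \<in> corner (a i) (a i)" "\<And>n. norm (e n) \<le> 1" "(\<lambda>n::nat. e n * a i) \<longlonglongrightarrow> a i"
    using approximate_unit_positive[OF a_positive _ S a_in_corner] a_norm[of i] by (metis order_refl)
  show thesis
    using that[of e] e(1) contraction_mult_tendsto(1)[OF e(2,3)] by blast
qed

section \<open>The element \<open>h\<close>\<close>

abbreviation weight :: "nat \<Rightarrow> real" where
  "weight i \<equiv> 1 / real (i + 1)"

lemma weight_tendsto: "weight \<longlonglongrightarrow> 0"
  using LIMSEQ_inverse_real_of_nat by (simp add: inverse_eq_divide)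

lemma h_sums: "(\<lambda>i. E i i (weight i *\<^sub>R a i)) sums h"
proof -
  have "(\<lambda>i. weight i *\<^sub>R a i) \<longlonglongrightarrow> 0"
    by (rule Lim_null_comparison[OF _ weight_tendsto]) (simp add: a_norm)
  then have "summable (\<lambda>i. E i i (weight i *\<^sub>R a i))" by (rule summable_diagonal)
  then show ?thesis unfolding h_def by (simp add: E_scaleR summable_sums)
qed

lemmas entry_h_mult = entry_diagonal_mult[OF h_sums]
  and entry_mult_h = entry_mult_diagonal[OF h_sums]

lemma entry_h: "entry i j h = (if i = j then weight i *\<^sub>R a i else 0)"
  by (rule entry_sums_diagonal[OF h_sums])

lemma h_selfadjoint: "h\<^sup>\<star> = h"
  by (rule entry_eqI) (simp add: entry_adj entry_h adj_scaleR a_selfadjoint)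

lemma norm_h_le: "norm h \<le> 1"
proof (rule LIMSEQ_le_const2)
  show "(\<lambda>n. norm (\<Sum>i<n. E i i (weight i *\<^sub>R a i))) \<longlonglongrightarrow> norm h"
    using h_sums unfolding sums_def by (rule tendsto_norm)
  show "\<exists>N. \<forall>n\<ge>N. norm (\<Sum>i<n. E i i (weight i *\<^sub>R a i)) \<le> 1"
    by (intro exI allI impI norm_sum_diagonal_le) (simp_all add: a_norm)
qed

lemma h_positive: "positive_in UNIV h"
proof -
  obtain x where x: "\<And>i. a i = (x i)\<^sup>\<star> * x i"
    using a_positive unfolding positive_in_def by metis
  have nx: "norm (x i) = 1" for i
  proof -
    have "(norm (x i))\<^sup>2 = 1" using cstar_identity[of "x i"] a_norm[of i] x[of i] by simp
    then show ?thesis by (metis norm_ge_zero power2_eq_iff_nonneg power_one zero_le_one)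
  qed
  \<comment> \<open>The roots of the weights still tend to 0, so the diagonal sum \<open>z\<close>
    converges in the algebra and serves as a witness for \<open>h\<close>.\<close>
  define d where "d i = sqrt (weight i) *\<^sub>R x i" for i
  have "d \<longlonglongrightarrow> 0"
  proof (rule Lim_null_comparison)
    show "(\<lambda>i. sqrt (weight i)) \<longlonglongrightarrow> 0" using tendsto_real_sqrt[OF weight_tendsto] by simp
  qed (simp add: d_def nx)
  then have "summable (\<lambda>i. E i i (d i))" by (rule summable_diagonal)
  then obtain z where z: "(\<lambda>i. E i i (d i)) sums z" by (auto simp: summable_def)
  have "(\<lambda>n. (\<Sum>i<n. E i i (d i))\<^sup>\<star> * (\<Sum>i<n. E i i (d i))) \<longlonglongrightarrow> z\<^sup>\<star> * z"
    using z unfolding sums_def by (intro tendsto_mult tendsto_adj)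
  moreover have "(d i)\<^sup>\<star> * d i = weight i *\<^sub>R a i" for i
    by (simp add: d_def adj_scaleR x flip: power2_eq_square)
  then have "(\<Sum>i<n. E i i (d i))\<^sup>\<star> * (\<Sum>i<n. E i i (d i)) = (\<Sum>i<n. E i i (weight i *\<^sub>R a i))" for n
    by (simp only: adj_sum E_adj sum_diagonal_mult)
  ultimately have "h = z\<^sup>\<star> * z"
    using h_sums LIMSEQ_unique unfolding sums_def by simp
  then show ?thesis by (auto simp: positive_in_def)
qed

section \<open>The algebra \<open>C\<close> and its entries\<close>

lemma cstar_subalgebra_C: "cstar_subalgebra C"
  by (rule cstar_subalgebra_hereditary[OF h_selfadjoint])

lemmas C_closed = cstar_subalgebraD[OF cstar_subalgebra_C]

lemma E_in_C:
  assumes "y \<in> corner (a i) (a j)" shows "E i j y \<in> C"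
proof -
  have "corner (a i) (a j) \<subseteq> E i j -` C"
  proof (rule corner_minimal)
    show "closed (E i j -` C)"
      by (intro closed_vimage C_closed linear_continuous_on bounded_clinearD(7)[OF bounded_clinear_E])
    fix x
    \<comment> \<open>The scalar (i + 1)(j + 1) cancels the weights contributed by the two factors
      \<open>h\<close>.\<close>
    have "E i j (a i * x * a j) = h * (real (i + 1) * real (j + 1)) *\<^sub>R E i j x * h"
      by (rule entry_eqI) (auto simp: entry_mult_h entry_h_mult entry_simps entry_E divide_simps)
    then show "a i * x * a j \<in> E i j -` C"
      using corner_base[of h "(real (i + 1) * real (j + 1)) *\<^sub>R E i j x" h]
      by (simp add: hereditary_subalgebra_eq_corner)
  qed
  then show ?thesis using assms by blast
qed

lemma entry_in_corner:
  assumes "b \<in> C" shows "entry i j b \<in> corner (a i) (a j)"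
proof -
  have "corner h h \<subseteq> entry i j -` corner (a i) (a j)"
  proof (rule corner_minimal)
    show "closed (entry i j -` corner (a i) (a j))"
      by (intro closed_vimage closed_corner linear_continuous_on bounded_clinearD(7)[OF bounded_clinear_entry])
    fix x
    have "entry i j (h * x * h) = (weight i * weight j) *\<^sub>R (a i * entry i j x * a j)"
      by (simp add: entry_mult_h entry_h_mult)
    then show "h * x * h \<in> entry i j -` corner (a i) (a j)"
      by (simp add: csubspaceD(5)[OF csubspace_corner] corner_base)
  qed
  then show ?thesis using assms by (auto simp: hereditary_subalgebra_eq_corner)
qed

lemma C_memI:
  assumes "\<And>i j. entry i j b \<in> corner (a i) (a j)" shows "b \<in> C"
  by (rule closed_sequentially[OF C_closed(2) _ sum_entries_tendsto])
    (intro csubspace_sum[OF C_closed(1)] E_in_C assms)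

section \<open>The diagonal subalgebra\<close>

lemma D_sums:
  assumes "b \<in> D" shows "(\<lambda>i. E i i (entry i i b)) sums b"
proof -
  have "diagonal_part b = b"
    by (rule entry_eqI) (use assms in \<open>auto simp: entry_diagonal_part D_def\<close>)
  then show ?thesis using diagonal_part_sums[of b] by simp
qed

lemma entry_D_mult: "b \<in> D \<Longrightarrow> entry i j (b * c) = entry i i b * entry i j c"
  and entry_mult_D: "b \<in> D \<Longrightarrow> entry i j (c * b) = entry i j c * entry j j b"
  using entry_diagonal_mult[OF D_sums] entry_mult_diagonal[OF D_sums] by auto

lemma D_memI:
  assumes "\<And>i. entry i i b \<in> corner (a i) (a i)" "\<And>i j. i \<noteq> j \<Longrightarrow> entry i j b = 0" shows "b \<in> D"
  using assms by (simp add: D_def)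

lemma D_subset_C: "D \<subseteq> C"
proof
  fix b assume b: "b \<in> D"
  have "entry i j b \<in> corner (a i) (a j)" for i j
    using b csubspaceD(1)[OF csubspace_corner, of "a i" "a j"] by (cases "i = j") (auto simp: D_def)
  then show "b \<in> C" by (rule C_memI)
qed

lemma cstar_subalgebra_D: "cstar_subalgebra D"
  unfolding cstar_subalgebra_def
proof (intro conjI ballI)
  note c = csubspaceD[OF csubspace_corner]
  show "csubspace D"
    by (auto simp: complex_vector.subspace_def D_def entry_simps c)
  have "D = (\<Inter>i. entry i i -` corner (a i) (a i)) \<inter> (\<Inter>i. \<Inter>j\<in>-{i}. entry i j -` {0})"
    by (auto simp: D_def)
  then show "closed D"
    by (auto intro!: closed_Int closed_INT closed_vimage closed_corner linear_continuous_on
        bounded_clinearD(7)[OF bounded_clinear_entry])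
  show "x * y \<in> D" if "x \<in> D" "y \<in> D" for x y
    by (rule D_memI; use that in \<open>simp add: entry_D_mult\<close>) (auto simp: D_def intro: corner_mult(2))
  show "x\<^sup>\<star> \<in> D" if "x \<in> D" for x
    by (rule D_memI; use that in \<open>simp add: entry_adj\<close>)
      (auto simp: D_def intro: corner_adj[OF _ a_selfadjoint a_selfadjoint])
qed

lemmas D_closed = cstar_subalgebraD[OF cstar_subalgebra_D]

lemma D_commute: "x \<in> D \<Longrightarrow> y \<in> D \<Longrightarrow> x * y = y * x"
proof (rule entry_eqI)
  fix i j assume xy: "x \<in> D" "y \<in> D"
  then have "entry i i x * entry i i y = entry i i y * entry i i x"
    by (intro corner_commute[of _ i]) (auto simp: D_def)
  then show "entry i j (x * y) = entry i j (y * x)"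
    using xy by (cases "i = j") (simp_all add: entry_D_mult, simp add: D_def)
qed

lemma E_in_D: "y \<in> corner (a i) (a i) \<Longrightarrow> E i i y \<in> D"
  by (rule D_memI) (auto simp: entry_E csubspaceD(1)[OF csubspace_corner])

lemma h_in_D: "h \<in> D"
  by (rule D_memI) (auto simp: entry_h intro: csubspaceD(5)[OF csubspace_corner] a_in_corner)

lemma D_eq: "D = {x. \<exists>d. (\<forall>i. d i \<in> hereditary_subalgebra (a i)) \<and> d \<longlonglongrightarrow> 0 \<and> (\<lambda>i. E i i (d i)) sums x}"
proof (intro set_eqI iffI)
  fix x assume x: "x \<in> D"
  let ?d = "\<lambda>i. entry i i x"
  have s: "(\<lambda>i. E i i (?d i)) sums x" by (rule D_sums[OF x])
  have "(\<lambda>i. norm (E i i (?d i))) \<longlonglongrightarrow> 0"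
    by (intro tendsto_norm_zero summable_LIMSEQ_zero sums_summable[OF s])
  then have "?d \<longlonglongrightarrow> 0" by (simp add: tendsto_norm_zero_iff)
  with s x show "x \<in> {x. \<exists>d. (\<forall>i. d i \<in> hereditary_subalgebra (a i)) \<and> d \<longlonglongrightarrow> 0 \<and> (\<lambda>i. E i i (d i)) sums x}"
    by (intro CollectI exI[of _ ?d]) (simp add: D_def hereditary_subalgebra_eq_corner)
next
  fix x assume "x \<in> {x. \<exists>d. (\<forall>i. d i \<in> hereditary_subalgebra (a i)) \<and> d \<longlonglongrightarrow> 0 \<and> (\<lambda>i. E i i (d i)) sums x}"
  then obtain d where "\<forall>i. d i \<in> corner (a i) (a i)" "(\<lambda>i. E i i (d i)) sums x"
    unfolding hereditary_subalgebra_eq_corner by blast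
  then show "x \<in> D"
    by (intro D_memI) (simp_all add: entry_sums_diagonal[of d])
qed

text \<open>As \<open>h\<close> itself lies in \<open>D\<close>, so does the approximate unit made
  from \<open>h\<close>. It works for all of \<open>C\<close> because the elements of
  \<open>C\<close> are limits of products beginning and ending with \<open>h\<close>.\<close>

lemma D_approximate_unit:
  obtains e where "\<And>n. e n \<in> D" "\<And>n. positive_in D (e n)" "\<And>n. norm (e n) \<le> 1"
    "\<And>c. c \<in> C \<Longrightarrow> (\<lambda>n::nat. e n * c) \<longlonglongrightarrow> c" "\<And>c. c \<in> C \<Longrightarrow> (\<lambda>n. c * e n) \<longlonglongrightarrow> c"
proof -
  obtain e where e: "\<And>n. e n \<in> D" "\<And>n. positive_in D (e n)" "\<And>n. norm (e n) \<le> 1"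
      "(\<lambda>n::nat. e n * h) \<longlonglongrightarrow> h" "(\<lambda>n. h * e n) \<longlonglongrightarrow> h"
    using approximate_unit_positive[OF h_positive norm_h_le cstar_subalgebra_D h_in_D] by metis
  show thesis
    by (rule that[OF e(1-3)])
      (use contraction_mult_tendsto[OF e(3)] e(4,5) in \<open>auto simp: hereditary_subalgebra_eq_corner\<close>)
qed

lemma contains_approximate_identity_D: "contains_approximate_identity C D"
proof -
  obtain e where e: "\<And>n. e n \<in> D" "\<And>n. positive_in D (e n)" "\<And>n. norm (e n) \<le> 1"
      "\<And>c. c \<in> C \<Longrightarrow> (\<lambda>n::nat. e n * c) \<longlonglongrightarrow> c" "\<And>c. c \<in> C \<Longrightarrow> (\<lambda>n. c * e n) \<longlonglongrightarrow> c"
    using D_approximate_unit by metis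
  show ?thesis
    unfolding contains_approximate_identity_def
    by (rule exI[of _ "filtermap e sequentially"])
      (use e in \<open>simp add: filtermap_bot_iff eventually_filtermap filterlim_filtermap\<close>)
qed

lemma diagonal_part_in_D: "c \<in> C \<Longrightarrow> diagonal_part c \<in> D"
  by (rule D_memI) (auto simp: entry_diagonal_part intro: entry_in_corner)

text \<open>The diagonal entries of \<open>x\<^sup>\<star> x\<close> are the positive elements \<open>(x (1 \<otimes> \<Theta> i i))\<^sup>\<star> (x (1 \<otimes> \<Theta> i i))\<close>, and
  their square roots tend to zero.\<close>

lemma diagonal_part_positive:
  assumes "positive_in C c" shows "positive_in D (diagonal_part c)"
proof -
  obtain x where x: "x \<in> C" "c = x\<^sup>\<star> * x" using assms by (auto simp: positive_in_def)
  have c: "c \<in> C" unfolding x(2) by (intro C_closed x)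
  have "\<exists>r. r \<in> D \<and> r\<^sup>\<star> = r \<and> E i i (entry i i c) = r * r" for i
  proof -
    have "E i i (entry i i c) \<in> D" by (intro E_in_D entry_in_corner c)
    moreover have "positive_in UNIV (E i i (entry i i c))"
      unfolding x(2) entry_adj_mult_self by (auto simp: positive_in_def)
    ultimately show ?thesis
      using positive_sqrt_in_subalgebra[OF cstar_subalgebra_D _ positive_Unitize] by metis
  qed
  then obtain r where r: "\<And>i. r i \<in> D" "\<And>i. (r i)\<^sup>\<star> = r i" "\<And>i. E i i (entry i i c) = r i * r i" by metis
  define y where "y i = entry i i (r i)" for i
  have y_sa: "(y i)\<^sup>\<star> = y i" for i
    using entry_adj[of i i "r i"] by (simp add: y_def r)
  have yy: "y i * y i = entry i i c" for i
    using arg_cong[OF r(3)[of i], of "entry i i"] by (simp add: entry_D_mult r(1) y_def entry_E)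
  have y_corner: "y i \<in> corner (a i) (a i)" for i
    using r(1)[of i] by (simp add: D_def y_def)
  have "(\<lambda>i. sqrt (norm (E i i (entry i i c)))) \<longlonglongrightarrow> sqrt 0"
    by (intro tendsto_real_sqrt tendsto_norm_zero summable_LIMSEQ_zero sums_summable[OF diagonal_part_sums])
  moreover have "sqrt (norm (E i i (entry i i c))) = norm (y i)" for i
    using norm_selfadjoint_square[OF y_sa, of i] by (simp add: yy)
  ultimately have "y \<longlonglongrightarrow> 0" by (simp add: tendsto_norm_zero_iff)
  then obtain z where z: "(\<lambda>i. E i i (y i)) sums z" using summable_diagonal by (auto simp: summable_def)
  have "z \<in> D"
    by (rule D_memI) (simp_all add: entry_sums_diagonal[OF z] y_corner)
  moreover have "diagonal_part c = z\<^sup>\<star> * z"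
  proof (rule entry_eqI)
    fix i j
    have "entry i j (z\<^sup>\<star> * z) = entry i j (z\<^sup>\<star>) * y j" by (rule entry_mult_diagonal[OF z])
    then show "entry i j (diagonal_part c) = entry i j (z\<^sup>\<star> * z)"
      by (simp add: entry_diagonal_part entry_adj entry_sums_diagonal[OF z] y_sa yy)
  qed
  ultimately show ?thesis by (auto simp: positive_in_def)
qed

lemma faithful_conditional_expectation_diagonal_part:
  "faithful_conditional_expectation C D diagonal_part"
  unfolding faithful_conditional_expectation_def
proof (intro conjI ballI allI impI)
  show "diagonal_part ` C \<subseteq> D" using diagonal_part_in_D by blast
  show "diagonal_part d = d" if "d \<in> D" for d
    by (rule entry_eqI) (use that in \<open>auto simp: entry_diagonal_part D_def\<close>)
  show "diagonal_part (c * d) = diagonal_part c * d" if "c \<in> C" "d \<in> D" for c d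
    by (rule entry_eqI) (use that in \<open>auto simp: entry_diagonal_part entry_mult_D\<close>)
  show "diagonal_part (d * c) = d * diagonal_part c" if "c \<in> C" "d \<in> D" for c d
    by (rule entry_eqI) (use that in \<open>auto simp: entry_diagonal_part entry_D_mult\<close>)
  \<comment> \<open>By \<open>entry_adj_mult_self\<close>, a vanishing diagonal entry of
    \<open>c\<^sup>\<star> * c\<close> means a vanishing column of \<open>c\<close>.\<close>
  show "c = 0" if "c \<in> C" "diagonal_part (c\<^sup>\<star> * c) = 0" for c
  proof -
    have "entry i i (c\<^sup>\<star> * c) = 0" for i
      using entry_diagonal_part[of i i "c\<^sup>\<star> * c"] by (simp add: that(2) entry_simps)
    then have "column_part i c = 0" for i
      using entry_adj_mult_self[of i c] by (simp add: adj_mult_eq_0_iff)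
    then have "entry i j c = 0" for i j
      using E_entry[of i j c] by (simp add: row_simps)
    then show ?thesis by (intro entry_eqI) (simp add: entry_simps)
  qed
qed (simp_all add: diagonal_part_simps norm_diagonal_part_le diagonal_part_positive)

lemma E_free_normaliser:
  assumes "y \<in> corner (a i) (a j)" "i \<noteq> j"
  shows "E i j y \<in> free_normalisers C D"
  unfolding free_normalisers_def
proof (intro CollectI conjI ballI)
  show "E i j y \<in> C" by (rule E_in_C[OF assms(1)])
  show "E i j y * E i j y = 0" using assms(2) by (simp add: E_mult)
  fix d assume d: "d \<in> D"
  have y': "y\<^sup>\<star> \<in> corner (a j) (a i)" by (rule corner_adj[OF assms(1) a_selfadjoint a_selfadjoint])
  have "(E i j y)\<^sup>\<star> * d * E i j y = E j j (y\<^sup>\<star> * entry i i d * y)"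
    by (rule entry_eqI) (auto simp: E_adj entry_mult_E entry_E_mult entry_E)
  then show "(E i j y)\<^sup>\<star> * d * E i j y \<in> D"
    using E_in_D[OF corner_mult(1)[OF y' assms(1)]] by simp
  have "E i j y * d * (E i j y)\<^sup>\<star> = E i i (y * entry j j d * y\<^sup>\<star>)"
    by (rule entry_eqI) (auto simp: E_adj entry_mult_E entry_E_mult entry_E)
  then show "E i j y * d * (E i j y)\<^sup>\<star> \<in> D"
    using E_in_D[OF corner_mult(1)[OF assms(1) y']] by simp
qed

text \<open>For a free normaliser \<open>n\<close>, the element \<open>f = n\<^sup>\<star> n\<close> of \<open>D\<close> satisfies \<open>f n = 0\<close>; hence \<open>f\<close> annihilates
  each diagonal entry \<open>z\<close> of \<open>n\<close>, so that \<open>n z = 0\<close> and \<open>z\<^sup>2 = 0\<close>, where \<open>z\<close> is normal.\<close>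

lemma free_normaliser_entry:
  assumes "n \<in> free_normalisers C D"
  shows "entry i i n = 0"
proof -
  have n: "n \<in> C" "n * n = 0" and norm_n: "\<And>d. d \<in> D \<Longrightarrow> n\<^sup>\<star> * d * n \<in> D"
    using assms by (auto simp: free_normalisers_def)
  define f where "f = n\<^sup>\<star> * n"
  define z where "z = entry i i n"
  \<comment> \<open>The normaliser property yields only the products with an element of
    \<open>D\<close> in the middle; \<open>f\<close> is their limit along an approximate
    unit.\<close>
  have f: "f \<in> D"
  proof -
    obtain e where e: "\<And>k. e k \<in> D" "\<And>c. c \<in> C \<Longrightarrow> (\<lambda>k::nat. e k * c) \<longlonglongrightarrow> c"
      using D_approximate_unit by metis
    show ?thesis
    proof (rule closed_sequentially[OF D_closed(2)])
      show "n\<^sup>\<star> * e k * n \<in> D" for k by (rule norm_n[OF e(1)])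
      show "(\<lambda>k. n\<^sup>\<star> * e k * n) \<longlonglongrightarrow> f"
        unfolding f_def mult.assoc by (intro tendsto_mult tendsto_const e(2) n)
    qed
  qed
  have z: "z \<in> corner (a i) (a i)" unfolding z_def by (rule entry_in_corner[OF n(1)])
  have z': "z\<^sup>\<star> \<in> corner (a i) (a i)" by (rule corner_adj[OF z a_selfadjoint a_selfadjoint])
  have "f * n = 0" by (simp add: f_def mult.assoc n)
  then have "entry i i f * z = 0"
    using entry_D_mult[OF f, of i i n] by (simp add: z_def entry_simps)
  then have "f * E i i z = 0"
  proof (intro entry_eqI)
    fix k l
    show "entry k l (f * E i i z) = entry k l 0"
      using \<open>entry i i f * z = 0\<close> f by (cases "k = i") (auto simp: entry_mult_E entry_simps D_def)
  qed
  then have "(n * E i i z)\<^sup>\<star> * (n * E i i z) = 0"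
    by (simp add: adj_mult mult.assoc f_def)
  then have "n * E i i z = 0" by (simp add: adj_mult_eq_0_iff)
  then have zz: "z * z = 0"
    using entry_mult_E[of i i n i i z] by (simp add: z_def entry_simps)
  have "(z\<^sup>\<star> * z)\<^sup>\<star> * (z\<^sup>\<star> * z) = z\<^sup>\<star> * (z * z\<^sup>\<star>) * z"
    by (simp add: adj_mult adj_adj mult.assoc)
  also have "z * z\<^sup>\<star> = z\<^sup>\<star> * z" by (rule corner_commute[OF z z'])
  also have "z\<^sup>\<star> * (z\<^sup>\<star> * z) * z = 0" by (simp add: mult.assoc zz)
  finally have "z\<^sup>\<star> * z = 0" by (simp only: adj_mult_eq_0_iff)
  then show ?thesis by (simp add: adj_mult_eq_0_iff z_def)
qed

lemma diagonal_part_eq_0_iff: "diagonal_part c = 0 \<longleftrightarrow> (\<forall>i. entry i i c = 0)"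
proof
  assume "diagonal_part c = 0"
  then show "\<forall>i. entry i i c = 0"
    using entry_diagonal_part[of _ _ c] by (metis entry_simps(4))
next
  assume "\<forall>i. entry i i c = 0"
  then show "diagonal_part c = 0"
    by (intro entry_eqI) (simp add: entry_diagonal_part entry_simps)
qed

lemma kernel_diagonal_part:
  "{c \<in> C. diagonal_part c = 0} = closure (cspan (free_normalisers C D))"
proof
  have "{c \<in> C. diagonal_part c = 0} = C \<inter> diagonal_part -` {0}" by auto
  then have "closed {c \<in> C. diagonal_part c = 0}"
    by (auto intro!: closed_Int C_closed closed_vimage linear_continuous_on
        bounded_clinearD(7)[OF bounded_clinear_diagonal_part])
  moreover have "csubspace {c \<in> C. diagonal_part c = 0}"
    using csubspaceD[OF C_closed(1)] by (auto simp: complex_vector.subspace_def diagonal_part_simps)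
  moreover have "free_normalisers C D \<subseteq> {c \<in> C. diagonal_part c = 0}"
    using free_normaliser_entry by (auto simp: diagonal_part_eq_0_iff) (simp add: free_normalisers_def)
  ultimately show "closure (cspan (free_normalisers C D)) \<subseteq> {c \<in> C. diagonal_part c = 0}"
    by (intro closure_cspan_minimal)
  show "{c \<in> C. diagonal_part c = 0} \<subseteq> closure (cspan (free_normalisers C D))"
  proof
    fix c assume "c \<in> {c \<in> C. diagonal_part c = 0}"
    then have c: "c \<in> C" "\<And>i. entry i i c = 0" by (auto simp: diagonal_part_eq_0_iff)
    have sub: "csubspace (cspan (free_normalisers C D))" by (rule complex_vector.subspace_span)
    have "E i j (entry i j c) \<in> cspan (free_normalisers C D)" for i j
    proof (cases "i = j")
      case False
      show ?thesis
        by (rule complex_vector.span_base[OF E_free_normaliser[OF entry_in_corner[OF c(1)] False]])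
    qed (simp add: c(2) csubspaceD(1)[OF sub])
    then have "(\<Sum>i<n. \<Sum>j<n. E i j (entry i j c)) \<in> cspan (free_normalisers C D)" for n
      by (intro csubspace_sum[OF sub])
    then show "c \<in> closure (cspan (free_normalisers C D))"
      unfolding closure_sequential
      by (intro exI[of _ "\<lambda>n. \<Sum>i<n. \<Sum>j<n. E i j (entry i j c)"]) (simp add: sum_entries_tendsto)
  qed
qed

theorem diagonal_pair_C_D:
  assumes "separable_space (euclidean :: 'a topology)"
  shows "diagonal_pair C D"
  unfolding diagonal_pair_def commutative_on_def
  using cstar_subalgebra_C cstar_subalgebra_D D_subset_C D_commute contains_approximate_identity_D
    separable_space_subset_UNIV[OF assms] faithful_conditional_expectation_diagonal_part kernel_diagonal_part
  by blast

text \<open>Let y be a single entry at (i, j) off the diagonal and e a diagonal entry at (i, i). The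
  bimodule property and commutativity of \<open>D\<close> give P(e y) = e P(y) = P(y) e = P(y e) =
  0, and e y tends to y along an approximate unit. So P agrees with \<open>diagonal_part\<close> on
  single entries, and contractivity extends this to \<open>C\<close>.\<close>

theorem conditional_expectation_unique:
  assumes P: "faithful_conditional_expectation C D P" and c: "c \<in> C"
  shows "P c = diagonal_part c"
proof -
  have add: "\<And>x y. x \<in> C \<Longrightarrow> y \<in> C \<Longrightarrow> P (x + y) = P x + P y"
    and scale: "\<And>z x. x \<in> C \<Longrightarrow> P (z *\<^sub>C x) = z *\<^sub>C P x"
    and le: "\<And>x. x \<in> C \<Longrightarrow> norm (P x) \<le> norm x"
    and id: "\<And>d. d \<in> D \<Longrightarrow> P d = d"
    and bimod: "\<And>x d. x \<in> C \<Longrightarrow> d \<in> D \<Longrightarrow> P (x * d) = P x * d" "\<And>x d. x \<in> C \<Longrightarrow> d \<in> D \<Longrightarrow> P (d * x) = d * P x"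
    and PD: "\<And>x. x \<in> C \<Longrightarrow> P x \<in> D"
    using P by (auto simp: faithful_conditional_expectation_def)
  note sub = csubspaceD[OF C_closed(1)]
  have zero: "P 0 = 0" using scale[OF sub(1), of 0] by simp
  have diff: "P (x - y) = P x - P y" if "x \<in> C" "y \<in> C" for x y
    using add[of "x - y" y] that sub(4) by (metis add_diff_cancel_right' diff_add_cancel)
  have sum: "P (sum g I) = (\<Sum>i\<in>I. P (g i))" if "\<And>i. i \<in> I \<Longrightarrow> g i \<in> C" for g :: "nat \<Rightarrow> 'b" and I
    using that
    by (induction I rule: infinite_finite_induct) (simp_all add: zero add csubspace_sum[OF C_closed(1)])
  have PE: "P (E i j y) = diagonal_part (E i j y)" if y: "y \<in> corner (a i) (a j)" for i j y
  proof (cases "i = j")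
    case True
    then have d: "E i j y \<in> D" using E_in_D y by simp
    have "diagonal_part (E i j y) = E i j y"
      by (rule entry_eqI) (auto simp: entry_diagonal_part entry_E True)
    then show ?thesis by (simp add: id[OF d])
  next
    case False
    obtain e where e: "\<And>n. e n \<in> corner (a i) (a i)"
        "\<And>j y. y \<in> corner (a i) (a j) \<Longrightarrow> (\<lambda>n::nat. e n * y) \<longlonglongrightarrow> y"
      using corner_approximate_unit[of i] by metis
    have y_C: "E i j y \<in> C" by (rule E_in_C[OF y])
    have vanish: "P (E i j (e n * y)) = 0" for n
    proof -
      have en: "E i i (e n) \<in> D" by (rule E_in_D[OF e(1)])
      have "P (E i j (e n * y)) = E i i (e n) * P (E i j y)"
        using bimod(2)[OF y_C en] by (simp add: E_mult)
      also have "\<dots> = P (E i j y) * E i i (e n)"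
        by (rule D_commute[OF en PD[OF y_C]])
      also have "\<dots> = P (E i j y * E i i (e n))" by (rule bimod(1)[OF y_C en, symmetric])
      also have "\<dots> = 0" using False by (simp add: E_mult zero)
      finally show ?thesis .
    qed
    have "norm (P (E i j y)) \<le> norm (y - e n * y)" for n
    proof -
      have en: "E i j (e n * y) \<in> C" by (rule E_in_C[OF corner_mult(2)[OF e(1) y]])
      have "P (E i j y) = P (E i j y - E i j (e n * y))"
        by (simp add: diff[OF y_C en] vanish)
      also have "norm \<dots> \<le> norm (E i j y - E i j (e n * y))"
        by (rule le[OF sub(4)[OF y_C en]])
      finally show ?thesis by (simp flip: E_diff)
    qed
    moreover have "(\<lambda>n. norm (y - e n * y)) \<longlonglongrightarrow> norm (y - y)"
      by (intro tendsto_intros e(2)[OF y])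
    ultimately have "norm (P (E i j y)) \<le> norm (y - y)"
      by (intro LIMSEQ_le_const) auto
    then have "P (E i j y) = 0" by simp
    moreover have "diagonal_part (E i j y) = 0"
      unfolding diagonal_part_eq_0_iff using False by (auto simp: entry_E)
    ultimately show ?thesis by simp
  qed
  define S where "S n = (\<Sum>i<n. \<Sum>j<n. E i j (entry i j c))" for n
  have S: "S \<longlonglongrightarrow> c" unfolding S_def[abs_def] by (rule sum_entries_tendsto)
  have EC: "E i j (entry i j c) \<in> C" for i j by (rule E_in_C[OF entry_in_corner[OF c]])
  have SC: "S n \<in> C" for n
    unfolding S_def by (intro csubspace_sum[OF C_closed(1)] EC)
  have PS: "P (S n) = diagonal_part (S n)" for n
  proof -
    have "P (S n) = (\<Sum>i<n. \<Sum>j<n. P (E i j (entry i j c)))"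
      unfolding S_def by (subst sum) (auto intro!: csubspace_sum[OF C_closed(1)] EC sum.cong sum)
    then show ?thesis
      by (simp add: S_def diagonal_part_simps PE[OF entry_in_corner[OF c]])
  qed
  have "(\<lambda>n. P (S n)) \<longlonglongrightarrow> P c"
  proof (rule LIM_zero_cancel, rule Lim_null_comparison)
    show "\<forall>\<^sub>F n in sequentially. norm (P (S n) - P c) \<le> norm (S n - c)"
      by (intro always_eventually allI) (simp flip: diff[OF SC c] add: le[OF sub(4)[OF SC c]])
    show "(\<lambda>n. norm (S n - c)) \<longlonglongrightarrow> 0"
      by (intro tendsto_norm_zero LIM_zero S)
  qed
  moreover have "(\<lambda>n. P (S n)) \<longlonglongrightarrow> diagonal_part c"
    unfolding PS by (rule bounded_clinearD(8)[OF bounded_clinear_diagonal_part S])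
  ultimately show ?thesis by (rule LIMSEQ_unique)
qed

end

section \<open>The imprimitivity bimodule\<close>

context matrix_system
begin

text \<open>\<open>column_part\<close> was defined through the adjoint. As a limit of right
  multiplications it can be evaluated on all elementary tensors, which identifies it with the right
  half of a double centralizer.\<close>

lemma column_tendsto: "(\<lambda>n. b * E i i (u n)) \<longlonglongrightarrow> column_part i b"
proof -
  have 1: "bounded_clinear (\<lambda>b. b * E i i (u n))" for n
    by (intro bounded_clinear_mult bounded_clinear_ident)
  have 2: "norm (b * E i i (u n)) \<le> norm b" for n b
    by (rule norm_mult_contraction) (simp add: u_norm)
  have E: "(\<lambda>n. E k l x * E i i (u n)) \<longlonglongrightarrow> column_part i (E k l x)" for k l x
    using tendsto_E[OF u_right[of x], of k l] by (simp add: E_mult column_E)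
  then have 3: "convergent (\<lambda>n. E k l x * E i i (u n))" for k l x by (auto simp: convergent_def)
  note c = contractions_converge[OF 1 2 3]
  have "lim (\<lambda>n. b * E i i (u n)) = column_part i b"
    by (rule E_ext[OF c(2) bounded_clinear_column]) (simp add: limI[OF E])
  then show ?thesis using c(1)[of b] by (simp add: convergent_LIMSEQ_iff)
qed

lemma cstar_subalgebra_range_E: "cstar_subalgebra (range (E i i))"
  unfolding cstar_subalgebra_def
proof (intro conjI ballI)
  show "csubspace (range (E i i))"
    by (auto simp: complex_vector.subspace_def simp flip: E_add E_scaleC intro: range_eqI[of 0 _ 0])
  show "closed (range (E i i))" by (rule closed_range_E)
qed (auto simp: E_mult E_adj)

text \<open>\<open>x\<close> itself need not be a single entry. But the copy
  \<open>range (E i i)\<close> of the algebra is a C*-subalgebra, and a root taken there has the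
  form \<open>E i i y\<close>.\<close>

lemma positive_in_entry:
  assumes "x\<^sup>\<star> * x = E i i t" shows "positive_in UNIV t"
proof -
  have "positive_in UNIV (E i i t)" unfolding assms[symmetric] by (auto simp: positive_in_def)
  then obtain r where r: "r \<in> range (E i i)" "r\<^sup>\<star> = r" "E i i t = r * r"
    using positive_sqrt_in_subalgebra[OF cstar_subalgebra_range_E rangeI positive_Unitize] by metis
  then obtain y where "r = E i i y" by blast
  with r have "t = y\<^sup>\<star> * y" by (simp add: E_adj E_mult)
  then show ?thesis by (auto simp: positive_in_def)
qed

end

context abelian_sequence
begin

definition right_ideal :: "'b set" where
  "right_ideal = closure (range (\<lambda>z. h * z))"

definition bimodule :: "'b set" where
  "bimodule = {x \<in> right_ideal. column_part 0 x = x}"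

lemma right_ideal_base: "h * z \<in> right_ideal"
  unfolding right_ideal_def by (rule subsetD[OF closure_subset]) (rule rangeI)

lemma closed_right_ideal: "closed right_ideal"
  by (simp add: right_ideal_def)

lemma csubspace_right_ideal: "csubspace right_ideal"
  unfolding right_ideal_def
proof (rule csubspace_closure)
  show "csubspace (range (\<lambda>z. h * z))"
    by (auto simp: complex_vector.subspace_def simp flip: distrib_left mult_scaleC_right
        intro: range_eqI[of 0 _ 0])
qed

lemma right_ideal_mult:
  assumes "x \<in> right_ideal" shows "x * t \<in> right_ideal"
proof -
  obtain f where f: "(\<lambda>n::nat. h * f n) \<longlonglongrightarrow> x" by (rule closure_range_sequence[OF assms[unfolded right_ideal_def]])
  show ?thesis
  proof (rule closed_sequentially[OF closed_right_ideal])
    show "(\<lambda>n. h * f n * t) \<longlonglongrightarrow> x * t" by (intro tendsto_intros f)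
    show "h * f n * t \<in> right_ideal" for n unfolding mult.assoc by (rule right_ideal_base)
  qed
qed

lemma C_subset_right_ideal: "C \<subseteq> right_ideal"
  unfolding hereditary_subalgebra_eq_corner
  by (rule corner_minimal[OF closed_right_ideal]) (simp add: mult.assoc right_ideal_base)

lemma right_ideal_mult_adj:
  assumes "x \<in> right_ideal" "y \<in> right_ideal" shows "x * y\<^sup>\<star> \<in> C"
proof -
  obtain f where f: "(\<lambda>n::nat. h * f n) \<longlonglongrightarrow> x" by (rule closure_range_sequence[OF assms(1)[unfolded right_ideal_def]])
  obtain g where g: "(\<lambda>n::nat. h * g n) \<longlonglongrightarrow> y" by (rule closure_range_sequence[OF assms(2)[unfolded right_ideal_def]])
  show ?thesis
  proof (rule closed_sequentially[OF C_closed(2)])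
    show "(\<lambda>n. (h * f n) * (h * g n)\<^sup>\<star>) \<longlonglongrightarrow> x * y\<^sup>\<star>" by (intro tendsto_intros tendsto_adj f g)
    show "(h * f n) * (h * g n)\<^sup>\<star> \<in> C" for n
      using corner_base[of h "f n * (g n)\<^sup>\<star>" h]
      by (simp add: hereditary_subalgebra_eq_corner adj_mult h_selfadjoint mult.assoc)
  qed
qed

lemma csubspace_bimodule: "csubspace bimodule"
  using csubspaceD[OF csubspace_right_ideal]
  by (auto simp: complex_vector.subspace_def bimodule_def column_simps)

lemma closed_bimodule: "closed bimodule"
proof -
  have "bimodule = right_ideal \<inter> {x. column_part 0 x = x}" by (auto simp: bimodule_def)
  then show ?thesis
    by (auto intro!: closed_Int closed_right_ideal closed_Collect_eq linear_continuous_on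
        bounded_clinearD(7)[OF bounded_clinear_column] continuous_on_id)
qed

text \<open>Both factors are supported in column 0, so their product has only the entry (0, 0), and
  passing to the \<open>A\<close>-valued inner product loses nothing.\<close>

lemma bimodule_inner: "x \<in> bimodule \<Longrightarrow> y \<in> bimodule \<Longrightarrow> E 0 0 (entry 0 0 (x\<^sup>\<star> * y)) = x\<^sup>\<star> * y"
  by (simp add: E_entry column_mult row_mult bimodule_def flip: column_adj)

lemma bimodule_mult_left: "c \<in> C \<Longrightarrow> x \<in> bimodule \<Longrightarrow> c * x \<in> bimodule"
  using C_subset_right_ideal by (auto simp: bimodule_def column_mult intro: right_ideal_mult)

lemma bimodule_mult_right: "x \<in> bimodule \<Longrightarrow> x * E 0 0 t \<in> bimodule"
  by (auto simp: bimodule_def column_mult column_E intro: right_ideal_mult)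

lemma bimodule_base: "h * E i 0 z \<in> bimodule"
  by (simp add: bimodule_def column_mult column_E right_ideal_base)

lemma bimodule_left_full: "closure (cspan {x * y\<^sup>\<star> | x y. x \<in> bimodule \<and> y \<in> bimodule}) = C"
  (is "?K = C")
proof
  show "?K \<subseteq> C"
    by (rule closure_cspan_minimal[OF _ C_closed(1,2)])
      (auto simp: bimodule_def intro: right_ideal_mult_adj)
  have sub: "csubspace ?K" by (intro csubspace_closure complex_vector.subspace_span)
  have "h * x * h \<in> ?K" for x
  proof -
    have f: "bounded_clinear (\<lambda>x. h * x * h)"
      by (intro bounded_clinear_mult bounded_clinear_ident)
    have "x \<in> {x. h * x * h \<in> ?K}"
    proof (rule E_induct)
      show "csubspace {x. h * x * h \<in> ?K}"
        using csubspaceD[OF sub]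
        by (simp add: complex_vector.subspace_def distrib_left distrib_right mult_scaleC_left mult_scaleC_right)
      have "closed ((\<lambda>x. h * x * h) -` ?K)"
        by (intro closed_vimage closed_closure linear_continuous_on bounded_clinearD(7)[OF f])
      then show "closed {x. h * x * h \<in> ?K}" by (simp add: vimage_def)
      fix i j z
      have "h * E i j z * h \<in> ?K"
      proof (rule closed_sequentially[OF closed_closure])
        \<comment> \<open>Inserting \<open>u n\<close> allows a factorization through the index 0,
          as \<open>E i 0 z * E 0 j (u n)\<close>, which brings in two elements of the
          bimodule.\<close>
        show "(\<lambda>n. h * E i j (z * u n) * h) \<longlonglongrightarrow> h * E i j z * h"
          by (intro tendsto_mult tendsto_const tendsto_E u_right)
        show "h * E i j (z * u n) * h \<in> ?K" for n
        proof -
          have "h * E i j (z * u n) * h = (h * E i 0 z) * (E 0 j (u n) * h)"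
            by (simp add: E_mult mult.assoc flip: mult.assoc[of "E i 0 z"])
          also have "E 0 j (u n) * h = (h * E j 0 ((u n)\<^sup>\<star>))\<^sup>\<star>"
            by (simp add: adj_mult E_adj adj_adj h_selfadjoint)
          finally show ?thesis
            using bimodule_base by (intro subsetD[OF closure_subset] complex_vector.span_base) blast
        qed
      qed
      then show "E i j z \<in> {x. h * x * h \<in> ?K}" by simp
    qed
    then show ?thesis by simp
  qed
  then show "C \<subseteq> ?K"
    unfolding hereditary_subalgebra_eq_corner by (rule corner_minimal[OF closed_closure])
qed

lemma bimodule_right_full:
  assumes "\<And>J. closed_ideal J \<Longrightarrow> range a \<subseteq> J \<Longrightarrow> J = UNIV"
  shows "closure (cspan {entry 0 0 (x\<^sup>\<star> * y) | x y. x \<in> bimodule \<and> y \<in> bimodule}) = UNIV"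
    (is "closure (cspan ?G) = UNIV")
proof (rule assms)
  let ?J = "closure (cspan ?G)"
  have sub: "csubspace ?J" by (intro csubspace_closure complex_vector.subspace_span)
  have G: "entry 0 0 (x\<^sup>\<star> * y) \<in> ?J" if "x \<in> bimodule" "y \<in> bimodule" for x y
    using that by (intro subsetD[OF closure_subset] complex_vector.span_base) blast
  have mult: "?J \<subseteq> f -` ?J" if "bounded_clinear f" "\<And>g. g \<in> ?G \<Longrightarrow> f g \<in> ?J" for f
  proof (rule closure_cspan_minimal)
    note f = bounded_clinearD[OF that(1)]
    show "?G \<subseteq> f -` ?J" using that(2) by blast
    show "csubspace (f -` ?J)"
      using csubspaceD[OF sub] by (simp add: complex_vector.subspace_def f)
    show "closed (f -` ?J)" by (intro closed_vimage closed_closure linear_continuous_on f)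
  qed
  have right: "?J \<subseteq> (\<lambda>g. g * t) -` ?J" for t
  proof (rule mult)
    fix g assume "g \<in> ?G"
    then obtain x y where xy: "x \<in> bimodule" "y \<in> bimodule" "g = entry 0 0 (x\<^sup>\<star> * y)" by blast
    have "g * t = entry 0 0 (x\<^sup>\<star> * (y * E 0 0 t))"
      by (simp add: xy(3) entry_mult_E flip: mult.assoc)
    then show "g * t \<in> ?J" using G[OF xy(1) bimodule_mult_right[OF xy(2)]] by simp
  qed (intro bounded_clinear_mult bounded_clinear_ident)
  have left: "?J \<subseteq> (\<lambda>g. t * g) -` ?J" for t
  proof (rule mult)
    fix g assume "g \<in> ?G"
    then obtain x y where xy: "x \<in> bimodule" "y \<in> bimodule" "g = entry 0 0 (x\<^sup>\<star> * y)" by blast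
    have "t * g = entry 0 0 ((x * E 0 0 (t\<^sup>\<star>))\<^sup>\<star> * y)"
      by (simp add: xy(3) adj_mult E_adj adj_adj mult.assoc entry_E_mult)
    then show "t * g \<in> ?J" using G[OF bimodule_mult_right[OF xy(1)] xy(2)] by simp
  qed (intro bounded_clinear_mult bounded_clinear_ident)
  show "closed_ideal ?J"
    unfolding closed_ideal_def using sub left right by auto
  show "range a \<subseteq> ?J"
  proof (rule image_subsetI)
    fix i
    \<comment> \<open>The two copies of a_i come from the two factors \<open>h\<close>. The outer
      elements are free; they will be specialised to \<open>u n\<close> and to the y_n of
      \<open>a_factor\<close>.\<close>
    have zw: "z * (a i * (a i * w)) \<in> ?J" for z w
    proof -
      have eq: "entry 0 0 ((h * E i 0 (z\<^sup>\<star>))\<^sup>\<star> * (h * E i 0 w)) = (weight i * weight i) *\<^sub>R (z * (a i * (a i * w)))"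
        by (simp add: adj_mult h_selfadjoint E_adj adj_adj mult.assoc entry_E_mult entry_h_mult entry_E)
      have "(weight i * weight i) *\<^sub>R (z * (a i * (a i * w))) \<in> ?J"
        unfolding eq[symmetric] by (rule G[OF bimodule_base bimodule_base])
      from csubspaceD(5)[OF sub this, of "1 / (weight i * weight i)"] show ?thesis by simp
    qed
    obtain y where y: "(\<lambda>n::nat. a i * (a i * y n)) \<longlonglongrightarrow> a i" using a_factor[of i] by metis
    have "a i * (a i * y n) \<in> ?J" for n
      by (rule closed_sequentially[OF closed_closure zw u_left])
    then show "a i \<in> ?J" by (rule closed_sequentially[OF closed_closure _ y])
  qed
qed

theorem morita_equivalent_C:
  assumes generate: "\<And>J. closed_ideal J \<Longrightarrow> range a \<subseteq> J \<Longrightarrow> J = UNIV"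
  shows "morita_equivalent C (UNIV :: 'a set)"
proof -
  \<comment> \<open>The second component is a dummy: the definition of Morita equivalence asks for a set of pairs.\<close>
  define X where "X = bimodule \<times> {0 :: 'a}"
  define vadd where "vadd x y = (fst x + fst y, 0 :: 'a)" for x y :: "'b \<times> 'a"
  define vzero where "vzero = (0 :: 'b, 0 :: 'a)"
  define vscale where "vscale c x = (c *\<^sub>C fst x, 0 :: 'a)" for c and x :: "'b \<times> 'a"
  define lact where "lact c x = (c * fst x, 0 :: 'a)" for c and x :: "'b \<times> 'a"
  define ract where "ract x t = (fst x * E 0 0 t, 0 :: 'a)" for t and x :: "'b \<times> 'a"
  define linner where "linner x y = fst x * (fst y)\<^sup>\<star>" for x y :: "'b \<times> 'a"
  define rinner where "rinner x y = entry 0 0 ((fst x)\<^sup>\<star> * fst y)" for x y :: "'b \<times> 'a"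
  note defs = vadd_def vzero_def vscale_def lact_def ract_def linner_def rinner_def
  note sub = csubspaceD[OF csubspace_bimodule]
  have X: "x \<in> X \<longleftrightarrow> fst x \<in> bimodule \<and> snd x = 0" for x by (cases x) (auto simp: X_def)
  have cv: "complex_vector_carrier X vadd vzero vscale"
  proof
    show "\<exists>y\<in>X. vadd x y = vzero" if "x \<in> X" for x
      using that by (intro bexI[of _ "(- fst x, 0)"]) (auto simp: X defs sub)
  qed (auto simp: X defs sub scaleC_add_left scaleC_add_right scaleC_scaleC prod_eq_iff)
  interpret complex_vector_carrier X vadd vzero vscale by (rule cv)
  have vdiff: "fst (vdiff x y) = fst x - fst y" for x y
    by (simp add: vdiff_def defs scaleC_minus_one)
  \<comment> \<open>Both Hilbert module norms equal the norm of the first component, so one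
    argument, from closedness of \<open>bimodule\<close>, serves both sides.\<close>
  have complete: "complete_wrt N" if N: "\<And>x. x \<in> X \<Longrightarrow> N x = norm (fst x)" for N
    unfolding complete_wrt_def
  proof (intro allI impI, elim conjE)
    fix f :: "nat \<Rightarrow> 'b \<times> 'a"
    assume f: "range f \<subseteq> X" and cauchy: "\<forall>e>0. \<exists>n0. \<forall>m\<ge>n0. \<forall>n\<ge>n0. N (vdiff (f m) (f n)) < e"
    have fX: "f n \<in> X" for n using f by blast
    have dX: "vdiff x y \<in> X" if "x \<in> X" "y \<in> X" for x y
      using that by (auto simp: X vdiff sub) (auto simp: vdiff_def defs)
    have "Cauchy (\<lambda>n. fst (f n))"
      unfolding Cauchy_def dist_norm using cauchy by (simp only: N[OF dX[OF fX fX]] vdiff)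
    then obtain l where l: "(\<lambda>n. fst (f n)) \<longlonglongrightarrow> l"
      by (auto simp: Cauchy_convergent_iff convergent_def)
    have "l \<in> bimodule"
      by (rule closed_sequentially[OF closed_bimodule _ l]) (use fX X in blast)
    then have lX: "(l, 0) \<in> X" by (simp add: X)
    show "\<exists>x\<in>X. (\<lambda>n. N (vdiff (f n) x)) \<longlonglongrightarrow> 0"
    proof (rule bexI[OF _ lX])
      show "(\<lambda>n. N (vdiff (f n) (l, 0))) \<longlonglongrightarrow> 0"
        unfolding N[OF dX[OF fX lX]] vdiff
        by (intro tendsto_norm_zero) (simp add: LIM_zero l)
    qed
  qed
  have "full_left_hilbert_module C X vadd vzero vscale lact linner"
  proof (intro full_left_hilbert_module.intro cv full_left_hilbert_module_axioms.intro)
    show "linner x y \<in> C" if "x \<in> X" "y \<in> X" for x y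
      using that by (auto simp: X linner_def bimodule_def intro: right_ideal_mult_adj)
    then show "positive_in C (linner x x)" if "x \<in> X" for x
      using that
      by (intro positive_in_subalgebra[OF cstar_subalgebra_C])
        (auto simp: positive_in_def linner_def intro: exI[of _ "(fst x)\<^sup>\<star>"] simp: adj_adj)
    show "x = vzero" if "x \<in> X" "linner x x = 0" for x
      using that norm_mult_adj[of "fst x"] by (simp add: X defs prod_eq_iff)
    show "complete_wrt (\<lambda>x. sqrt (norm (linner x x)))"
      by (rule complete) (simp add: linner_def norm_mult_adj)
    have "{linner x y | x y. x \<in> X \<and> y \<in> X} = {x * y\<^sup>\<star> | x y. x \<in> bimodule \<and> y \<in> bimodule}"
      by (force simp: X_def linner_def)
    then show "closure (cspan {linner x y | x y. x \<in> X \<and> y \<in> X}) = C"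
      using bimodule_left_full by simp
  qed (auto simp: X defs bimodule_mult_left distrib_left distrib_right mult_scaleC_left mult_scaleC_right
      mult.assoc adj_mult adj_adj)
  moreover have "full_right_hilbert_module UNIV X vadd vzero vscale ract rinner"
  proof (intro full_right_hilbert_module.intro cv full_right_hilbert_module_axioms.intro)
    have norm_rinner: "norm (rinner x x) = (norm (fst x))\<^sup>2" if "x \<in> X" for x
    proof -
      have "norm (rinner x x) = norm (E 0 0 (rinner x x))" by simp
      also have "E 0 0 (rinner x x) = (fst x)\<^sup>\<star> * fst x"
        using that by (simp only: X rinner_def bimodule_inner)
      finally show ?thesis by (simp add: cstar_identity)
    qed
    show "positive_in UNIV (rinner x x)" if "x \<in> X" for x
      by (rule positive_in_entry[of "fst x" 0]) (use that in \<open>simp add: X rinner_def bimodule_inner\<close>)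
    show "x = vzero" if "x \<in> X" "rinner x x = 0" for x
      using that norm_rinner[OF that(1)] by (simp add: X vzero_def prod_eq_iff)
    show "complete_wrt (\<lambda>x. sqrt (norm (rinner x x)))"
      by (rule complete) (simp add: norm_rinner)
    have "{rinner x y | x y. x \<in> X \<and> y \<in> X} = {entry 0 0 (x\<^sup>\<star> * y) | x y. x \<in> bimodule \<and> y \<in> bimodule}"
      by (force simp: X_def rinner_def)
    then show "closure (cspan {rinner x y | x y. x \<in> X \<and> y \<in> X}) = UNIV"
      using bimodule_right_full[OF generate] by simp
    show "rinner x (ract y b) = rinner x y * b" for x y b
      by (simp add: rinner_def ract_def entry_mult_E flip: mult.assoc)
    show "ract x (b * d) = ract (ract x b) d" for x b d
      by (simp add: ract_def E_mult mult.assoc)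
    show "(rinner x y)\<^sup>\<star> = rinner y x" for x y
      by (simp add: rinner_def adj_mult adj_adj flip: entry_adj)
  qed (auto simp: X defs bimodule_mult_right distrib_left distrib_right mult_scaleC_left mult_scaleC_right
      E_add E_scaleC entry_simps)
  moreover have "imprimitivity_bimodule_axioms C UNIV X lact ract linner rinner"
  proof
    show "lact (linner x y) z = ract x (rinner y z)" if "x \<in> X" "y \<in> X" "z \<in> X" for x y z
      using that by (simp add: X lact_def linner_def ract_def rinner_def bimodule_inner mult.assoc)
  qed (auto simp: defs adj_mult adj_adj E_adj mult.assoc)
  ultimately have "imprimitivity_bimodule C UNIV X vadd vzero vscale lact ract linner rinner"
    by (rule imprimitivity_bimodule.intro)
  then show ?thesis
    unfolding morita_equivalent_def using cstar_subalgebra_C cstar_subalgebra_UNIV by blast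
qed

end

section \<open>Tensor products\<close>

lemma tensor_with_compactsD:
  assumes "tensor_with_compacts tensor" "k \<in> compact_operators" "l \<in> compact_operators"
  shows "clinear (\<lambda>x. tensor x k)" "tensor x (k + l) = tensor x k + tensor x l"
    "tensor x (c *\<^sub>C k) = c *\<^sub>C tensor x k" "tensor x k * tensor y l = tensor (x * y) (k o\<^sub>L l)"
    "adjoint_pair k l \<Longrightarrow> (tensor x k)\<^sup>\<star> = tensor (x\<^sup>\<star>) l" "norm (tensor x k) = norm x * norm k"
proof -
  note t = assms(1)[unfolded tensor_with_compacts_def]
  show "clinear (\<lambda>x. tensor x k)"
    by (rule bspec[OF t[THEN conjunct1] assms(2)])
  show "tensor x (k + l) = tensor x k + tensor x l"
    by (rule t[THEN conjunct2, THEN conjunct1, rule_format, OF assms(2,3)])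
  show "tensor x (c *\<^sub>C k) = c *\<^sub>C tensor x k"
    by (rule t[THEN conjunct2, THEN conjunct2, THEN conjunct1, rule_format, OF assms(2)])
  show "tensor x k * tensor y l = tensor (x * y) (k o\<^sub>L l)"
    by (rule t[THEN conjunct2, THEN conjunct2, THEN conjunct2, THEN conjunct1, rule_format, OF assms(2,3)])
  show "adjoint_pair k l \<Longrightarrow> (tensor x k)\<^sup>\<star> = tensor (x\<^sup>\<star>) l"
    by (rule t[THEN conjunct2, THEN conjunct2, THEN conjunct2, THEN conjunct2, THEN conjunct1, rule_format, OF assms(2,3)])
  show "norm (tensor x k) = norm x * norm k"
    by (rule t[THEN conjunct2, THEN conjunct2, THEN conjunct2, THEN conjunct2, THEN conjunct2, THEN conjunct1, rule_format, OF assms(2)])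
qed

text \<open>The cross norm makes the tensor continuous in the operator, so density of the span of
  the matrix units among the compact operators carries over.\<close>

lemma tensor_matrix_units_dense:
  fixes tensor :: "'a::cstar_algebra \<Rightarrow> nat operator \<Rightarrow> 'b::cstar_algebra"
  assumes "tensor_with_compacts tensor"
  shows "closure (cspan {tensor x (\<Theta> i j) | i j x. True}) = UNIV" (is "?K = UNIV")
proof -
  note k = csubspaceD[OF csubspace_compact_operators]
  note add = tensor_with_compactsD(2)[OF assms] and scale = tensor_with_compactsD(3)[OF assms _ k(1)]
    and norm = tensor_with_compactsD(6)[OF assms _ k(1)]
  have zero: "tensor x 0 = 0" for x using scale[OF k(1), of x 0] by simp
  have diff: "tensor x (k - l) = tensor x k - tensor x l"
    if "k \<in> compact_operators" "l \<in> compact_operators" for x k l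
    using add[OF that(1) csubspaceD(6)[OF csubspace_compact_operators that(2)], of x] scale[OF that(2), of x "-1"]
    by (simp add: scaleC_minus_one)
  have sub: "csubspace ?K" by (intro csubspace_closure complex_vector.subspace_span)
  \<comment> \<open>Compactness is carried through the induction because the laws of
    \<open>tensor\<close> are available for compact operators only.\<close>
  have span: "m \<in> compact_operators \<and> tensor x m \<in> cspan {tensor x (\<Theta> i j) | i j x. True}"
    if "m \<in> cspan (range (case_prod \<Theta>))" for m x
    using that
  proof (induction m rule: complex_vector.span_induct_alt)
    case base
    then show ?case by (simp add: zero k complex_vector.span_zero)
  next
    case (step c b m)
    then obtain i j where b: "b = \<Theta> i j" by auto
    have bc: "c *\<^sub>C b \<in> compact_operators" by (simp add: b k(3) matrix_unit_compact)
    have "tensor x (c *\<^sub>C b + m) = c *\<^sub>C tensor x (\<Theta> i j) + tensor x m"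
      using step bc by (simp add: add scale[OF matrix_unit_compact] b)
    moreover have "c *\<^sub>C tensor x (\<Theta> i j) + tensor x m \<in> cspan {tensor x (\<Theta> i j) | i j x. True}"
      by (rule complex_vector.span_add[OF complex_vector.span_scale[OF complex_vector.span_base]])
        (use step in auto)
    ultimately show ?case using step bc by (simp add: k)
  qed
  have "tensor x m \<in> ?K" if m: "m \<in> compact_operators" for x m
  proof -
    obtain f where f: "\<forall>n. f n \<in> cspan (range (case_prod \<Theta>))" "f \<longlonglongrightarrow> m"
      using subsetD[OF compact_operators_subset_closure m] unfolding closure_sequential by blast
    have "(\<lambda>n. tensor x (f n)) \<longlonglongrightarrow> tensor x m"
    proof (rule LIM_zero_cancel, rule Lim_null_comparison)
      show "\<forall>\<^sub>F n in sequentially. norm (tensor x (f n) - tensor x m) \<le> norm x * norm (f n - m)"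
        using span f(1) m by (intro always_eventually allI) (simp flip: diff add: norm k)
      show "(\<lambda>n. norm x * norm (f n - m)) \<longlonglongrightarrow> 0"
        by (intro tendsto_mult_right_zero tendsto_norm_zero LIM_zero f)
    qed
    then show ?thesis
      unfolding closure_sequential using span f(1) by (intro exI[of _ "\<lambda>n. tensor x (f n)"]) blast
  qed
  then have "closure (cspan {tensor x m | x m. m \<in> compact_operators}) \<subseteq> ?K"
    by (intro closure_cspan_minimal sub closed_closure) blast
  moreover have "closure (cspan {tensor x m | x m. m \<in> compact_operators}) = UNIV"
    using assms unfolding tensor_with_compacts_def by (elim conjE)
  ultimately show ?thesis by blast
qed

lemma tensor_matrix_system:
  fixes tensor :: "'a::cstar_algebra \<Rightarrow> nat operator \<Rightarrow> 'b::cstar_algebra"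
  assumes tensor: "tensor_with_compacts tensor"
    and u: "\<And>n. norm (u n) \<le> 1" "\<And>x. (\<lambda>n. u n * x) \<longlonglongrightarrow> x" "\<And>x. (\<lambda>n. x * u n) \<longlonglongrightarrow> x"
  shows "matrix_system (\<lambda>i j x. tensor x (\<Theta> i j)) u"
proof
  note t = tensor_with_compactsD[OF tensor matrix_unit_compact matrix_unit_compact]
  have lin: "clinear (\<lambda>x. tensor x (\<Theta> i j))" for i j by (rule t(1))
  then show "tensor (x + y) (\<Theta> i j) = tensor x (\<Theta> i j) + tensor y (\<Theta> i j)"
    "tensor (c *\<^sub>C x) (\<Theta> i j) = c *\<^sub>C tensor x (\<Theta> i j)" for c x y i j
    by (simp_all add: clinear_def)
  have zero: "tensor x 0 = 0" for x
  proof -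
    have "norm (tensor x 0) = norm x * norm (0 :: nat operator)"
      by (intro tensor_with_compactsD(6)[OF tensor _ matrix_unit_compact] csubspaceD(1)[OF csubspace_compact_operators])
    then show ?thesis by simp
  qed
  have "tensor x (\<Theta> i j) * tensor y (\<Theta> k l) = tensor (x * y) (\<Theta> i j o\<^sub>L \<Theta> k l)" for i j k l x y
    by (rule t(4))
  then show "tensor x (\<Theta> i j) * tensor y (\<Theta> k l) = (if j = k then tensor (x * y) (\<Theta> i l) else 0)" for i j k l x y
    by (simp add: matrix_unit_compose zero)
  show "(tensor x (\<Theta> i j))\<^sup>\<star> = tensor (x\<^sup>\<star>) (\<Theta> j i)" for i j x
    by (rule t(5)[OF matrix_unit_adjoint])
  have "norm (tensor x (\<Theta> i j)) = norm x * norm (\<Theta> i j)" for i j x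
    by (rule t(6))
  then show "norm (tensor x (\<Theta> i j)) = norm x" for i j x by simp
  show "closure (cspan {tensor x (\<Theta> i j) | i j x. True}) = UNIV"
    by (rule tensor_matrix_units_dense[OF tensor])
qed (rule u)+

text \<open>The definite description is met by \<open>row_part\<close> and
  \<open>column_part\<close>. It is unique because a double centralizer with the prescribed values
  is determined on the elementary elements, whose span is dense.\<close>

lemma one_tensor_matrix_unit:
  fixes tensor :: "'a::cstar_algebra \<Rightarrow> nat operator \<Rightarrow> 'b::cstar_algebra"
  assumes tensor: "tensor_with_compacts tensor"
    and M: "matrix_system (\<lambda>i j x. tensor x (\<Theta> i j)) u"
  shows "one_tensor tensor (\<Theta> i i) =
    (matrix_system.row_part (\<lambda>i j x. tensor x (\<Theta> i j)) u i,
     matrix_system.column_part (\<lambda>i j x. tensor x (\<Theta> i j)) u i)"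
proof -
  interpret matrix_system "\<lambda>i j x. tensor x (\<Theta> i j)" u by (rule M)
  note mult = tensor_with_compactsD(4)[OF tensor]
  have tendsto: "(\<lambda>n. tensor (f n) k) \<longlonglongrightarrow> tensor x k" if "f \<longlonglongrightarrow> x" "k \<in> compact_operators" for f x k
  proof -
    have "bounded_clinear (\<lambda>x. tensor x k)"
      using tensor_with_compactsD(1,6)[OF tensor that(2,2)]
      by (intro bounded_clinearI[of _ "norm k"]) (simp_all add: clinear_def mult.commute)
    then show ?thesis using that(1) by (rule bounded_clinearD(8))
  qed
  have row: "row_part i (tensor x k) = tensor x (\<Theta> i i o\<^sub>L k)" if k: "k \<in> compact_operators" for x k
  proof (rule LIMSEQ_unique[OF row_tendsto])
    show "(\<lambda>n. tensor (u n) (\<Theta> i i) * tensor x k) \<longlonglongrightarrow> tensor x (\<Theta> i i o\<^sub>L k)"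
      unfolding mult[OF matrix_unit_compact k]
      by (intro tendsto u_left compose_compact[OF k clinear_matrix_unit])
  qed
  have column: "column_part i (tensor x k) = tensor x (k o\<^sub>L \<Theta> i i)" if k: "k \<in> compact_operators" for x k
  proof (rule LIMSEQ_unique[OF column_tendsto])
    show "(\<lambda>n. tensor x k * tensor (u n) (\<Theta> i i)) \<longlonglongrightarrow> tensor x (k o\<^sub>L \<Theta> i i)"
      unfolding mult[OF k matrix_unit_compact]
      by (intro tendsto u_right compact_compose_contraction[OF k clinear_matrix_unit]) simp
  qed
  show ?thesis
    unfolding one_tensor_def
  proof (rule the_equality)
    show "case (row_part i, column_part i) of (L, R) \<Rightarrow> double_centralizer (L, R) \<and>
        (\<forall>a. \<forall>k\<in>compact_operators. L (tensor a k) = tensor a (\<Theta> i i o\<^sub>L k) \<and> R (tensor a k) = tensor a (k o\<^sub>L \<Theta> i i))"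
      using bounded_clinear_row[of i] bounded_clinear_column[of i]
      by (simp add: double_centralizer_def bounded_clinear_def row column row_mult column_mult column_times)
    fix m assume m: "case m of (L, R) \<Rightarrow> double_centralizer (L, R) \<and>
        (\<forall>a. \<forall>k\<in>compact_operators. L (tensor a k) = tensor a (\<Theta> i i o\<^sub>L k) \<and> R (tensor a k) = tensor a (k o\<^sub>L \<Theta> i i))"
    obtain L R where LR: "m = (L, R)" by (cases m)
    have bc: "bounded_clinear L" "bounded_clinear R"
      using m by (simp_all add: LR double_centralizer_def bounded_clinear_def)
    have "L = row_part i"
      by (rule ext, rule E_ext[OF bc(1) bounded_clinear_row])
        (use m in \<open>simp add: LR row matrix_unit_compact\<close>)
    moreover have "R = column_part i"
      by (rule ext, rule E_ext[OF bc(2) bounded_clinear_column])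
        (use m in \<open>simp add: LR column matrix_unit_compact\<close>)
    ultimately show "m = (row_part i, column_part i)" by (simp add: LR)
  qed
qed

theorem theorem5p17:
  fixes a :: "nat \<Rightarrow> 'a::cstar_algebra"
    and tensor :: "'a \<Rightarrow> nat operator \<Rightarrow> 'b::cstar_algebra"  (infixl \<open>\<otimes>\<close> 72)
    and h :: 'b and C D :: "'b set"
  assumes "separable_space (euclidean :: 'a topology)"
    and "fell_algebra TYPE('a)"
    and "\<And>i. abelian_element (a i)"
    and "\<And>i. norm (a i) = 1"
    and "closed_ideal hull (range a) = UNIV"
    and "tensor_with_compacts (\<otimes>)"
    and h_def: "h = (\<Sum>i. (1 / real (i + 1)) *\<^sub>R (a i \<otimes> \<Theta> i i))"
    and C_def: "C = hereditary_subalgebra h"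
    and D_def: "D = {x. \<exists>d. (\<forall>i. d i \<in> hereditary_subalgebra (a i)) \<and> d \<longlonglongrightarrow> 0 \<and>
                          (\<lambda>i. d i \<otimes> \<Theta> i i) sums x}"
  shows "summable (\<lambda>i. (1 / real (i + 1)) *\<^sub>R (a i \<otimes> \<Theta> i i)) \<and>
    morita_equivalent C (UNIV :: 'a set) \<and>
    diagonal_pair C D \<and>
    (\<forall>P. faithful_conditional_expectation C D P \<longrightarrow>
      (\<forall>c\<in>C. (\<lambda>i. compress (one_tensor (\<otimes>) (\<Theta> i i)) c) sums P c))"
proof -
  obtain u :: "nat \<Rightarrow> 'a" where u: "\<And>n. norm (u n) \<le> 1" "\<And>x. (\<lambda>n. u n * x) \<longlonglongrightarrow> x" "\<And>x. (\<lambda>n. x * u n) \<longlonglongrightarrow> x"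
    using approximate_unit_separable[OF assms(1)] by blast
  define E where "E i j x = x \<otimes> \<Theta> i j" for i j x
  have E_eq: "E = (\<lambda>i j x. x \<otimes> \<Theta> i j)" by (simp add: E_def fun_eq_iff)
  have M: "matrix_system E u" unfolding E_eq by (rule tensor_matrix_system[OF assms(6) u])
  interpret A: abelian_sequence E u a h
    by (rule abelian_sequence.intro[OF M abelian_sequence_axioms.intro])
      (use assms(3,4) in \<open>simp_all add: h_def E_def\<close>)
  have C: "C = A.C" by (rule C_def)
  have D: "D = A.D" unfolding D_def A.D_eq by (simp add: E_def)
  have "J = UNIV" if "closed_ideal J" "range a \<subseteq> J" for J
    using hull_minimal[of "range a" J closed_ideal] that assms(5) by auto
  then have "morita_equivalent C (UNIV :: 'a set)"
    unfolding C by (rule A.morita_equivalent_C)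
  moreover have "summable (\<lambda>i. (1 / real (i + 1)) *\<^sub>R (a i \<otimes> \<Theta> i i))"
    using sums_summable[OF A.h_sums] unfolding A.E_scaleR unfolding E_def .
  moreover have "diagonal_pair C D"
    unfolding C D by (rule A.diagonal_pair_C_D[OF assms(1)])
  moreover have "(\<lambda>i. compress (one_tensor (\<otimes>) (\<Theta> i i)) c) sums P c"
    if P: "faithful_conditional_expectation C D P" and c: "c \<in> C" for P c
  proof -
    \<comment> \<open>Compression keeps only the entry (i, i), so the series is that of
      \<open>diagonal_part\<close>; uniqueness of the expectation transfers it to
      \<open>P\<close>.\<close>
    have "compress (one_tensor (\<otimes>) (\<Theta> i i)) c = E i i (A.entry i i c)" for i
      using one_tensor_matrix_unit[OF assms(6) M[unfolded E_eq], folded E_eq, of i]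
      by (simp add: compress_def A.E_entry)
    then show ?thesis
      using A.diagonal_part_sums[of c] A.conditional_expectation_unique[OF P[unfolded C D] c[unfolded C]]
      by simp
  qed
  ultimately show ?thesis by blast
qed

end
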